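(* Let $0<w\in L^1(\mathbb R)\cap L^\infty(\mathbb R)$. For each $\alpha\in\mathbb C$ with $|\alpha|=1$, the convergence $$\lim_{T\to\infty}\frac1{2T}\int_{-T}^Te^{itH_w^\alpha}\,dt=P$$ holds in the uniform operator topology on $\mathcal B(L^2_w(\mathbb R),L^2_w(\mathbb R))$, where $P$ is the orthogonal projection onto the kernel of $H_w^\alpha$.
   Context: $L^2_w(\mathbb R)$ is the Hilbert space of functions $f:\mathbb R\to\mathbb C$ with $\|f\|^2_{L^2_w(\mathbb R)}:=\int_{\mathbb R}|f|^2w\,dx<\infty$, with inner product $(f,g)_{L^2_w(\mathbb R)}=\int_{\mathbb R}f\overline g\,w\,dx$. Let $H_w=-\frac{i}{w}\frac{d}{dx}$ (derivative in the weak sense) and, for $|\alpha|=1$, $$D^\alpha=\left\{f\in L^2_w(\mathbb R)\ \Big|\ H_wf\in L^2_w(\mathbb R),\ \lim_{x\to\infty}f(x)=\alpha\lim_{x\to-\infty}f(x)\right\}.$$ The operator $H_w:D^\alpha\subset L^2_w(\mathbb R)\to L^2_w(\mathbb R)$ is essentially self-adjoint, and $H_w^\alpha$ denotes its unique self-adjoint extension. $\mathcal B(X,Y)$ denotes the bounded linear operators from $X$ to $Y$ with the operator norm. *)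

theory Defs
  imports "HOL-Analysis.Analysis"
begin

section \<open>The Hilbert space of square-integrable functions\<close>

text \<open>
  Vectors are represented by functions; two of them denote the same vector iff they agree almost
  everywhere. The inner product is linear in its first argument.
\<close>

definition L2 :: "'a measure \<Rightarrow> ('a \<Rightarrow> complex) set" where
  "L2 M = {f \<in> borel_measurable M. integrable M (\<lambda>x. (cmod (f x))\<^sup>2)}"

definition l2_inner :: "'a measure \<Rightarrow> ('a \<Rightarrow> complex) \<Rightarrow> ('a \<Rightarrow> complex) \<Rightarrow> complex" where
  "l2_inner M f g = (LINT x|M. f x * cnj (g x))"

definition l2_norm :: "'a measure \<Rightarrow> ('a \<Rightarrow> complex) \<Rightarrow> real" where
  "l2_norm M f = sqrt (LINT x|M. (cmod (f x))\<^sup>2)"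

definition weighted_measure :: "(real \<Rightarrow> real) \<Rightarrow> real measure" where
  "weighted_measure w = density lebesgue (\<lambda>x. ennreal (w x))"


section \<open>Bounded operators\<close>

definition bounded_ops ::
  "'a measure \<Rightarrow> (('a \<Rightarrow> complex) \<Rightarrow> ('a \<Rightarrow> complex)) set" where
  "bounded_ops M = {A.
     (\<forall>f\<in>L2 M. A f \<in> L2 M) \<and>
     (\<forall>f\<in>L2 M. \<forall>g\<in>L2 M. \<forall>c. AE x in M. A (\<lambda>y. f y + c * g y) x = A f x + c * A g x) \<and>
     (\<exists>C. \<forall>f\<in>L2 M. l2_norm M (A f) \<le> C * l2_norm M f)}"

definition op_norm ::
  "'a measure \<Rightarrow> (('a \<Rightarrow> complex) \<Rightarrow> ('a \<Rightarrow> complex)) \<Rightarrow> ennreal" where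
  "op_norm M A = (SUP f\<in>{f \<in> L2 M. l2_norm M f \<le> 1}. ennreal (l2_norm M (A f)))"

definition op_norm_tendsto ::
  "'a measure \<Rightarrow> ('b \<Rightarrow> ('a \<Rightarrow> complex) \<Rightarrow> ('a \<Rightarrow> complex)) \<Rightarrow>
   (('a \<Rightarrow> complex) \<Rightarrow> ('a \<Rightarrow> complex)) \<Rightarrow> 'b filter \<Rightarrow> bool" where
  "op_norm_tendsto M A B F \<longleftrightarrow>
     (\<forall>\<^sub>F T in F. A T \<in> bounded_ops M) \<and> B \<in> bounded_ops M \<and>
     ((\<lambda>T. op_norm M (\<lambda>f x. A T f x - B f x)) \<longlongrightarrow> 0) F"

definition orth_proj ::
  "'a measure \<Rightarrow> ('a \<Rightarrow> complex) set \<Rightarrow> ('a \<Rightarrow> complex) \<Rightarrow> ('a \<Rightarrow> complex)" where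
  "orth_proj M N f = (SOME p. p \<in> N \<and> (\<forall>g\<in>N. l2_inner M (\<lambda>x. f x - p x) g = 0))"


section \<open>Unbounded operators\<close>

text \<open>
  An unbounded operator is given by its graph, a set of pairs of representatives.
\<close>

type_synonym 'a graph = "(('a \<Rightarrow> complex) \<times> ('a \<Rightarrow> complex)) set"

definition op_kernel :: "'a graph \<Rightarrow> ('a \<Rightarrow> complex) set" where
  "op_kernel K = {f. (f, \<lambda>_. 0) \<in> K}"

definition densely_defined :: "'a measure \<Rightarrow> 'a graph \<Rightarrow> bool" where
  "densely_defined M K \<longleftrightarrow>
     (\<forall>f\<in>L2 M. \<forall>\<epsilon>>0. \<exists>(u, v)\<in>K. l2_norm M (\<lambda>x. f x - u x) < \<epsilon>)"

definition op_adjoint :: "'a measure \<Rightarrow> 'a graph \<Rightarrow> 'a graph" where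
  "op_adjoint M K =
     {(u, v). u \<in> L2 M \<and> v \<in> L2 M \<and> (\<forall>(f, g)\<in>K. l2_inner M g u = l2_inner M f v)}"

text \<open>
  An adjoint graph is linear and closed under changes on null sets, and the adjoint of a densely
  defined graph is single-valued up to null sets; so these properties of a self-adjoint graph
  need not be required separately.
\<close>

definition selfadjoint :: "'a measure \<Rightarrow> 'a graph \<Rightarrow> bool" where
  "selfadjoint M K \<longleftrightarrow> densely_defined M K \<and> op_adjoint M K = K"


section \<open>Spectral measures and functional calculus\<close>

definition projection_valued_measure ::
  "'a measure \<Rightarrow> (real set \<Rightarrow> ('a \<Rightarrow> complex) \<Rightarrow> ('a \<Rightarrow> complex)) \<Rightarrow> bool" where
  "projection_valued_measure M E \<longleftrightarrow>
     (\<forall>A\<in>sets borel. E A \<in> bounded_ops M) \<and>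
     (\<forall>A\<in>sets borel. \<forall>f\<in>L2 M. \<forall>g\<in>L2 M. l2_inner M (E A f) g = l2_inner M f (E A g)) \<and>
     (\<forall>A\<in>sets borel. \<forall>B\<in>sets borel. \<forall>f\<in>L2 M. AE x in M. E (A \<inter> B) f x = E A (E B f) x) \<and>
     (\<forall>f\<in>L2 M. AE x in M. E UNIV f x = f x) \<and>
     (\<forall>A :: nat \<Rightarrow> real set. range A \<subseteq> sets borel \<longrightarrow> disjoint_family A \<longrightarrow>
        (\<forall>f\<in>L2 M. \<forall>g\<in>L2 M.
           (\<lambda>n. l2_inner M (E (A n) f) g) sums l2_inner M (E (\<Union>n. A n) f) g))"

definition scalar_measure ::
  "'a measure \<Rightarrow> (real set \<Rightarrow> ('a \<Rightarrow> complex) \<Rightarrow> ('a \<Rightarrow> complex)) \<Rightarrow> ('a \<Rightarrow> complex) \<Rightarrow> real measure"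
  where
  "scalar_measure M E f = measure_of UNIV (sets borel) (\<lambda>A. ennreal (Re (l2_inner M (E A f) f)))"

definition spectral_domain ::
  "'a measure \<Rightarrow> (real set \<Rightarrow> ('a \<Rightarrow> complex) \<Rightarrow> ('a \<Rightarrow> complex)) \<Rightarrow> (real \<Rightarrow> complex) \<Rightarrow>
   ('a \<Rightarrow> complex) set" where
  "spectral_domain M E \<phi> =
     {f \<in> L2 M. integrable (scalar_measure M E f) (\<lambda>s. (cmod (\<phi> s))\<^sup>2)}"

text \<open>
  The operator \<open>\<integral> \<phi> dE\<close>, for a Borel function \<open>\<phi>\<close>. The integral of \<open>\<phi>\<close> against the complex measure
  \<open>A \<mapsto> (E A f, g)\<close> is expressed by polarization through the positive measures
  \<open>A \<mapsto> (E A h, h)\<close>, \<open>h = f + \<i>\<^sup>k g\<close>. These integrals exist for \<open>f\<close> and \<open>g\<close> in the domain, which is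
  dense, so that testing against such \<open>g\<close> determines the value at \<open>f\<close>.
\<close>

definition spectral_integral ::
  "'a measure \<Rightarrow> (real set \<Rightarrow> ('a \<Rightarrow> complex) \<Rightarrow> ('a \<Rightarrow> complex)) \<Rightarrow> (real \<Rightarrow> complex) \<Rightarrow> 'a graph"
  where
  "spectral_integral M E \<phi> = {(f, h). f \<in> spectral_domain M E \<phi> \<and> h \<in> L2 M \<and>
     (\<forall>g\<in>spectral_domain M E \<phi>.
        l2_inner M h g =
          (\<Sum>k<4. \<i> ^ k * (LINT s|scalar_measure M E (\<lambda>x. f x + \<i> ^ k * g x). \<phi> s)) / 4)}"

definition spectral_measure_of ::
  "'a measure \<Rightarrow> 'a graph \<Rightarrow> real set \<Rightarrow> ('a \<Rightarrow> complex) \<Rightarrow> ('a \<Rightarrow> complex)" where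
  "spectral_measure_of M K =
     (SOME E. projection_valued_measure M E \<and> spectral_integral M E (\<lambda>s. complex_of_real s) = K)"

text \<open>The unitary operator \<open>exp (\<i> t K)\<close> for self-adjoint \<open>K\<close>.\<close>

definition exp_it ::
  "'a measure \<Rightarrow> 'a graph \<Rightarrow> real \<Rightarrow> ('a \<Rightarrow> complex) \<Rightarrow> ('a \<Rightarrow> complex)" where
  "exp_it M K t f =
     (SOME h. (f, h) \<in> spectral_integral M (spectral_measure_of M K)
                          (\<lambda>s. exp (\<i> * complex_of_real t * complex_of_real s)))"


section \<open>Time averages\<close>

text \<open>The Riemann integral of a vector-valued function, with Riemann sums converging in norm.\<close>

definition has_strong_integral ::
  "'a measure \<Rightarrow> (real \<Rightarrow> ('a \<Rightarrow> complex)) \<Rightarrow> ('a \<Rightarrow> complex) \<Rightarrow> real set \<Rightarrow> bool" where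
  "has_strong_integral M F v J \<longleftrightarrow> v \<in> L2 M \<and>
     (\<forall>\<epsilon>>0. \<exists>\<delta>>0. \<forall>D. D tagged_division_of J \<and> (\<forall>(s, k)\<in>D. measure lborel k < \<delta>) \<longrightarrow>
        l2_norm M (\<lambda>x. (\<Sum>(s, k)\<in>D. measure lborel k *\<^sub>R F s x) - v x) < \<epsilon>)"

definition time_average ::
  "'a measure \<Rightarrow> (real \<Rightarrow> ('a \<Rightarrow> complex) \<Rightarrow> ('a \<Rightarrow> complex)) \<Rightarrow> real \<Rightarrow>
   ('a \<Rightarrow> complex) \<Rightarrow> ('a \<Rightarrow> complex)" where
  "time_average M U T f =
     (\<lambda>x. (SOME v. has_strong_integral M (\<lambda>t. U t f) v {-T..T}) x / complex_of_real (2 * T))"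


section \<open>The operator\<close>

definition test_function :: "(real \<Rightarrow> real) \<Rightarrow> bool" where
  "test_function \<phi> \<longleftrightarrow>
     (\<forall>n x. (deriv ^^ n) \<phi> field_differentiable (at x)) \<and> (\<exists>R. \<forall>x. \<bar>x\<bar> > R \<longrightarrow> \<phi> x = 0)"

definition locally_integrable :: "(real \<Rightarrow> complex) \<Rightarrow> bool" where
  "locally_integrable f \<longleftrightarrow> (\<forall>a b. f absolutely_integrable_on {a..b})"

definition has_weak_derivative :: "(real \<Rightarrow> complex) \<Rightarrow> (real \<Rightarrow> complex) \<Rightarrow> bool" where
  "has_weak_derivative f g \<longleftrightarrow> locally_integrable f \<and> locally_integrable g \<and>
     (\<forall>\<phi>. test_function \<phi> \<longrightarrow>
        (LINT x|lebesgue. f x * complex_of_real (deriv \<phi> x)) =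
        - (LINT x|lebesgue. g x * complex_of_real (\<phi> x)))"

text \<open>
  The boundary condition refers to the continuous representative of \<open>f\<close>.
\<close>

definition boundary_condition :: "complex \<Rightarrow> (real \<Rightarrow> complex) \<Rightarrow> bool" where
  "boundary_condition \<alpha> f \<longleftrightarrow>
     (\<exists>u lp lm. continuous_on UNIV u \<and> (AE x in lebesgue. u x = f x) \<and>
        (u \<longlongrightarrow> lp) at_top \<and> (u \<longlongrightarrow> lm) at_bot \<and> lp = \<alpha> * lm)"

text \<open>The graph of \<open>H\<^sub>w = -(\<i>/w) d/dx\<close> with domain \<open>D\<^sup>\<alpha>\<close>.\<close>

definition H_graph :: "(real \<Rightarrow> real) \<Rightarrow> complex \<Rightarrow> real graph" where
  "H_graph w \<alpha> = {(f, h). f \<in> L2 (weighted_measure w) \<and> h \<in> L2 (weighted_measure w) \<and>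
     (\<exists>g. has_weak_derivative f g \<and>
        (AE x in lebesgue. h x = - (\<i> / complex_of_real (w x)) * g x)) \<and>
     boundary_condition \<alpha> f}"

definition H_op :: "(real \<Rightarrow> real) \<Rightarrow> complex \<Rightarrow> real graph" where
  "H_op w \<alpha> = (THE K. selfadjoint (weighted_measure w) K \<and> H_graph w \<alpha> \<subseteq> K)"

end

theory Submission
  imports Defs
begin

text \<open>
  The substitution \<open>s = W x\<close>, where \<open>W\<close> is the primitive of \<open>w\<close> that vanishes at \<open>-\<infinity>\<close>, carries
  \<open>L\<^sup>2\<close> of the weighted line to \<open>L\<^sup>2(0, L)\<close>, where \<open>L\<close> is the total weight, and it carries \<open>H\<^sub>w\<close> to
  \<open>-\<i> d/ds\<close> with the boundary condition \<open>f(L) = \<alpha> f(0)\<close>. So the functions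
  \<open>e\<^sub>n = exp (\<i> \<lambda>\<^sub>n W) / \<surd>L\<close> with \<open>\<lambda>\<^sub>n = (Arg \<alpha> + 2 \<pi> n) / L\<close> form an orthonormal basis of
  eigenfunctions. The eigenvalues form an arithmetic progression; in particular those that differ
  from \<open>0\<close> keep a distance \<open>\<delta> > 0\<close> from \<open>0\<close>.

  In the coordinates of this basis \<open>exp (\<i> t H)\<close> multiplies the \<open>n\<close>-th coefficient by
  \<open>exp (\<i> t \<lambda>\<^sub>n)\<close>, its mean over \<open>[-T, T]\<close> multiplies it by a number that is \<open>1\<close> if \<open>\<lambda>\<^sub>n = 0\<close> and has
  modulus at most \<open>1 / (T \<bar>\<lambda>\<^sub>n\<bar>)\<close> otherwise, and the projection onto the kernel multiplies it by \<open>1\<close> or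
  by \<open>0\<close> accordingly. The difference of the last two is a multiplier bounded by \<open>1 / (T \<delta>)\<close>, uniformly
  in \<open>n\<close>, and the operator norm of a multiplier is at most its supremum. This is
  \<open>time_averages_converge_if_gap\<close>, which holds for every operator that is diagonal with such a gap.

  Two points carry most of the work. First, the exponential is defined by some spectral
  measure of \<open>H\<close>, about which nothing else is known; \<open>eigenvector_spectral_projection\<close>
  shows that it acts on each eigenvector in the expected way, so that it is diagonal
  as well (\<open>spectral_family_if_spectral_integral\<close>). Second, \<open>H_op_eq_diag\<close> identifies \<open>H\<close> with the
  diagonal operator. It rests on the completeness of the exponentials (\<open>basis_complete\<close>),
  on the lemma of du Bois-Reymond, by which the weak derivative determines a function up to a
  constant, and on \<open>green_formula\<close>, which relates the coefficients of \<open>u\<close> and of \<open>H u\<close> up to a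
  boundary term that does not depend on \<open>n\<close>.
\<close>

section \<open>Square-integrable functions\<close>

lemma L2_measurable [measurable_dest]: "f \<in> L2 M \<Longrightarrow> f \<in> borel_measurable M"
  by (simp add: L2_def)

lemma L2_integrable: "f \<in> L2 M \<Longrightarrow> integrable M (\<lambda>x. (cmod (f x))\<^sup>2)"
  by (simp add: L2_def)

lemma L2_cong_AE:
  assumes "f \<in> L2 M" "g \<in> borel_measurable M" "AE x in M. f x = g x"
  shows "g \<in> L2 M"
proof -
  have "integrable M (\<lambda>x. (cmod (g x))\<^sup>2)"
    by (rule integrable_cong_AE_imp[OF L2_integrable[OF assms(1)]]) (use assms in auto)
  then show ?thesis
    using assms by (simp add: L2_def)
qed

lemma borel_measurable_cnj [measurable (raw)]:
  "f \<in> borel_measurable M \<Longrightarrow> (\<lambda>x. cnj (f x)) \<in> borel_measurable M"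
  by (rule measurable_compose[OF _ borel_measurable_continuous_onI]) (auto intro: continuous_intros)

lemma integrable_L2_mult:
  assumes "f \<in> L2 M" "g \<in> L2 M"
  shows "integrable M (\<lambda>x. f x * cnj (g x))"
proof (rule Bochner_Integration.integrable_bound)
  show "integrable M (\<lambda>x. (cmod (f x))\<^sup>2 + (cmod (g x))\<^sup>2)"
    using assms by (intro Bochner_Integration.integrable_add L2_integrable)
  show "(\<lambda>x. f x * cnj (g x)) \<in> borel_measurable M"
    using assms by (auto intro!: borel_measurable_times dest: L2_measurable)
  have "cmod a * cmod b \<le> (cmod a)\<^sup>2 + (cmod b)\<^sup>2" for a b :: complex
    using sum_squares_bound[of "cmod a" "cmod b"] mult_nonneg_nonneg[of "cmod a" "cmod b"] norm_ge_zero[of a] norm_ge_zero[of b]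
    by linarith
  then show "AE x in M. norm (f x * cnj (g x)) \<le> norm ((cmod (f x))\<^sup>2 + (cmod (g x))\<^sup>2)"
    by (simp add: norm_mult)
qed

lemma L2_lincomb:
  assumes f: "f \<in> L2 M" and g: "g \<in> L2 M"
  shows "(\<lambda>x. f x + c * g x) \<in> L2 M"
proof -
  have "integrable M (\<lambda>x. (cmod (f x + c * g x))\<^sup>2)"
  proof (rule Bochner_Integration.integrable_bound)
    show "integrable M (\<lambda>x. 2 * (cmod (f x))\<^sup>2 + 2 * (cmod c)\<^sup>2 * (cmod (g x))\<^sup>2)"
      using f g by (intro Bochner_Integration.integrable_add integrable_mult_right L2_integrable)
    show "(\<lambda>x. (cmod (f x + c * g x))\<^sup>2) \<in> borel_measurable M"
      using f g by (auto dest!: L2_measurable)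
    have "(cmod (a + c * b))\<^sup>2 \<le> 2 * (cmod a)\<^sup>2 + 2 * (cmod c)\<^sup>2 * (cmod b)\<^sup>2" for a b
    proof -
      have "(cmod (a + c * b))\<^sup>2 \<le> (cmod a + cmod (c * b))\<^sup>2"
        by (intro power_mono norm_triangle_ineq) auto
      also have "\<dots> \<le> 2 * (cmod a)\<^sup>2 + 2 * (cmod (c * b))\<^sup>2"
        using sum_squares_bound[of "cmod a" "cmod (c * b)"] by (simp add: power2_sum)
      finally show ?thesis
        by (simp add: norm_mult power_mult_distrib)
    qed
    then show "AE x in M. norm ((cmod (f x + c * g x))\<^sup>2)
        \<le> norm (2 * (cmod (f x))\<^sup>2 + 2 * (cmod c)\<^sup>2 * (cmod (g x))\<^sup>2)"
      by (simp add: abs_of_nonneg)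
  qed
  then show ?thesis
    using f g by (auto simp: L2_def)
qed

lemma L2_zero [simp]: "(\<lambda>_. 0) \<in> L2 M"
  by (simp add: L2_def)

lemma L2_scale: "f \<in> L2 M \<Longrightarrow> (\<lambda>x. c * f x) \<in> L2 M"
  using L2_lincomb[of "\<lambda>_. 0" M f c] by simp

lemma L2_add: "f \<in> L2 M \<Longrightarrow> g \<in> L2 M \<Longrightarrow> (\<lambda>x. f x + g x) \<in> L2 M"
  using L2_lincomb[of f M g 1] by simp

lemma L2_diff: "f \<in> L2 M \<Longrightarrow> g \<in> L2 M \<Longrightarrow> (\<lambda>x. f x - g x) \<in> L2 M"
  using L2_lincomb[of f M g "-1"] by simp

lemma L2_sum: "(\<And>i. i \<in> I \<Longrightarrow> f i \<in> L2 M) \<Longrightarrow> (\<lambda>x. \<Sum>i\<in>I. f i x) \<in> L2 M"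
  by (induction I rule: infinite_finite_induct) (auto intro: L2_add)

lemma L2_bounded_mult:
  assumes f: "f \<in> L2 M" and m: "m \<in> borel_measurable M" and bound: "\<And>x. cmod (m x) \<le> C"
  shows "(\<lambda>x. m x * f x) \<in> L2 M"
proof -
  have "integrable M (\<lambda>x. (cmod (m x * f x))\<^sup>2)"
  proof (rule Bochner_Integration.integrable_bound)
    show "integrable M (\<lambda>x. C\<^sup>2 * (cmod (f x))\<^sup>2)"
      using f by (intro integrable_mult_right L2_integrable)
    show "(\<lambda>x. (cmod (m x * f x))\<^sup>2) \<in> borel_measurable M"
      using f m by (auto dest!: L2_measurable)
    have "(cmod (m x))\<^sup>2 \<le> C\<^sup>2" for x
      by (rule power_mono[OF bound]) simp
    then show "AE x in M. norm ((cmod (m x * f x))\<^sup>2) \<le> norm (C\<^sup>2 * (cmod (f x))\<^sup>2)"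
      by (simp add: norm_mult power_mult_distrib mult_right_mono)
  qed
  then show ?thesis
    using f m by (auto simp: L2_def)
qed

lemma l2_inner_lincomb_left:
  assumes "f \<in> L2 M" "g \<in> L2 M" "h \<in> L2 M"
  shows "l2_inner M (\<lambda>x. f x + c * g x) h = l2_inner M f h + c * l2_inner M g h"
  using integrable_L2_mult[OF assms(1,3)] integrable_L2_mult[OF assms(2,3)]
  by (simp add: l2_inner_def distrib_right mult.assoc)

lemma cnj_l2_inner: "cnj (l2_inner M f g) = l2_inner M g f"
proof -
  have "cnj (l2_inner M f g) = (LINT x|M. cnj (f x * cnj (g x)))"
    unfolding l2_inner_def by (rule Bochner_Integration.integral_cnj[symmetric])
  then show ?thesis
    by (simp add: l2_inner_def mult.commute del: Bochner_Integration.integral_cnj)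
qed

lemma l2_inner_lincomb_right:
  assumes "f \<in> L2 M" "g \<in> L2 M" "h \<in> L2 M"
  shows "l2_inner M h (\<lambda>x. f x + c * g x) = l2_inner M h f + cnj c * l2_inner M h g"
  by (subst (1 2 3) cnj_l2_inner[symmetric]) (simp add: l2_inner_lincomb_left assms)

lemma l2_inner_zero_left [simp]: "l2_inner M (\<lambda>_. 0) g = 0"
  by (simp add: l2_inner_def)

lemma l2_inner_scale_left:
  "f \<in> L2 M \<Longrightarrow> h \<in> L2 M \<Longrightarrow> l2_inner M (\<lambda>x. c * f x) h = c * l2_inner M f h"
  using l2_inner_lincomb_left[of "\<lambda>_. 0" M f h c] by simp

lemma l2_inner_diff_left:
  "f \<in> L2 M \<Longrightarrow> g \<in> L2 M \<Longrightarrow> h \<in> L2 M \<Longrightarrow>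
    l2_inner M (\<lambda>x. f x - g x) h = l2_inner M f h - l2_inner M g h"
  using l2_inner_lincomb_left[of f M g h "-1"] by simp

lemma l2_inner_sum_left:
  assumes "\<And>i. i \<in> I \<Longrightarrow> f i \<in> L2 M" "h \<in> L2 M"
  shows "l2_inner M (\<lambda>x. \<Sum>i\<in>I. f i x) h = (\<Sum>i\<in>I. l2_inner M (f i) h)"
  using assms(1)
proof (induction I rule: infinite_finite_induct)
  case (insert i I)
  then show ?case
    using l2_inner_lincomb_left[of "f i" M "\<lambda>x. \<Sum>i\<in>I. f i x" h 1] assms(2)
    by (simp add: L2_sum)
qed simp_all

lemma l2_inner_cong_AE:
  assumes "f \<in> L2 M" "f' \<in> L2 M" "g \<in> L2 M" "AE x in M. f x = f' x"
  shows "l2_inner M f g = l2_inner M f' g"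
  unfolding l2_inner_def using assms by (intro integral_cong_AE) (auto dest!: L2_measurable)

lemma l2_norm_nonneg [simp]: "0 \<le> l2_norm M f"
  by (simp add: l2_norm_def)

lemma l2_norm_power2: "(l2_norm M f)\<^sup>2 = (LINT x|M. (cmod (f x))\<^sup>2)"
  by (simp add: l2_norm_def)

lemma l2_inner_self: "l2_inner M f f = complex_of_real ((l2_norm M f)\<^sup>2)"
  by (simp add: l2_inner_def l2_norm_power2 integral_complex_of_real[symmetric] complex_norm_square
      del: of_real_power)

lemma l2_norm_eq_0_imp_AE:
  assumes "f \<in> L2 M" "l2_norm M f = 0"
  shows "AE x in M. f x = 0"
proof -
  have "AE x in M. (cmod (f x))\<^sup>2 = 0"
    using assms integral_nonneg_eq_0_iff_AE[OF L2_integrable[OF assms(1)]]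
    by (simp add: l2_norm_def)
  then show ?thesis by simp
qed

lemma l2_norm_lincomb:
  assumes f: "f \<in> L2 M" and g: "g \<in> L2 M"
  shows "(l2_norm M (\<lambda>x. f x + c * g x))\<^sup>2 =
    (l2_norm M f)\<^sup>2 + 2 * Re (cnj c * l2_inner M f g) + (cmod c)\<^sup>2 * (l2_norm M g)\<^sup>2"
proof -
  have *: "cnj c * (c * z) = of_real ((cmod c)\<^sup>2) * z" for z
    using complex_norm_square[of c] by (simp add: mult.commute mult.left_commute)
  have "complex_of_real ((l2_norm M (\<lambda>x. f x + c * g x))\<^sup>2)
     = l2_inner M (\<lambda>x. f x + c * g x) (\<lambda>x. f x + c * g x)"
    by (rule l2_inner_self[symmetric])
  also have "\<dots> = l2_inner M f f + cnj c * l2_inner M f g + c * l2_inner M g f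
      + cnj c * (c * l2_inner M g g)"
    using f g by (simp add: l2_inner_lincomb_left l2_inner_lincomb_right L2_lincomb algebra_simps)
  also have "\<dots> = of_real ((l2_norm M f)\<^sup>2) + (cnj c * l2_inner M f g + cnj (cnj c * l2_inner M f g))
      + of_real ((cmod c)\<^sup>2 * (l2_norm M g)\<^sup>2)"
    by (simp add: * l2_inner_self cnj_l2_inner)
  also have "\<dots> = of_real ((l2_norm M f)\<^sup>2 + 2 * Re (cnj c * l2_inner M f g)
      + (cmod c)\<^sup>2 * (l2_norm M g)\<^sup>2)"
    by (simp only: complex_add_cnj of_real_add of_real_mult of_real_numeral)
  finally show ?thesis
    by (simp only: of_real_eq_iff)
qed

lemma l2_norm_diff:
  assumes f: "f \<in> L2 M" and g: "g \<in> L2 M"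
  shows "(l2_norm M (\<lambda>x. f x - g x))\<^sup>2 =
    (l2_norm M f)\<^sup>2 - 2 * Re (l2_inner M f g) + (l2_norm M g)\<^sup>2"
  using l2_norm_lincomb[OF assms, of "-1"] by simp

lemma sum_lessThan_4: "(\<Sum>k<4. h k) = h 0 + h 1 + h 2 + (h (3::nat) :: complex)"
  by (simp add: eval_nat_numeral)

text \<open>
  Both the inner product and the spectral integral are compared through their diagonal values, by
  this pointwise identity.
\<close>

lemma polarization:
  "a * cnj b = (\<Sum>k<4. \<i> ^ k * complex_of_real ((cmod (a + \<i> ^ k * b))\<^sup>2)) / 4"
  unfolding sum_lessThan_4 complex_norm_square
  by (simp add: power3_eq_cube algebra_simps)

lemma l2_inner_polarization:
  assumes f: "f \<in> L2 M" and g: "g \<in> L2 M"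
  shows "l2_inner M f g =
    (\<Sum>k<4. \<i> ^ k * complex_of_real ((l2_norm M (\<lambda>x. f x + \<i> ^ k * g x))\<^sup>2)) / 4"
proof -
  have "l2_inner M f g =
    (LINT x|M. (\<Sum>k<4. \<i> ^ k * complex_of_real ((cmod (f x + \<i> ^ k * g x))\<^sup>2)) / 4)"
    unfolding l2_inner_def by (subst polarization) simp
  also have "\<dots> = (\<Sum>k<4. \<i> ^ k * (LINT x|M. complex_of_real ((cmod (f x + \<i> ^ k * g x))\<^sup>2))) / 4"
    using L2_integrable[OF L2_lincomb[OF f g]]
    by (simp del: of_real_power)
  finally show ?thesis
    by (simp only: l2_norm_power2 integral_complex_of_real)
qed

section \<open>Orthonormal bases\<close>

text \<open>
  Coefficient sequences are square-integrable functions for the counting measure, so everything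
  proved about \<open>L2\<close> applies to them, and sums over the integers are Bochner integrals.
\<close>

abbreviation Zs :: "int measure" where "Zs \<equiv> count_space UNIV"

text \<open>
  Finite sets that exhaust the integers: sums over all integers are limits of sums over windows.
\<close>

definition window :: "nat \<Rightarrow> int set" where
  "window N = {- int N..int N}"

lemma finite_window [simp]: "finite (window N)"
  by (simp add: window_def)

lemma window_mono: "M \<le> N \<Longrightarrow> window M \<subseteq> window N"
  by (auto simp: window_def)

lemma eventually_window: "\<forall>\<^sub>F N in sequentially. n \<in> window N"
  using eventually_ge_at_top[of "nat \<bar>n\<bar>"]
  by eventually_elim (auto simp: window_def)

lemma sum_finite_eq_integral:
  fixes g :: "int \<Rightarrow> 'b :: {banach, second_countable_topology}"
  assumes "finite I"
  shows "(LINT n|Zs. indicator I n *\<^sub>R g n) = sum g I"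
proof -
  have "(LINT n|Zs. indicator I n *\<^sub>R g n) = (\<Sum>n | indicator I n *\<^sub>R g n \<noteq> 0. indicator I n *\<^sub>R g n)"
    using lebesgue_integral_count_space_finite_support[of UNIV "\<lambda>n. indicator I n *\<^sub>R g n"] assms
    by (auto simp: indicator_def intro: finite_subset[of _ I])
  also have "\<dots> = sum g I"
    using assms by (intro sum.mono_neutral_cong_left) (auto simp: indicator_def)
  finally show ?thesis .
qed

lemma sum_window_tendsto:
  fixes g :: "int \<Rightarrow> 'b :: {banach, second_countable_topology}"
  assumes "integrable Zs g"
  shows "(\<lambda>N. sum g (window N)) \<longlonglongrightarrow> integral\<^sup>L Zs g"
proof -
  have "(\<lambda>N. LINT n|Zs. indicator (window N) n *\<^sub>R g n) \<longlonglongrightarrow> integral\<^sup>L Zs g"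
  proof (rule integral_dominated_convergence)
    show "integrable Zs (\<lambda>n. norm (g n))"
      using assms by simp
    have "(\<lambda>N. indicator (window N) n *\<^sub>R g n) \<longlonglongrightarrow> g n" for n
      by (rule tendsto_eventually) (use eventually_window[of n] in \<open>auto elim: eventually_mono\<close>)
    then show "AE n in Zs. (\<lambda>N. indicator (window N) n *\<^sub>R g n) \<longlonglongrightarrow> g n"
      by simp
  qed (auto simp: indicator_def)
  then show ?thesis
    by (simp add: sum_finite_eq_integral)
qed

lemma L2_ZsI:
  assumes "\<And>I. finite I \<Longrightarrow> (\<Sum>n\<in>I. (cmod (c n))\<^sup>2) \<le> B"
  shows "c \<in> L2 Zs"
proof -
  have "(\<lambda>n. (cmod (c n))\<^sup>2) summable_on UNIV"
    using assms by (intro nonneg_bdd_above_summable_on) (auto simp: bdd_above_def)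
  then have "Infinite_Sum.abs_summable_on (\<lambda>n. (cmod (c n))\<^sup>2) UNIV"
    by simp
  then have "integrable Zs (\<lambda>n. (cmod (c n))\<^sup>2)"
    unfolding abs_summable_equivalent Infinite_Set_Sum.abs_summable_on_def .
  then show ?thesis
    by (simp add: L2_def)
qed

locale l2_basis = finite_measure M for M :: "'a measure" +
  fixes e :: "int \<Rightarrow> 'a \<Rightarrow> complex"
  assumes e_L2: "e n \<in> L2 M"
    and orthonormal: "l2_inner M (e n) (e m) = (if n = m then 1 else 0)"
    and complete: "\<lbrakk>f \<in> L2 M; \<And>n. l2_inner M f (e n) = 0\<rbrakk> \<Longrightarrow> AE x in M. f x = 0"
begin

definition hat :: "('a \<Rightarrow> complex) \<Rightarrow> int \<Rightarrow> complex" where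
  "hat f n = l2_inner M f (e n)"

definition synth :: "int set \<Rightarrow> (int \<Rightarrow> complex) \<Rightarrow> 'a \<Rightarrow> complex" where
  "synth I c x = (\<Sum>n\<in>I. c n * e n x)"

lemma hat_lincomb: "f \<in> L2 M \<Longrightarrow> g \<in> L2 M \<Longrightarrow> hat (\<lambda>x. f x + c * g x) n = hat f n + c * hat g n"
  by (simp add: hat_def l2_inner_lincomb_left e_L2)

lemma hat_diff: "f \<in> L2 M \<Longrightarrow> g \<in> L2 M \<Longrightarrow> hat (\<lambda>x. f x - g x) n = hat f n - hat g n"
  by (simp add: hat_def l2_inner_diff_left e_L2)

lemma hat_scale: "f \<in> L2 M \<Longrightarrow> hat (\<lambda>x. c * f x) n = c * hat f n"
  by (simp add: hat_def l2_inner_scale_left e_L2)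

lemma hat_sum:
  "(\<And>i. i \<in> I \<Longrightarrow> f i \<in> L2 M) \<Longrightarrow> hat (\<lambda>x. \<Sum>i\<in>I. f i x) n = (\<Sum>i\<in>I. hat (f i) n)"
  by (simp add: hat_def l2_inner_sum_left e_L2)

lemma hat_basis: "hat (e m) n = (if n = m then 1 else 0)"
  by (auto simp: hat_def orthonormal)

lemma hat_zero [simp]: "hat (\<lambda>_. 0) n = 0"
  by (simp add: hat_def)

lemma eq_AE_if_hat_eq:
  assumes "f \<in> L2 M" "g \<in> L2 M" "\<And>n. hat f n = hat g n"
  shows "AE x in M. f x = g x"
proof -
  have "AE x in M. f x - g x = 0"
    using assms by (intro complete L2_diff) (auto simp: l2_inner_diff_left e_L2 hat_def)
  then show ?thesis
    by simp
qed

lemma synth_L2: "synth I c \<in> L2 M"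
  unfolding synth_def[abs_def] by (intro L2_sum L2_scale e_L2)

lemma hat_synth: "finite I \<Longrightarrow> hat (synth I c) n = (if n \<in> I then c n else 0)"
  unfolding synth_def[abs_def] by (simp add: hat_sum L2_scale e_L2 hat_scale hat_basis if_distrib cong: if_cong)

lemma l2_inner_synth_left:
  assumes "g \<in> L2 M"
  shows "l2_inner M (synth I c) g = (\<Sum>n\<in>I. c n * cnj (hat g n))"
  unfolding synth_def[abs_def] using assms
  by (simp add: l2_inner_sum_left L2_scale e_L2 l2_inner_scale_left hat_def cnj_l2_inner)

lemma l2_norm_synth: 
  assumes "finite I" 
  shows "(l2_norm M (synth I c))\<^sup>2 = (\<Sum>n\<in>I. (cmod (c n))\<^sup>2)"
proof -
  have "complex_of_real ((l2_norm M (synth I c))\<^sup>2) = (\<Sum>n\<in>I. c n * cnj (c n))"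
    using assms by (simp only: l2_inner_self[symmetric] l2_inner_synth_left synth_L2 hat_synth cong: sum.cong) simp
  also have "\<dots> = complex_of_real (\<Sum>n\<in>I. (cmod (c n))\<^sup>2)"
    by (simp add: complex_norm_square del: of_real_power)
  finally show ?thesis
    by (simp only: of_real_eq_iff)
qed

lemma synth_diff:
  assumes "finite I" "J \<subseteq> I"
  shows "synth I c x - synth J c x = synth (I - J) c x"
  unfolding synth_def using sum_diff[OF assms, of "\<lambda>n. c n * e n x"] by simp

lemma l2_norm_minus_projection:
  assumes f: "f \<in> L2 M" and I: "finite I"
  shows "(l2_norm M (\<lambda>x. f x - synth I (hat f) x))\<^sup>2 = (l2_norm M f)\<^sup>2 - (\<Sum>n\<in>I. (cmod (hat f n))\<^sup>2)"
proof -
  have "l2_inner M (synth I (hat f)) f = complex_of_real (\<Sum>n\<in>I. (cmod (hat f n))\<^sup>2)"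
    using f by (simp add: l2_inner_synth_left complex_norm_square del: of_real_power)
  then have "l2_inner M f (synth I (hat f)) = complex_of_real (\<Sum>n\<in>I. (cmod (hat f n))\<^sup>2)"
    by (metis cnj_l2_inner complex_cnj_complex_of_real)
  then show ?thesis
    using l2_norm_diff[OF f synth_L2, of I "hat f"] l2_norm_synth[OF I, of "hat f"] by simp
qed

lemma Bessel:
  assumes "f \<in> L2 M" "finite I"
  shows "(\<Sum>n\<in>I. (cmod (hat f n))\<^sup>2) \<le> (l2_norm M f)\<^sup>2"
  using l2_norm_minus_projection[OF assms] zero_le_power2[of "l2_norm M (\<lambda>x. f x - synth I (hat f) x)"]
  by linarith

lemma hat_L2: "f \<in> L2 M \<Longrightarrow> hat f \<in> L2 Zs"
  by (rule L2_ZsI) (rule Bessel)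

lemma norm_hat_le: "f \<in> L2 M \<Longrightarrow> cmod (hat f n) \<le> l2_norm M f"
  using Bessel[of f "{n}"] power2_le_imp_le by fastforce

text \<open>
  The partial sums form a Cauchy sequence in \<open>L\<^sup>2\<close>, hence in \<open>L\<^sup>1\<close> because the measure is finite, hence
  a subsequence converges almost everywhere; Fatou's lemma gives the bound on the distance of the
  limit from the partial sums. The bound is kept in the conclusion since Parseval's equation is
  read off from it.
\<close>

lemma Riesz_Fischer_tail:
  assumes c: "c \<in> L2 Zs"
  obtains f where "f \<in> L2 M" "\<And>n. hat f n = c n"
    "\<And>N. (l2_norm M (\<lambda>x. f x - synth (window N) c x))\<^sup>2
           \<le> (l2_norm Zs c)\<^sup>2 - (\<Sum>n\<in>window N. (cmod (c n))\<^sup>2)"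
proof -
  define s where "s N = synth (window N) c" for N
  define tail where "tail N = (l2_norm Zs c)\<^sup>2 - (\<Sum>n\<in>window N. (cmod (c n))\<^sup>2)" for N
  have s_L2: "s N \<in> L2 M" for N
    by (simp add: s_def synth_L2)
  have s_meas [measurable]: "s N \<in> borel_measurable M" for N
    by (rule L2_measurable[OF s_L2])
  have lim: "(\<lambda>N. \<Sum>n\<in>window N. (cmod (c n))\<^sup>2) \<longlonglongrightarrow> (l2_norm Zs c)\<^sup>2"
    unfolding l2_norm_power2 by (rule sum_window_tendsto[OF L2_integrable[OF c]])
  have mono: "(\<Sum>n\<in>window N. (cmod (c n))\<^sup>2) \<le> (\<Sum>n\<in>window K. (cmod (c n))\<^sup>2)" if "N \<le> K" for N K
    by (rule sum_mono2) (use window_mono[OF that] in auto)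
  have le: "(\<Sum>n\<in>window N. (cmod (c n))\<^sup>2) \<le> (l2_norm Zs c)\<^sup>2" for N
    by (rule Lim_bounded2[OF lim]) (use mono in auto)
  have tail0: "tail \<longlonglongrightarrow> 0"
    unfolding tail_def[abs_def] using tendsto_diff[OF tendsto_const lim, of "(l2_norm Zs c)\<^sup>2"] by simp
  have tail_mono: "tail K \<le> tail N" if "N \<le> K" for N K
    using mono[OF that] by (simp add: tail_def)
  have diff_le: "(l2_norm M (\<lambda>x. s K x - s N x))\<^sup>2 \<le> tail N" if "N \<le> K" for N K
  proof -
    have "(l2_norm M (\<lambda>x. s K x - s N x))\<^sup>2 = (\<Sum>n\<in>window K - window N. (cmod (c n))\<^sup>2)"
      unfolding s_def using window_mono[OF that] by (simp add: synth_diff l2_norm_synth)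
    also have "\<dots> = (\<Sum>n\<in>window K. (cmod (c n))\<^sup>2) - (\<Sum>n\<in>window N. (cmod (c n))\<^sup>2)"
      using window_mono[OF that] by (simp add: sum_diff)
    finally show ?thesis
      using le[of K] by (simp add: tail_def)
  qed
  have diff_le': "(LINT x|M. (cmod (s i x - s j x))\<^sup>2) \<le> tail N" if "N \<le> i" "N \<le> j" for i j N
  proof (cases "i \<le> j")
    case True
    then show ?thesis
      using diff_le[OF True] tail_mono[OF that(1)] by (simp add: l2_norm_power2 norm_minus_commute)
  next
    case False
    then show ?thesis
      using diff_le[of j i] tail_mono[OF that(2)] by (simp add: l2_norm_power2)
  qed
  have s_int: "integrable M (s N)" for N
  proof (rule Bochner_Integration.integrable_bound)
    show "integrable M (\<lambda>x. 1 + (cmod (s N x))\<^sup>2)"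
      using L2_integrable[OF s_L2] by simp
    have "t \<le> 1 + t\<^sup>2" for t :: real
    proof -
      have "2 * t \<le> 1 + t\<^sup>2"
        using sum_squares_bound[of 1 t] by simp
      then show ?thesis
        using zero_le_power2[of t] by linarith
    qed
    then show "AE x in M. norm (s N x) \<le> norm (1 + (cmod (s N x))\<^sup>2)"
      by (simp add: abs_of_nonneg)
  qed simp
  have cauchy: "\<exists>N. \<forall>i\<ge>N. \<forall>j\<ge>N. (LINT x|M. norm (s i x - s j x)) < r" if "r > 0" for r
  proof -
    define \<mu> where "\<mu> = measure M (space M)"
    define \<eta> where "\<eta> = r / (2 * (\<mu> + 1))"
    have \<mu>: "0 \<le> \<mu>"
      by (simp add: \<mu>_def)
    then have \<eta>: "\<eta> > 0"
      using that by (simp add: \<eta>_def)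
    have "\<eta> * (\<mu> + 1) = r / 2"
      using \<mu> by (simp add: \<eta>_def divide_simps)
    then have \<eta>': "\<eta> * \<mu> \<le> r / 2"
      using \<eta> by (simp add: distrib_left)
    have "\<forall>\<^sub>F N in sequentially. tail N < \<eta> * r / 2"
      using \<eta> that by (intro order_tendstoD(2)[OF tail0]) simp
    then obtain N where N: "tail N < \<eta> * r / 2"
      by (rule eventually_happens'[OF sequentially_bot, THEN exE])
    have "(LINT x|M. norm (s i x - s j x)) < r" if "N \<le> i" "N \<le> j" for i j
    proof -
      have L2: "(\<lambda>x. s i x - s j x) \<in> L2 M"
        by (intro L2_diff s_L2)
      \<comment> \<open>This replaces the Cauchy-Schwarz inequality in the passage from \<open>L\<^sup>2\<close> to \<open>L\<^sup>1\<close>.\<close>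
      have pt: "t \<le> \<eta> + t\<^sup>2 / \<eta>" if "t \<ge> 0" for t :: real
      proof -
        have "t * \<eta> \<le> \<eta>\<^sup>2 + t\<^sup>2"
          using sum_squares_bound[of t \<eta>] mult_nonneg_nonneg[of t \<eta>] that \<eta> by linarith
        then show ?thesis
          using \<eta> by (simp add: field_simps power2_eq_square)
      qed
      have "(LINT x|M. norm (s i x - s j x)) \<le> (LINT x|M. \<eta> + (cmod (s i x - s j x))\<^sup>2 / \<eta>)"
        using s_int L2_integrable[OF L2] by (intro integral_mono pt) auto
      also have "\<dots> = \<eta> * \<mu> + (LINT x|M. (cmod (s i x - s j x))\<^sup>2) / \<eta>"
        using L2_integrable[OF L2] by (simp add: \<mu>_def)
      also have "\<dots> < r"
      proof -
        have "(LINT x|M. (cmod (s i x - s j x))\<^sup>2) / \<eta> < r / 2"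
          using diff_le'[OF that] N \<eta> by (simp add: field_simps)
        then show ?thesis using \<eta>' by linarith
      qed
      finally show ?thesis .
    qed
    then show ?thesis by blast
  qed
  obtain r where r: "strict_mono r" "AE x in M. Cauchy (\<lambda>i. s (r i) x)"
    using cauchy_L1_AE_cauchy_subseq[of M s, OF s_int cauchy] by blast
  define f where "f x = lim (\<lambda>i. s (r i) x)" for x
  have f_meas [measurable]: "f \<in> borel_measurable M"
    unfolding f_def[abs_def] by measurable
  have f_lim: "AE x in M. (\<lambda>i. s (r i) x) \<longlonglongrightarrow> f x"
    using r(2) by eventually_elim (simp add: f_def Cauchy_convergent convergent_LIMSEQ_iff[symmetric])
  have fatou: "(\<integral>\<^sup>+x. ennreal ((cmod (f x - s N x))\<^sup>2) \<partial>M) \<le> ennreal (tail N)" for N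
  proof -
    have "(\<integral>\<^sup>+x. ennreal ((cmod (f x - s N x))\<^sup>2) \<partial>M)
        = (\<integral>\<^sup>+x. liminf (\<lambda>i. ennreal ((cmod (s (r i) x - s N x))\<^sup>2)) \<partial>M)"
    proof (rule nn_integral_cong_AE)
      show "AE x in M. ennreal ((cmod (f x - s N x))\<^sup>2)
          = liminf (\<lambda>i. ennreal ((cmod (s (r i) x - s N x))\<^sup>2))"
        using f_lim
      proof eventually_elim
        case (elim x)
        have "(\<lambda>i. ennreal ((cmod (s (r i) x - s N x))\<^sup>2)) \<longlonglongrightarrow> ennreal ((cmod (f x - s N x))\<^sup>2)"
          by (intro tendsto_intros elim)
        then show ?case
          by (rule lim_imp_Liminf[OF sequentially_bot, symmetric])
      qed
    qed
    also have "\<dots> \<le> liminf (\<lambda>i. \<integral>\<^sup>+x. ennreal ((cmod (s (r i) x - s N x))\<^sup>2) \<partial>M)"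
      by (rule nn_integral_liminf) measurable
    also have "\<dots> \<le> ennreal (tail N)"
    proof (rule Liminf_le)
      show "\<forall>\<^sub>F i in sequentially. (\<integral>\<^sup>+x. ennreal ((cmod (s (r i) x - s N x))\<^sup>2) \<partial>M) \<le> ennreal (tail N)"
        using eventually_ge_at_top[of N]
      proof eventually_elim
        case (elim i)
        have "N \<le> r i"
          using elim seq_suble[OF r(1), of i] by linarith
        then show ?case
          using diff_le'[of N "r i" N] L2_integrable[OF L2_diff[OF s_L2 s_L2]]
          by (simp add: nn_integral_eq_integral ennreal_leI)
      qed
    qed simp
    finally show ?thesis .
  qed
  have diff_int: "integrable M (\<lambda>x. (cmod (f x - s N x))\<^sup>2)" for N
    by (rule integrableI_bounded) (use fatou[of N] in \<open>auto simp: less_top[symmetric] top_unique\<close>)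
  then have diff_L2: "(\<lambda>x. f x - s N x) \<in> L2 M" for N
    by (auto simp: L2_def)
  have diff_norm: "(l2_norm M (\<lambda>x. f x - s N x))\<^sup>2 \<le> tail N" for N
  proof -
    have "0 \<le> tail N"
      using le[of N] by (simp add: tail_def)
    then show ?thesis
      using fatou[of N] diff_int[of N] by (simp add: nn_integral_eq_integral l2_norm_power2)
  qed
  have f_L2: "f \<in> L2 M"
    using L2_add[OF diff_L2[of 0] s_L2[of 0]] by simp
  have hat_f: "hat f n = c n" for n
  proof -
    have "(\<lambda>N. (cmod (hat f n - c n))\<^sup>2) \<longlonglongrightarrow> 0"
    proof (rule tendsto_sandwich[OF _ _ tendsto_const tail0])
      show "\<forall>\<^sub>F N in sequentially. (cmod (hat f n - c n))\<^sup>2 \<le> tail N"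
        using eventually_window[of n]
      proof eventually_elim
        case (elim N)
        then have "hat (\<lambda>x. f x - s N x) n = hat f n - c n"
          by (simp add: hat_diff f_L2 s_L2) (simp add: s_def hat_synth)
        then have "(cmod (hat f n - c n))\<^sup>2 \<le> (l2_norm M (\<lambda>x. f x - s N x))\<^sup>2"
          using norm_hat_le[OF diff_L2[of N], of n] by (intro power_mono) auto
        then show ?case
          using diff_norm[of N] by linarith
      qed
    qed simp
    then show ?thesis
      by (simp add: LIMSEQ_const_iff)
  qed
  show thesis
    by (rule that[of f]) (use f_L2 hat_f diff_norm in \<open>auto simp: s_def tail_def\<close>)
qed

lemma Riesz_Fischer:
  assumes "c \<in> L2 Zs"
  obtains f where "f \<in> L2 M" "\<And>n. hat f n = c n"
  by (rule Riesz_Fischer_tail[OF assms]) (rule that)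

text \<open>
  By completeness \<open>f\<close> agrees with the function that the Riesz-Fischer theorem builds from its
  coefficients, so its distance from its projections is bounded by the tail of the coefficients.
  The projection to a single window already gives the inequality that complements Bessel's.
\<close>

lemma Parseval_norm:
  assumes f: "f \<in> L2 M"
  shows "l2_norm M f = l2_norm Zs (hat f)"
proof -
  obtain f' where f': "f' \<in> L2 M" "\<And>n. hat f' n = hat f n"
    "\<And>N. (l2_norm M (\<lambda>x. f' x - synth (window N) (hat f) x))\<^sup>2
           \<le> (l2_norm Zs (hat f))\<^sup>2 - (\<Sum>n\<in>window N. (cmod (hat f n))\<^sup>2)"
    by (rule Riesz_Fischer_tail[OF hat_L2[OF f]]) (rule that)
  have ae: "AE x in M. f x = f' x"
    using f f' by (intro eq_AE_if_hat_eq) auto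
  have "(l2_norm M f)\<^sup>2 \<le> (l2_norm Zs (hat f))\<^sup>2"
  proof -
    have "synth (window 0) (hat f) \<in> borel_measurable M" "f \<in> borel_measurable M" "f' \<in> borel_measurable M"
      using synth_L2 f f'(1) by (auto dest: L2_measurable)
    then have "(l2_norm M (\<lambda>x. f x - synth (window 0) (hat f) x))\<^sup>2
      = (l2_norm M (\<lambda>x. f' x - synth (window 0) (hat f) x))\<^sup>2"
      unfolding l2_norm_power2 using ae by (intro integral_cong_AE) auto
    then show ?thesis
      using f'(3)[of 0] l2_norm_minus_projection[OF f, of "window 0"] finite_window[of 0] by linarith
  qed
  moreover have "(l2_norm Zs (hat f))\<^sup>2 \<le> (l2_norm M f)\<^sup>2"
    unfolding l2_norm_power2[of Zs]
    by (rule LIMSEQ_le_const2[OF sum_window_tendsto[OF L2_integrable[OF hat_L2[OF f]]]])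
       (use Bessel[OF f finite_window] in blast)
  ultimately have "(l2_norm M f)\<^sup>2 = (l2_norm Zs (hat f))\<^sup>2"
    by (rule antisym)
  then show ?thesis
    by (rule power2_eq_imp_eq) auto
qed

lemma Parseval:
  assumes f: "f \<in> L2 M" and g: "g \<in> L2 M"
  shows "l2_inner M f g = l2_inner Zs (hat f) (hat g)"
proof -
  have "hat (\<lambda>x. f x + c * g x) = (\<lambda>n. hat f n + c * hat g n)" for c
    by (rule ext) (rule hat_lincomb[OF f g])
  then show ?thesis
    using f g by (simp add: l2_inner_polarization Parseval_norm L2_lincomb hat_L2)
qed

end

section \<open>Diagonal operators\<close>

text \<open>
  Taking adjoints reverses inclusions.
\<close>

lemma selfadjoint_extension_unique:
  assumes "selfadjoint M K" "selfadjoint M K'" "K \<subseteq> K'"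
  shows "K' = K"
proof -
  have "op_adjoint M K' \<subseteq> op_adjoint M K"
    using assms(3) by (auto simp: op_adjoint_def)
  then show ?thesis
    using assms by (auto simp: selfadjoint_def)
qed

context l2_basis
begin

text \<open>
  The unbounded operator that multiplies the \<open>n\<close>-th coefficient by \<open>m n\<close>, on its maximal
  domain.
\<close>

definition diag :: "(int \<Rightarrow> complex) \<Rightarrow> 'a graph" where
  "diag m = {(f, h). f \<in> L2 M \<and> h \<in> L2 M \<and> (\<forall>n. hat h n = m n * hat f n)}"

lemma synth_diag:
  "finite I \<Longrightarrow> (synth I c, synth I (\<lambda>n. m n * c n)) \<in> diag m"
  by (auto simp: diag_def synth_L2 hat_synth)

lemma projections_converge:
  assumes f: "f \<in> L2 M"
  shows "(\<lambda>N. l2_norm M (\<lambda>x. f x - synth (window N) (hat f) x)) \<longlonglongrightarrow> 0"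
proof -
  have "(\<lambda>N. (l2_norm Zs (hat f))\<^sup>2 - (\<Sum>n\<in>window N. (cmod (hat f n))\<^sup>2))
      \<longlonglongrightarrow> (l2_norm Zs (hat f))\<^sup>2 - (l2_norm Zs (hat f))\<^sup>2"
    unfolding l2_norm_power2
    by (intro tendsto_diff tendsto_const sum_window_tendsto L2_integrable[OF hat_L2[OF f]])
  then have "(\<lambda>N. (l2_norm M (\<lambda>x. f x - synth (window N) (hat f) x))\<^sup>2) \<longlonglongrightarrow> 0"
    by (simp add: l2_norm_minus_projection[OF f] Parseval_norm[OF f])
  then have "(\<lambda>N. sqrt ((l2_norm M (\<lambda>x. f x - synth (window N) (hat f) x))\<^sup>2)) \<longlonglongrightarrow> sqrt 0"
    by (rule tendsto_real_sqrt)
  then show ?thesis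
    by simp
qed

lemma densely_defined_diag: "densely_defined M (diag m)"
  unfolding densely_defined_def
proof (intro ballI allI impI)
  fix f and \<epsilon> :: real
  assume f: "f \<in> L2 M" and "\<epsilon> > 0"
  obtain N where "l2_norm M (\<lambda>x. f x - synth (window N) (hat f) x) < \<epsilon>"
    using order_tendstoD(2)[OF projections_converge[OF f] \<open>\<epsilon> > 0\<close>]
    by (auto simp: eventually_sequentially)
  then show "\<exists>(u, v)\<in>diag m. l2_norm M (\<lambda>x. f x - u x) < \<epsilon>"
    using synth_diag[of "window N" "hat f" m] by (intro bexI[of _ "(synth (window N) (hat f), synth (window N) (\<lambda>n. m n * hat f n))"]) auto
qed

text \<open>
  Testing a pair of the adjoint against the eigenvectors \<open>e n\<close> shows that it is diagonal.
\<close>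

lemma selfadjoint_diag:
  fixes l :: "int \<Rightarrow> real"
  shows "selfadjoint M (diag (\<lambda>n. of_real (l n)))"
proof -
  let ?K = "diag (\<lambda>n. of_real (l n))"
  have 1: "?K \<subseteq> op_adjoint M ?K"
  proof (clarsimp simp: op_adjoint_def diag_def)
    fix u v f g
    assume *: "u \<in> L2 M" "v \<in> L2 M" "f \<in> L2 M" "g \<in> L2 M"
      "\<forall>n. hat v n = complex_of_real (l n) * hat u n"
      "\<forall>n. hat g n = complex_of_real (l n) * hat f n"
    show "l2_inner M g u = l2_inner M f v"
      by (simp add: Parseval *(1-4)) (simp add: l2_inner_def *(5,6) ac_simps)
  qed
  have 2: "op_adjoint M ?K \<subseteq> ?K"
  proof
    fix p assume p: "p \<in> op_adjoint M ?K"
    obtain u v where [simp]: "p = (u, v)"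
      by (cases p)
    have uv: "u \<in> L2 M" "v \<in> L2 M"
      using p by (auto simp: op_adjoint_def)
    have "hat v n = of_real (l n) * hat u n" for n
    proof -
      have "(e n, \<lambda>x. of_real (l n) * e n x) \<in> ?K"
        by (auto simp: diag_def e_L2 L2_scale hat_scale hat_basis)
      then have "l2_inner M (\<lambda>x. of_real (l n) * e n x) u = l2_inner M (e n) v"
        using p by (auto simp: op_adjoint_def)
      then have "of_real (l n) * l2_inner M (e n) u = l2_inner M (e n) v"
        using uv by (simp add: l2_inner_scale_left e_L2)
      then have "cnj (of_real (l n) * l2_inner M (e n) u) = cnj (l2_inner M (e n) v)"
        by (rule arg_cong)
      then show ?thesis
        by (simp add: cnj_l2_inner hat_def)
    qed
    then show "p \<in> ?K"
      using uv by (simp add: diag_def)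
  qed
  show ?thesis
    unfolding selfadjoint_def using densely_defined_diag 1 2 by (auto simp only: subset_antisym)
qed

end

section \<open>Eigenvectors and spectral measures\<close>

lemma sets_scalar_measure [simp, measurable_cong]: "sets (scalar_measure M E f) = sets borel"
  unfolding scalar_measure_def
  by (metis sets.sigma_sets_eq sets.space_closed sets_measure_of space_borel)

lemma space_scalar_measure [simp]: "space (scalar_measure M E f) = UNIV"
  by (simp add: scalar_measure_def space_measure_of_conv)

locale pvm =
  fixes M :: "'a measure" and E
  assumes pvm: "projection_valued_measure M E"
begin

lemma E_bounded: "A \<in> sets borel \<Longrightarrow> E A \<in> bounded_ops M"
  and E_symm: "A \<in> sets borel \<Longrightarrow> f \<in> L2 M \<Longrightarrow> g \<in> L2 M \<Longrightarrow> l2_inner M (E A f) g = l2_inner M f (E A g)"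
  and E_Int: "A \<in> sets borel \<Longrightarrow> B \<in> sets borel \<Longrightarrow> f \<in> L2 M \<Longrightarrow> AE x in M. E (A \<inter> B) f x = E A (E B f) x"
  and E_UNIV: "f \<in> L2 M \<Longrightarrow> AE x in M. E UNIV f x = f x"
  using pvm by (auto simp: projection_valued_measure_def)

lemma E_sums:
  fixes A :: "nat \<Rightarrow> real set"
  assumes "range A \<subseteq> sets borel" "disjoint_family A" "f \<in> L2 M" "g \<in> L2 M"
  shows "(\<lambda>n. l2_inner M (E (A n) f) g) sums l2_inner M (E (\<Union>n. A n) f) g"
  using pvm assms unfolding projection_valued_measure_def by blast

lemma E_L2: "A \<in> sets borel \<Longrightarrow> f \<in> L2 M \<Longrightarrow> E A f \<in> L2 M"
  using E_bounded by (auto simp: bounded_ops_def)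

lemma l2_inner_E_lincomb:
  assumes "A \<in> sets borel" "f \<in> L2 M" "g \<in> L2 M" "h \<in> L2 M"
  shows "l2_inner M (E A (\<lambda>x. f x + c * g x)) h = l2_inner M (E A f) h + c * l2_inner M (E A g) h"
proof -
  have "AE x in M. E A (\<lambda>x. f x + c * g x) x = E A f x + c * E A g x"
    using E_bounded[OF assms(1)] assms(2,3) by (auto simp: bounded_ops_def)
  then have "l2_inner M (E A (\<lambda>x. f x + c * g x)) h = l2_inner M (\<lambda>x. E A f x + c * E A g x) h"
    using assms by (intro l2_inner_cong_AE E_L2 L2_lincomb)
  then show ?thesis
    using assms by (simp add: l2_inner_lincomb_left E_L2)
qed

lemma l2_inner_E_Int:
  assumes "A \<in> sets borel" "B \<in> sets borel" "f \<in> L2 M" "h \<in> L2 M"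
  shows "l2_inner M (E A (E B f)) h = l2_inner M (E (A \<inter> B) f) h"
proof -
  have "AE x in M. E A (E B f) x = E (A \<inter> B) f x"
    using E_Int[OF assms(1-3)] by eventually_elim simp
  then show ?thesis
    using assms by (intro l2_inner_cong_AE E_L2) auto
qed

lemma l2_inner_E_self:
  assumes "A \<in> sets borel" "f \<in> L2 M"
  shows "l2_inner M (E A f) f = complex_of_real ((l2_norm M (E A f))\<^sup>2)"
proof -
  have "l2_inner M (E A f) f = l2_inner M (E A (E A f)) f"
    using l2_inner_E_Int[of A A f f] assms by simp
  also have "\<dots> = l2_inner M (E A f) (E A f)"
    using assms by (simp add: E_symm E_L2)
  finally show ?thesis
    by (simp add: l2_inner_self del: of_real_power)
qed

lemma emeasure_scalar_measure:
  assumes f: "f \<in> L2 M" and A: "A \<in> sets borel"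
  shows "emeasure (scalar_measure M E f) A = ennreal (Re (l2_inner M (E A f) f))"
proof (rule emeasure_measure_of[OF scalar_measure_def])
  have nn: "0 \<le> Re (l2_inner M (E A f) f)" if "A \<in> sets borel" for A
    using l2_inner_E_self[OF that f] by simp
  have "countably_additive (sets borel) (\<lambda>A. ennreal (Re (l2_inner M (E A f) f)))"
  proof (rule countably_additiveI)
    fix A :: "nat \<Rightarrow> real set"
    assume A: "range A \<subseteq> sets borel" "disjoint_family A" "(\<Union>i. A i) \<in> sets borel"
    have "(\<lambda>n. Re (l2_inner M (E (A n) f) f)) sums Re (l2_inner M (E (\<Union>n. A n) f) f)"
      by (rule sums_Re[OF E_sums[OF A(1,2) f f]])
    then show "(\<Sum>i. ennreal (Re (l2_inner M (E (A i) f) f)))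
        = ennreal (Re (l2_inner M (E (\<Union> (range A)) f) f))"
      using A(1) nn by (intro suminf_ennreal_eq) auto
  qed
  then show "countably_additive (sets (scalar_measure M E f)) (\<lambda>A. ennreal (Re (l2_inner M (E A f) f)))"
    by simp
  have "l2_norm M (E {} f) = 0"
  proof -
    have "(\<lambda>n::nat. l2_inner M (E {} f) f) sums l2_inner M (E {} f) f"
      using E_sums[of "\<lambda>_. {}" f f] f by (simp add: disjoint_family_on_def)
    then have "(\<lambda>n::nat. l2_inner M (E {} f) f) \<longlonglongrightarrow> 0"
      by (intro summable_LIMSEQ_zero sums_summable)
    then have "l2_inner M (E {} f) f = 0"
      by (simp add: LIMSEQ_const_iff)
    then show ?thesis
      using l2_inner_E_self[of "{}" f] f by simp
  qed
  then show "positive (sets (scalar_measure M E f)) (\<lambda>A. ennreal (Re (l2_inner M (E A f) f)))"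
    using l2_inner_E_self[of "{}" f] f by (simp add: positive_def)
qed (use A in \<open>auto simp: sets.space_closed\<close>)

lemma finite_scalar_measure: "f \<in> L2 M \<Longrightarrow> finite_measure (scalar_measure M E f)"
  by (rule finite_measureI) (simp add: emeasure_scalar_measure)

lemma measure_scalar_measure:
  assumes f: "f \<in> L2 M" and A: "A \<in> sets borel"
  shows "measure (scalar_measure M E f) A = Re (l2_inner M (E A f) f)"
    and "complex_of_real (measure (scalar_measure M E f) A) = l2_inner M (E A f) f"
  using assms l2_inner_E_self[OF A f] by (simp_all add: measure_def emeasure_scalar_measure)

text \<open>
  The spectral integral is a polarized expression in the measures of the vectors \<open>f + \<i>\<^sup>k g\<close>. For
  \<open>g = E A f\<close> all of them have densities with respect to the measure of \<open>f\<close> alone.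
\<close>

lemma scalar_measure_spectral_translate:
  assumes f: "f \<in> L2 M" and A: "A \<in> sets borel"
  shows "scalar_measure M E (\<lambda>x. f x + c * E A f x)
    = density (scalar_measure M E f) (\<lambda>s. ennreal ((cmod (1 + c * indicator A s))\<^sup>2))"
    (is "?L = density ?\<mu> ?g")
proof (rule measure_eqI)
  fix B assume "B \<in> sets ?L"
  then have B: "B \<in> sets borel"
    by simp
  interpret finite_measure ?\<mu>
    by (rule finite_scalar_measure[OF f])
  let ?h = "\<lambda>x. f x + c * E A f x"
  have EAf: "E A f \<in> L2 M"
    by (rule E_L2[OF A f])
  have h: "?h \<in> L2 M"
    by (intro L2_lincomb f EAf)
  define a where "a = measure ?\<mu> (B - A)"
  define b where "b = measure ?\<mu> (B \<inter> A)"
  have ab: "measure ?\<mu> B = a + b"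
  proof -
    have "(B - A) \<union> (B \<inter> A) = B" "(B - A) \<inter> (B \<inter> A) = {}"
      by auto
    then show ?thesis
      unfolding a_def b_def using A B finite_measure_Union[of "B - A" "B \<inter> A"] by simp
  qed
  have BAA: "B \<inter> A \<inter> A = B \<inter> A" by auto
  have EBh: "l2_inner M (E B ?h) h' = l2_inner M (E B f) h' + c * l2_inner M (E (B \<inter> A) f) h'"
    if "h' \<in> L2 M" for h'
    using A B f EAf that by (simp add: l2_inner_E_lincomb l2_inner_E_Int)
  have "l2_inner M (E B ?h) ?h = l2_inner M (E B ?h) f + cnj c * l2_inner M (E B ?h) (E A f)"
    using A B f EAf h by (simp add: l2_inner_lincomb_right E_L2)
  also have "l2_inner M (E B ?h) (E A f) = l2_inner M (E A (E B ?h)) f"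
    using A B f h by (simp add: E_symm E_L2)
  also have "\<dots> = l2_inner M (E (B \<inter> A) ?h) f"
    using A B f h by (simp add: l2_inner_E_Int Int_commute)
  also have "\<dots> = l2_inner M (E (B \<inter> A) f) f + c * l2_inner M (E (B \<inter> A) f) f"
    using A B f EAf by (simp add: l2_inner_E_lincomb l2_inner_E_Int BAA)
  also have "l2_inner M (E B ?h) f = l2_inner M (E B f) f + c * l2_inner M (E (B \<inter> A) f) f"
    by (rule EBh[OF f])
  finally have "l2_inner M (E B ?h) ?h = of_real a + (1 + c) * (1 + cnj c) * of_real b"
    using A B ab by (simp add: measure_scalar_measure(2)[OF f, symmetric] b_def[symmetric] algebra_simps)
  also have "\<dots> = of_real (a + (cmod (1 + c))\<^sup>2 * b)"
    by (simp add: complex_norm_square del: of_real_power)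
  finally have L: "emeasure ?L B = ennreal (a + (cmod (1 + c))\<^sup>2 * b)"
    using B h by (simp add: emeasure_scalar_measure)
  have "emeasure (density ?\<mu> ?g) B = (\<integral>\<^sup>+ s. ?g s * indicator B s \<partial>?\<mu>)"
    using A B by (subst emeasure_density) auto
  also have "\<dots> = (\<integral>\<^sup>+ s. indicator (B - A) s + ennreal ((cmod (1 + c))\<^sup>2) * indicator (B \<inter> A) s \<partial>?\<mu>)"
    by (intro nn_integral_cong) (auto simp: indicator_def)
  also have "\<dots> = emeasure ?\<mu> (B - A) + ennreal ((cmod (1 + c))\<^sup>2) * emeasure ?\<mu> (B \<inter> A)"
    using A B by (subst nn_integral_add) (auto simp: nn_integral_cmult_indicator)
  also have "\<dots> = ennreal (a + (cmod (1 + c))\<^sup>2 * b)"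
    by (simp add: emeasure_eq_measure a_def b_def ennreal_mult[symmetric] ennreal_plus[symmetric] del: ennreal_plus)
  finally show "emeasure ?L B = emeasure (density ?\<mu> ?g) B"
    using L by simp
qed simp

lemma scalar_measure_spectral_projection:
  assumes f: "f \<in> L2 M" and A: "A \<in> sets borel"
  shows "scalar_measure M E (E A f) = density (scalar_measure M E f) (indicator A)"
    (is "?L = density ?\<mu> ?g")
proof (rule measure_eqI)
  fix B assume "B \<in> sets ?L"
  then have B: "B \<in> sets borel"
    by simp
  have "l2_inner M (E B (E A f)) (E A f) = l2_inner M (E (B \<inter> A) f) (E A f)"
    using A B f by (simp add: l2_inner_E_Int E_L2)
  also have "\<dots> = l2_inner M (E A (E (B \<inter> A) f)) f"
    using A B f by (simp add: E_symm E_L2)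
  also have "\<dots> = l2_inner M (E (B \<inter> A) f) f"
    using A B f by (simp add: l2_inner_E_Int Int_ac)
  finally have "emeasure ?L B = emeasure ?\<mu> (A \<inter> B)"
    using A B f by (simp add: emeasure_scalar_measure E_L2 Int_commute)
  then show "emeasure ?L B = emeasure (density ?\<mu> ?g) B"
    using A B by (simp add: emeasure_density nn_integral_indicator indicator_inter_arith[symmetric])
qed simp

text \<open>
  With \<open>g = E A f\<close> the polarized densities add up to the indicator of \<open>A\<close>. So an eigenvector satisfies
  \<open>r \<mu>(A) = \<integral>\<^sub>A s d\<mu>(s)\<close> for every Borel set \<open>A\<close>, where \<open>\<mu>\<close> is its scalar measure.
\<close>

lemma eigenvector_scalar_measure:
  assumes eig: "(f, \<lambda>x. of_real r * f x) \<in> spectral_integral M E (\<lambda>s. complex_of_real s)"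
    and A: "A \<in> sets borel"
  shows "of_real r * l2_inner M f (E A f) = of_real (LINT s|scalar_measure M E f. indicator A s * s)"
    and "integrable (scalar_measure M E f) (\<lambda>s. s)"
proof -
  let ?\<mu> = "scalar_measure M E f"
  have f: "f \<in> L2 M"
    using eig by (auto simp: spectral_integral_def spectral_domain_def)
  interpret finite_measure ?\<mu>
    by (rule finite_scalar_measure[OF f])
  have sq: "integrable ?\<mu> (\<lambda>s. s\<^sup>2)"
    using eig by (auto simp: spectral_integral_def spectral_domain_def)
  show int: "integrable ?\<mu> (\<lambda>s. s)"
  proof (rule Bochner_Integration.integrable_bound)
    show "integrable ?\<mu> (\<lambda>s. 1 + s\<^sup>2)"
      using sq by simp
    have "\<bar>t\<bar> \<le> 1 + t\<^sup>2" for t :: real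
    proof -
      have "2 * \<bar>t\<bar> \<le> 1 + t\<^sup>2"
        using sum_squares_bound[of 1 "\<bar>t\<bar>"] by simp
      then show ?thesis
        using zero_le_power2[of t] by linarith
    qed
    then show "AE s in ?\<mu>. norm s \<le> norm (1 + s\<^sup>2)"
      by (simp add: abs_of_nonneg)
  qed simp
  have "E A f \<in> spectral_domain M E (\<lambda>s. complex_of_real s)"
  proof -
    have "integrable ?\<mu> (\<lambda>s. indicator A s *\<^sub>R s\<^sup>2)"
      using A sq by (intro integrable_mult_indicator) auto
    then have "integrable (density ?\<mu> (\<lambda>s. ennreal (indicator A s))) (\<lambda>s. s\<^sup>2)"
      using A by (subst integrable_density) auto
    then show ?thesis
      using A f by (simp add: spectral_domain_def E_L2 scalar_measure_spectral_projection ennreal_indicator)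
  qed
  then have "l2_inner M (\<lambda>x. of_real r * f x) (E A f)
      = (\<Sum>k<4. \<i> ^ k * (LINT s|scalar_measure M E (\<lambda>x. f x + \<i> ^ k * E A f x). complex_of_real s)) / 4"
    using eig by (auto simp: spectral_integral_def)
  also have "\<dots> = (\<Sum>k<4. \<i> ^ k * (LINT s|?\<mu>. of_real ((cmod (1 + \<i> ^ k * indicator A s))\<^sup>2) * complex_of_real s)) / 4"
    using A by (simp add: scalar_measure_spectral_translate[OF f A] integral_density scaleR_conv_of_real
        del: of_real_power of_real_mult flip: of_real_mult)
  also have "\<dots> = (LINT s|?\<mu>. (\<Sum>k<4. \<i> ^ k * (of_real ((cmod (1 + \<i> ^ k * indicator A s))\<^sup>2))) / 4 * complex_of_real s)"
  proof -
    have b: "integrable ?\<mu> (\<lambda>s. of_real ((cmod (1 + \<i> ^ k * indicator A s))\<^sup>2) * complex_of_real s)" for k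
    proof (rule Bochner_Integration.integrable_bound)
      show "integrable ?\<mu> (\<lambda>s. 4 * s)"
        using int by simp
      have "(cmod (1 + \<i> ^ k * indicator A s))\<^sup>2 \<le> 2\<^sup>2" for s
      proof (rule power_mono)
        show "cmod (1 + \<i> ^ k * indicator A s) \<le> 2"
          by (rule order.trans[OF norm_triangle_ineq]) (auto simp: norm_mult norm_power indicator_def)
      qed simp
      then show "AE s in ?\<mu>. norm (of_real ((cmod (1 + \<i> ^ k * indicator A s))\<^sup>2) * complex_of_real s) \<le> norm (4 * s)"
        by (auto simp: norm_mult norm_power abs_mult mult_right_mono intro!: AE_I2)
    qed (use A in measurable)
    have "(LINT s|?\<mu>. (\<Sum>k<4. \<i> ^ k * (of_real ((cmod (1 + \<i> ^ k * indicator A s))\<^sup>2))) / 4 * complex_of_real s)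
      = (LINT s|?\<mu>. (\<Sum>k<4. \<i> ^ k * (of_real ((cmod (1 + \<i> ^ k * indicator A s))\<^sup>2) * complex_of_real s)) / 4)"
      by (intro Bochner_Integration.integral_cong) (simp_all add: sum_distrib_right mult.assoc)
    also have "\<dots> = (\<Sum>k<4. \<i> ^ k * (LINT s|?\<mu>. of_real ((cmod (1 + \<i> ^ k * indicator A s))\<^sup>2) * complex_of_real s)) / 4"
      using b by (simp del: of_real_power)
    finally show ?thesis ..
  qed
  also have "\<dots> = (LINT s|?\<mu>. complex_of_real (indicator A s * s))"
    by (subst polarization[symmetric]) (auto intro!: Bochner_Integration.integral_cong simp: indicator_def)
  also have "\<dots> = of_real (LINT s|?\<mu>. indicator A s * s)"
    by (rule integral_complex_of_real)
  finally show "of_real r * l2_inner M f (E A f) = of_real (LINT s|?\<mu>. indicator A s * s)"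
    using A f by (simp add: l2_inner_scale_left E_L2)
qed

text \<open>
  By the preceding identity \<open>s - r\<close> has integral zero over every Borel set, so the scalar measure is
  concentrated at the eigenvalue \<open>r\<close>. This determines the inner products that enter the norm of
  \<open>E A f - indicator A r * f\<close>. The argument uses a first moment only and avoids the multiplicativity
  of the functional calculus.
\<close>

lemma eigenvector_spectral_projection:
  assumes eig: "(f, \<lambda>x. of_real r * f x) \<in> spectral_integral M E (\<lambda>s. complex_of_real s)"
    and A: "A \<in> sets borel"
  shows "AE x in M. E A f x = indicator A r * f x"
proof -
  let ?\<mu> = "scalar_measure M E f"
  have f: "f \<in> L2 M"
    using eig by (auto simp: spectral_integral_def spectral_domain_def)
  interpret finite_measure ?\<mu>
    by (rule finite_scalar_measure[OF f])
  note int = eigenvector_scalar_measure(2)[OF eig A]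
  have zero: "(LINT s|?\<mu>. indicator B s *\<^sub>R (s - r)) = 0" if B: "B \<in> sets borel" for B
  proof -
    have "of_real (r * measure ?\<mu> B) = complex_of_real (LINT s|?\<mu>. indicator B s * s)"
      using eigenvector_scalar_measure(1)[OF eig B] B f
      by (simp add: measure_scalar_measure(2) E_symm)
    then have r_eq: "r * measure ?\<mu> B = (LINT s|?\<mu>. indicator B s * s)"
      by (simp only: of_real_eq_iff)
    have "(LINT s|?\<mu>. indicator B s *\<^sub>R (s - r))
      = (LINT s|?\<mu>. indicator B s * s - r * indicator B s)"
      by (intro Bochner_Integration.integral_cong) (auto simp: algebra_simps)
    also have "\<dots> = (LINT s|?\<mu>. indicator B s * s) - r * measure ?\<mu> B"
    proof -
      have "integrable ?\<mu> (\<lambda>s. indicator B s *\<^sub>R s)"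
        using int B by (intro integrable_mult_indicator) auto
      moreover have "integrable ?\<mu> (\<lambda>s. r * indicator B s)"
        using B by (intro integrable_mult_right integrable_real_indicator) (auto simp: less_top[symmetric])
      ultimately show ?thesis
        using B by (subst Bochner_Integration.integral_diff) simp_all
    qed
    finally show ?thesis
      using r_eq by linarith
  qed
  have "AE s in ?\<mu>. s - r = 0"
    using int zero by (intro density_zero) (auto simp: set_lebesgue_integral_def)
  then have conc: "AE s in ?\<mu>. s = r"
    by simp
  have norm_E: "(l2_norm M (E B f))\<^sup>2 = measure ?\<mu> B" if "B \<in> sets borel" for B
    using l2_inner_E_self[OF that f] that f by (simp add: measure_scalar_measure(1))
  have norm_f: "(l2_norm M f)\<^sup>2 = measure ?\<mu> UNIV"
  proof -
    have "l2_inner M (E UNIV f) f = l2_inner M f f"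
      by (intro l2_inner_cong_AE E_L2 f E_UNIV) simp
    then show ?thesis
      using f by (simp add: measure_scalar_measure(1) l2_inner_self)
  qed
  have mea: "measure ?\<mu> A = indicator A r * measure ?\<mu> UNIV"
  proof (cases "r \<in> A")
    case True
    then have "measure ?\<mu> A = measure ?\<mu> UNIV"
      using conc A by (intro finite_measure_eq_AE) auto
    then show ?thesis using True by simp
  next
    case False
    then have "measure ?\<mu> A = measure ?\<mu> {}"
      using conc A by (intro finite_measure_eq_AE) auto
    then show ?thesis using False by simp
  qed
  have "(l2_norm M (\<lambda>x. E A f x - indicator A r * f x))\<^sup>2 = 0"
  proof (cases "r \<in> A")
    case True
    then show ?thesis
      using l2_norm_diff[OF E_L2[OF A f] f] mea A f
      by (simp add: norm_E norm_f measure_scalar_measure(1)[symmetric])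
  next
    case False
    then show ?thesis
      using norm_E[OF A] mea by simp
  qed
  then have "AE x in M. E A f x - indicator A r * f x = 0"
    using A f by (intro l2_norm_eq_0_imp_AE L2_diff E_L2 L2_scale) simp_all
  then show ?thesis
    by simp
qed

end

section \<open>Multipliers and the functional calculus of a diagonal operator\<close>

lemma l2_norm_bounded_mult:
  assumes f: "f \<in> L2 M" and m: "m \<in> borel_measurable M" and bound: "\<And>x. cmod (m x) \<le> C" and "0 \<le> C"
  shows "l2_norm M (\<lambda>x. m x * f x) \<le> C * l2_norm M f"
proof -
  have "(LINT x|M. (cmod (m x * f x))\<^sup>2) \<le> (LINT x|M. C\<^sup>2 * (cmod (f x))\<^sup>2)"
  proof (rule integral_mono)
    fix x
    have "(cmod (m x))\<^sup>2 \<le> C\<^sup>2"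
      by (rule power_mono[OF bound]) simp
    then show "(cmod (m x * f x))\<^sup>2 \<le> C\<^sup>2 * (cmod (f x))\<^sup>2"
      by (simp add: norm_mult power_mult_distrib mult_right_mono)
  qed (use L2_integrable[OF f] L2_integrable[OF L2_bounded_mult[OF f m bound]] in auto)
  then have "(l2_norm M (\<lambda>x. m x * f x))\<^sup>2 \<le> (C * l2_norm M f)\<^sup>2"
    by (simp add: l2_norm_power2 power_mult_distrib)
  then show ?thesis
    by (rule power2_le_imp_le) (use \<open>0 \<le> C\<close> in simp)
qed

context l2_basis
begin

lemma Parseval_integral:
  "f \<in> L2 M \<Longrightarrow> g \<in> L2 M \<Longrightarrow> l2_inner M f g = (LINT n|Zs. hat f n * cnj (hat g n))"
  unfolding Parseval by (simp only: l2_inner_def)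

text \<open>
  Vectors are functions up to null sets and operators come from Hilbert choice, so an operator
  is described by its effect on coefficients. This fixes its values almost everywhere.
\<close>

definition is_multiplier :: "(('a \<Rightarrow> complex) \<Rightarrow> 'a \<Rightarrow> complex) \<Rightarrow> (int \<Rightarrow> complex) \<Rightarrow> bool" where
  "is_multiplier A m \<longleftrightarrow> (\<forall>f\<in>L2 M. A f \<in> L2 M \<and> (\<forall>n. hat (A f) n = m n * hat f n))"

lemma multiplierD:
  assumes "is_multiplier A m" "f \<in> L2 M"
  shows "A f \<in> L2 M" "hat (A f) n = m n * hat f n"
  using assms by (auto simp: is_multiplier_def)

lemma multiplier_norm_le:
  assumes A: "is_multiplier A m" and bound: "\<And>n. cmod (m n) \<le> C" and f: "f \<in> L2 M"
  shows "l2_norm M (A f) \<le> C * l2_norm M f"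
proof -
  have "0 \<le> C"
    using order.trans[OF norm_ge_zero bound] .
  have "hat (A f) = (\<lambda>n. m n * hat f n)"
    using multiplierD[OF A f] by auto
  then show ?thesis
    using l2_norm_bounded_mult[OF hat_L2[OF f], of m C] bound \<open>0 \<le> C\<close>
    by (simp add: Parseval_norm multiplierD[OF A f] f)
qed

lemma multiplier_bounded_ops:
  assumes A: "is_multiplier A m" and bound: "\<And>n. cmod (m n) \<le> C"
  shows "A \<in> bounded_ops M"
proof -
  have "AE x in M. A (\<lambda>y. f y + c * g y) x = A f x + c * A g x" if "f \<in> L2 M" "g \<in> L2 M" for f g c
    using that multiplierD[OF A] 
    by (intro eq_AE_if_hat_eq) (auto simp: L2_lincomb hat_lincomb algebra_simps)
  then show ?thesis
    using multiplierD[OF A] multiplier_norm_le[OF A bound] unfolding bounded_ops_def by blast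
qed

lemma multiplier_op_norm_le:
  assumes A: "is_multiplier A m" and bound: "\<And>n. cmod (m n) \<le> C"
  shows "op_norm M A \<le> ennreal C"
  unfolding op_norm_def
proof (rule SUP_least)
  fix f assume f: "f \<in> {f \<in> L2 M. l2_norm M f \<le> 1}"
  have "0 \<le> C"
    using order.trans[OF norm_ge_zero bound] .
  have "l2_norm M (A f) \<le> C * l2_norm M f"
    using f by (intro multiplier_norm_le[OF A bound]) auto
  also have "\<dots> \<le> C"
    using f \<open>0 \<le> C\<close> by (intro mult_left_le) auto
  finally show "ennreal (l2_norm M (A f)) \<le> ennreal C"
    by (rule ennreal_leI)
qed

lemma ex_multiplier:
  assumes bound: "\<And>n. cmod (m n) \<le> C"
  obtains A where "is_multiplier A m"
proof -
  have "\<exists>h. h \<in> L2 M \<and> (\<forall>n. hat h n = m n * hat f n)" if f: "f \<in> L2 M" for f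
  proof -
    have "(\<lambda>n. m n * hat f n) \<in> L2 Zs"
      using bound by (intro L2_bounded_mult hat_L2 f) auto
    then show ?thesis
      by (metis Riesz_Fischer)
  qed
  then have "\<exists>A. \<forall>f\<in>L2 M. A f \<in> L2 M \<and> (\<forall>n. hat (A f) n = m n * hat f n)"
    by (intro bchoice ballI)
  then show thesis
    using that by (auto simp: is_multiplier_def)
qed

text \<open>
  What the spectral projections of the diagonal operator with eigenvalues \<open>l n\<close> must be.
\<close>

definition spectral_family :: "(real set \<Rightarrow> ('a \<Rightarrow> complex) \<Rightarrow> 'a \<Rightarrow> complex) \<Rightarrow> (int \<Rightarrow> real) \<Rightarrow> bool" where
  "spectral_family E l \<longleftrightarrow> (\<forall>A\<in>sets borel. is_multiplier (E A) (\<lambda>n. indicator A (l n)))"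

lemma spectral_familyD:
  assumes "spectral_family E l" "A \<in> sets borel"
  shows "is_multiplier (E A) (\<lambda>n. indicator A (l n))"
  using assms by (simp add: spectral_family_def)

lemma ex_spectral_family:
  obtains E where "spectral_family E l"
proof -
  have "\<exists>B. is_multiplier B (\<lambda>n. indicator A (l n))" for A
    by (rule ex_multiplier[of "\<lambda>n. indicator A (l n)" 1]) (auto simp: indicator_def)
  then have "\<exists>E. \<forall>A. is_multiplier (E A) (\<lambda>n. indicator A (l n))"
    by (intro choice allI)
  then show thesis
    using that by (auto simp: spectral_family_def)
qed

lemma spectral_family_pvm:
  assumes E: "spectral_family E l"
  shows "projection_valued_measure M E"
proof -
  note EL2 = multiplierD(1)[OF spectral_familyD[OF E]]
  note hatE = multiplierD(2)[OF spectral_familyD[OF E]]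
  have inner: "l2_inner M (E A f) g = (LINT n|Zs. indicator A (l n) * (hat f n * cnj (hat g n)))"
    if "A \<in> sets borel" "f \<in> L2 M" "g \<in> L2 M" for A f g
    using that by (simp add: Parseval_integral EL2 hatE mult.assoc)
  have int: "integrable Zs (\<lambda>n. hat f n * cnj (hat g n))" if "f \<in> L2 M" "g \<in> L2 M" for f g
    using that by (intro integrable_L2_mult hat_L2)
  have "E A \<in> bounded_ops M" if "A \<in> sets borel" for A
    using that by (intro multiplier_bounded_ops[OF spectral_familyD[OF E], of A 1]) (auto simp: indicator_def)
  moreover have "l2_inner M (E A f) g = l2_inner M f (E A g)"
    if "A \<in> sets borel" "f \<in> L2 M" "g \<in> L2 M" for A f g
    using that by (auto simp: Parseval_integral EL2 hatE indicator_def intro!: Bochner_Integration.integral_cong)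
  moreover have "AE x in M. E (A \<inter> B) f x = E A (E B f) x"
    if "A \<in> sets borel" "B \<in> sets borel" "f \<in> L2 M" for A B f
    using that by (intro eq_AE_if_hat_eq) (auto simp: EL2 hatE indicator_def)
  moreover have "AE x in M. E UNIV f x = f x" if "f \<in> L2 M" for f
    using that by (intro eq_AE_if_hat_eq) (auto simp: EL2 hatE)
  moreover have "(\<lambda>n. l2_inner M (E (A n) f) g) sums l2_inner M (E (\<Union>n. A n) f) g"
    if A: "range A \<subseteq> sets borel" "disjoint_family A" and fg: "f \<in> L2 M" "g \<in> L2 M"
    for A :: "nat \<Rightarrow> real set" and f g
  proof -
    let ?F = "\<lambda>k n. indicator (A k) (l n) * (hat f n * cnj (hat g n))"
    have *: "(\<lambda>k. indicator (A k) x :: complex) sums indicator (\<Union>k. A k) x" for x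
    proof (cases "x \<in> (\<Union>k. A k)")
      case True
      then obtain k where k: "x \<in> A k"
        by blast
      have "indicator (A j) x = (if j = k then 1 else 0 :: complex)" for j
        using A(2) k by (auto simp: indicator_def disjoint_family_on_def)
      then show ?thesis
        using True sums_single[of k "\<lambda>_. 1 :: complex"] by simp
    next
      case False
      then show ?thesis
        by (auto simp: indicator_def)
    qed
    have part: "(\<lambda>K. LINT n|Zs. (\<Sum>k<K. ?F k n)) \<longlonglongrightarrow> (LINT n|Zs. indicator (\<Union>k. A k) (l n) * (hat f n * cnj (hat g n)))"
    proof (rule integral_dominated_convergence)
      show "integrable Zs (\<lambda>n. norm (hat f n * cnj (hat g n)))"
        using int[OF fg] by (rule integrable_norm)
      show "AE n in Zs. (\<lambda>K. \<Sum>k<K. ?F k n) \<longlonglongrightarrow> indicator (\<Union>k. A k) (l n) * (hat f n * cnj (hat g n))"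
        using sums_mult2[OF *] by (simp add: sums_def)
      show "AE n in Zs. norm (\<Sum>k<K. ?F k n) \<le> norm (hat f n * cnj (hat g n))" for K
      proof (rule AE_I2)
        fix n
        have "(\<Sum>k<K. indicator (A k) (l n) :: complex) = indicator (\<Union>k<K. A k) (l n)"
          using A(2) by (subst indicator_UN_disjoint) (auto simp: disjoint_family_on_def)
        then show "norm (\<Sum>k<K. ?F k n) \<le> norm (hat f n * cnj (hat g n))"
          by (simp add: sum_distrib_right[symmetric] indicator_def)
      qed
    qed auto
    have intF: "integrable Zs (?F k)" for k
      by (rule Bochner_Integration.integrable_bound[OF int[OF fg]]) (auto simp: indicator_def)
    have "(LINT n|Zs. (\<Sum>k<K. ?F k n)) = (\<Sum>k<K. l2_inner M (E (A k) f) g)" for K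
      using A(1) fg by (subst Bochner_Integration.integral_sum) (auto simp: intF inner range_subsetD)
    moreover have "(LINT n|Zs. indicator (\<Union>k. A k) (l n) * (hat f n * cnj (hat g n)))
        = l2_inner M (E (\<Union>k. A k) f) g"
      using A(1) fg by (intro inner[symmetric] sets.countable_UN) auto
    ultimately show ?thesis
      using part by (simp only: sums_def)
  qed
  ultimately show ?thesis
    by (simp add: projection_valued_measure_def)
qed

text \<open>
  The scalar measure of \<open>f\<close> has mass \<open>\<bar>hat f n\<bar>\<^sup>2\<close> at the point \<open>l n\<close>. Expressed as an image measure,
  it turns spectral integrals into sums over coefficients.
\<close>

lemma spectral_family_scalar_measure:
  assumes E: "spectral_family E l" and f: "f \<in> L2 M"
  shows "scalar_measure M E f = distr (density Zs (\<lambda>n. ennreal ((cmod (hat f n))\<^sup>2))) borel l"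
    (is "_ = ?D")
proof (rule measure_eqI)
  interpret pvm M E
    using spectral_family_pvm[OF E] by (rule pvm.intro)
  fix A assume "A \<in> sets (scalar_measure M E f)"
  then have A: "A \<in> sets borel"
    by simp
  have int: "integrable Zs (\<lambda>n. indicator A (l n) * (cmod (hat f n))\<^sup>2)"
    by (rule Bochner_Integration.integrable_bound[OF L2_integrable[OF hat_L2[OF f]]]) (auto simp: indicator_def)
  have "l2_inner M (E A f) f = (LINT n|Zs. of_real (indicator A (l n) * (cmod (hat f n))\<^sup>2))"
    using A f multiplierD[OF spectral_familyD[OF E A] f]
    by (auto simp: Parseval_integral complex_norm_square indicator_def mult.assoc
        simp del: of_real_power intro!: Bochner_Integration.integral_cong)
  then have "l2_inner M (E A f) f = of_real (LINT n|Zs. indicator A (l n) * (cmod (hat f n))\<^sup>2)"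
    by (simp only: integral_complex_of_real)
  then have "emeasure (scalar_measure M E f) A = ennreal (LINT n|Zs. indicator A (l n) * (cmod (hat f n))\<^sup>2)"
    by (simp add: emeasure_scalar_measure[OF f A])
  also have "\<dots> = (\<integral>\<^sup>+n. ennreal (indicator A (l n) * (cmod (hat f n))\<^sup>2) \<partial>Zs)"
    using int by (intro nn_integral_eq_integral[symmetric]) auto
  also have "\<dots> = (\<integral>\<^sup>+n. ennreal ((cmod (hat f n))\<^sup>2) * indicator (l -` A) n \<partial>Zs)"
    by (intro nn_integral_cong) (auto simp: indicator_def)
  also have "\<dots> = emeasure ?D A"
    using A by (subst emeasure_distr) (auto simp: emeasure_density)
  finally show "emeasure (scalar_measure M E f) A = emeasure ?D A" .
qed simp

lemma spectral_family_spectral_domain: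
  assumes E: "spectral_family E l" and \<phi>: "\<phi> \<in> borel_measurable borel"
  shows "spectral_domain M E \<phi> = {f \<in> L2 M. (\<lambda>n. \<phi> (l n) * hat f n) \<in> L2 Zs}"
proof -
  have "integrable (scalar_measure M E f) (\<lambda>s. (cmod (\<phi> s))\<^sup>2)
      \<longleftrightarrow> (\<lambda>n. \<phi> (l n) * hat f n) \<in> L2 Zs" if f: "f \<in> L2 M" for f
    unfolding spectral_family_scalar_measure[OF E f] using \<phi>
    by (subst integrable_distr_eq) (auto simp: integrable_density L2_def norm_mult power_mult_distrib mult.commute)
  then show ?thesis
    by (auto simp: spectral_domain_def)
qed

text \<open>
  Polarization under the sum over \<open>n\<close> turns the defining form of the spectral integral into an inner
  product of coefficient sequences. Testing against \<open>e n\<close> isolates the \<open>n\<close>-th coefficient.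
\<close>

lemma spectral_family_spectral_integral:
  assumes E: "spectral_family E l" and \<phi>: "\<phi> \<in> borel_measurable borel"
  shows "spectral_integral M E \<phi> = diag (\<lambda>n. \<phi> (l n))"
proof -
  note dom = spectral_family_spectral_domain[OF E \<phi>]
  have form: "(\<Sum>k<4. \<i> ^ k * (LINT s|scalar_measure M E (\<lambda>x. f x + \<i> ^ k * g x). \<phi> s)) / 4
      = l2_inner Zs (\<lambda>n. \<phi> (l n) * hat f n) (hat g)"
    if f: "f \<in> spectral_domain M E \<phi>" and g: "g \<in> spectral_domain M E \<phi>" for f g
  proof -
    have fg: "f \<in> L2 M" "g \<in> L2 M"
      and \<phi>fg: "(\<lambda>n. \<phi> (l n) * hat f n) \<in> L2 Zs" "(\<lambda>n. \<phi> (l n) * hat g n) \<in> L2 Zs"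
      using f g by (auto simp: dom)
    let ?h = "\<lambda>k x. f x + \<i> ^ k * g x"
    have h: "?h k \<in> L2 M" for k
      using fg by (intro L2_lincomb)
    have \<phi>h: "(\<lambda>n. \<phi> (l n) * hat (?h k) n) \<in> L2 Zs" for k
      using L2_lincomb[OF \<phi>fg, of "\<i> ^ k"] by (simp only: hat_lincomb[OF fg] ring_distribs mult.left_commute)
    have int: "integrable Zs (\<lambda>n. \<phi> (l n) * of_real ((cmod (hat (?h k) n))\<^sup>2))" for k
      using integrable_L2_mult[OF \<phi>h hat_L2[OF h], of k]
      by (simp add: complex_norm_square mult.assoc del: of_real_power)
    have "(LINT s|scalar_measure M E (?h k). \<phi> s) = (LINT n|Zs. \<phi> (l n) * of_real ((cmod (hat (?h k) n))\<^sup>2))" for k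
      unfolding spectral_family_scalar_measure[OF E h] using \<phi>
      by (subst integral_distr) (auto simp: integral_density scaleR_conv_of_real mult.commute)
    then have "(\<Sum>k<4. \<i> ^ k * (LINT s|scalar_measure M E (?h k). \<phi> s)) / 4
      = (LINT n|Zs. (\<Sum>k<4. \<i> ^ k * (\<phi> (l n) * of_real ((cmod (hat (?h k) n))\<^sup>2))) / 4)"
      using int by (simp del: of_real_power)
    also have "\<dots> = (LINT n|Zs. \<phi> (l n) * ((\<Sum>k<4. \<i> ^ k * of_real ((cmod (hat f n + \<i> ^ k * hat g n))\<^sup>2)) / 4))"
      by (simp only: hat_lincomb[OF fg] sum_distrib_left times_divide_eq_right mult.left_commute)
    also have "\<dots> = l2_inner Zs (\<lambda>n. \<phi> (l n) * hat f n) (hat g)"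
      by (simp only: polarization[symmetric] l2_inner_def mult.assoc)
    finally show ?thesis .
  qed
  show ?thesis
  proof (intro set_eqI iffI)
    fix p assume p: "p \<in> spectral_integral M E \<phi>"
    obtain f h where [simp]: "p = (f, h)"
      by (cases p)
    have f: "f \<in> spectral_domain M E \<phi>" and h: "h \<in> L2 M"
      using p by (auto simp: spectral_integral_def)
    have "hat h n = \<phi> (l n) * hat f n" for n
    proof -
      have "(\<lambda>k. \<phi> (l k) * hat (e n) k) \<in> L2 Zs"
        by (rule L2_cong_AE[OF L2_scale[OF hat_L2[OF e_L2[of n]], of "\<phi> (l n)"]])
           (auto simp: hat_basis)
      then have e: "e n \<in> spectral_domain M E \<phi>"
        by (simp add: dom e_L2)
      have "hat h n = l2_inner M h (e n)"
        by (simp add: hat_def)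
      also have "\<dots> = l2_inner Zs (\<lambda>k. \<phi> (l k) * hat f k) (hat (e n))"
        using p e unfolding spectral_integral_def form[OF f e, symmetric] by simp
      also have "\<dots> = (LINT k|Zs. indicator {n} k *\<^sub>R (\<phi> (l k) * hat f k))"
        unfolding l2_inner_def by (intro Bochner_Integration.integral_cong) (auto simp: hat_basis indicator_def)
      also have "\<dots> = \<phi> (l n) * hat f n"
        by (subst sum_finite_eq_integral) auto
      finally show ?thesis .
    qed
    then show "p \<in> diag (\<lambda>n. \<phi> (l n))"
      using f h by (simp add: diag_def dom)
  next
    fix p assume p: "p \<in> diag (\<lambda>n. \<phi> (l n))"
    obtain f h where [simp]: "p = (f, h)"
      by (cases p)
    have f: "f \<in> L2 M" and h: "h \<in> L2 M" and *: "hat h = (\<lambda>n. \<phi> (l n) * hat f n)"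
      using p by (auto simp: diag_def)
    have f': "f \<in> spectral_domain M E \<phi>"
      using f hat_L2[OF h] by (simp add: dom *)
    have "l2_inner M h g
        = (\<Sum>k<4. \<i> ^ k * (LINT s|scalar_measure M E (\<lambda>x. f x + \<i> ^ k * g x). \<phi> s)) / 4"
      if g: "g \<in> spectral_domain M E \<phi>" for g
      unfolding form[OF f' g] using g by (simp add: Parseval h * dom)
    then show "p \<in> spectral_integral M E \<phi>"
      unfolding spectral_integral_def \<open>p = (f, h)\<close> mem_Collect_eq case_prod_conv
      by (intro conjI ballI f' h)
  qed
qed

text \<open>
  The projections are symmetric and their values on the basis vectors are known, which determines
  the coefficients of \<open>E A f\<close>. Hence a diagonal operator has one spectral measure only.
\<close>

lemma spectral_family_if_spectral_integral:
  assumes "projection_valued_measure M E"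
    and K: "spectral_integral M E (\<lambda>s. complex_of_real s) = diag (\<lambda>n. of_real (l n))"
  shows "spectral_family E l"
  unfolding spectral_family_def is_multiplier_def
proof (intro ballI conjI allI)
  interpret pvm M E
    using assms(1) by (rule pvm.intro)
  fix A :: "real set" and f n
  assume A: "A \<in> sets borel" and f: "f \<in> L2 M"
  show "E A f \<in> L2 M"
    by (rule E_L2[OF A f])
  have "(e n, \<lambda>x. of_real (l n) * e n x) \<in> diag (\<lambda>n. of_real (l n))"
    by (auto simp: diag_def e_L2 L2_scale hat_scale hat_basis)
  then have ae: "AE x in M. E A (e n) x = indicator A (l n) * e n x"
    by (intro eigenvector_spectral_projection A) (simp add: K)
  have "hat (E A f) n = l2_inner M f (E A (e n))"
    unfolding hat_def by (rule E_symm[OF A f e_L2])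
  also have "\<dots> = cnj (l2_inner M (E A (e n)) f)"
    by (simp add: cnj_l2_inner)
  also have "l2_inner M (E A (e n)) f = l2_inner M (\<lambda>x. indicator A (l n) * e n x) f"
    by (intro l2_inner_cong_AE E_L2 A e_L2 f L2_scale ae)
  also have "cnj \<dots> = indicator A (l n) * hat f n"
    using f by (simp add: l2_inner_scale_left e_L2 cnj_l2_inner hat_def indicator_def)
  finally show "hat (E A f) n = indicator A (l n) * hat f n" .
qed

lemma spectral_family_spectral_measure_of:
  "spectral_family (spectral_measure_of M (diag (\<lambda>n. of_real (l n)))) l"
proof -
  let ?K = "diag (\<lambda>n. of_real (l n))"
  let ?P = "\<lambda>E. projection_valued_measure M E \<and> spectral_integral M E (\<lambda>s. complex_of_real s) = ?K"
  obtain E where "spectral_family E l"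
    by (rule ex_spectral_family)
  then have "?P E"
    by (simp add: spectral_family_pvm spectral_family_spectral_integral)
  then have "?P (spectral_measure_of M ?K)"
    unfolding spectral_measure_of_def by (rule someI[where P = ?P])
  then show ?thesis
    by (intro spectral_family_if_spectral_integral) auto
qed

lemma exp_it_multiplier:
  "is_multiplier (exp_it M (diag (\<lambda>n. of_real (l n))) t) (\<lambda>n. exp (\<i> * of_real t * of_real (l n)))"
proof -
  let ?m = "\<lambda>n. exp (\<i> * of_real t * of_real (l n))"
  obtain A where A: "is_multiplier A ?m"
    by (rule ex_multiplier[of ?m 1]) (auto simp: norm_exp_eq_Re)
  have eq: "spectral_integral M (spectral_measure_of M (diag (\<lambda>n. of_real (l n))))
      (\<lambda>s. exp (\<i> * complex_of_real t * complex_of_real s)) = diag ?m"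
    by (intro spectral_family_spectral_integral spectral_family_spectral_measure_of
        borel_measurable_continuous_onI continuous_intros)
  have "(f, exp_it M (diag (\<lambda>n. of_real (l n))) t f) \<in> diag ?m" if "f \<in> L2 M" for f
    unfolding exp_it_def eq
    by (rule someI[of _ "A f"]) (use multiplierD[OF A that] that in \<open>simp add: diag_def\<close>)
  then show ?thesis
    by (auto simp: is_multiplier_def diag_def)
qed

text \<open>
  The kernel is spanned by the \<open>e n\<close> with \<open>l n = 0\<close>. A vector \<open>p\<close> as in the definition of the projection
  exists by the Riesz-Fischer theorem; any such \<open>p\<close> has the same coefficients.
\<close>

lemma orth_proj_kernel_multiplier:
  fixes l :: "int \<Rightarrow> real"
  shows "is_multiplier (orth_proj M (op_kernel (diag (\<lambda>n. of_real (l n))))) (\<lambda>n. if l n = 0 then 1 else 0)"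
  unfolding is_multiplier_def
proof (rule ballI)
  let ?N = "op_kernel (diag (\<lambda>n. of_real (l n)))"
  let ?m = "\<lambda>n. if l n = 0 then 1 else 0 :: complex"
  have N: "g \<in> ?N \<longleftrightarrow> g \<in> L2 M \<and> (\<forall>n. l n \<noteq> 0 \<longrightarrow> hat g n = 0)" for g
    by (auto simp: op_kernel_def diag_def)
  fix f assume f: "f \<in> L2 M"
  obtain A where A: "is_multiplier A ?m"
    by (rule ex_multiplier[of ?m 1]) auto
  let ?P = "\<lambda>p. p \<in> ?N \<and> (\<forall>g\<in>?N. l2_inner M (\<lambda>x. f x - p x) g = 0)"
  have "?P (A f)"
  proof (intro conjI ballI)
    show "A f \<in> ?N"
      using multiplierD[OF A f] by (auto simp: N)
    fix g assume g: "g \<in> ?N"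
    have "(\<lambda>n. hat (\<lambda>x. f x - A f x) n * cnj (hat g n)) = (\<lambda>_. 0)"
      using g multiplierD[OF A f] f by (auto simp: N hat_diff)
    then show "l2_inner M (\<lambda>x. f x - A f x) g = 0"
      using g multiplierD(1)[OF A f] f by (simp only: N Parseval_integral L2_diff) simp
  qed
  then have P: "?P (orth_proj M ?N f)"
    unfolding orth_proj_def by (rule someI[where P = ?P])
  have "hat (orth_proj M ?N f) n = hat f n" if "l n = 0" for n
  proof -
    have "e n \<in> ?N"
      using that by (auto simp: N e_L2 hat_basis)
    then have "hat (\<lambda>x. f x - orth_proj M ?N f x) n = 0"
      using P by (auto simp: hat_def)
    then show ?thesis
      using P f by (simp add: N hat_diff)
  qed
  then show "orth_proj M ?N f \<in> L2 M \<and> (\<forall>n. hat (orth_proj M ?N f) n = ?m n * hat f n)"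
    using P by (auto simp: N)
qed

end

section \<open>Time averages of diagonal unitary groups\<close>

lemma cmod_exp_ii_diff: "cmod (exp (\<i> * of_real a) - exp (\<i> * of_real b)) \<le> \<bar>a - b\<bar>"
proof -
  have "exp (\<i> * of_real a) - exp (\<i> * of_real b) = exp (\<i> * of_real b) * (exp (\<i> * of_real (a - b)) - 1)"
    by (simp add: algebra_simps exp_add[symmetric])
  then have "cmod (exp (\<i> * of_real a) - exp (\<i> * of_real b)) = cmod (exp (\<i> * of_real (a - b)) - 1)"
    by (simp only: norm_mult norm_exp_i_times mult_1)
  also have "\<dots> = 2 * \<bar>sin ((a - b) / 2)\<bar>"
    using dist_exp_i_1[of "a - b"] by (simp only: dist_norm)
  also have "\<dots> \<le> 2 * \<bar>(a - b) / 2\<bar>"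
    using abs_sin_x_le_abs_x[of "(a - b) / 2"] by linarith
  finally show ?thesis
    by simp
qed

definition phase_integral :: "real \<Rightarrow> real \<Rightarrow> complex" where
  "phase_integral T r = integral {-T..T} (\<lambda>t. exp (\<i> * of_real t * of_real r))"

lemma phase_integrable: "(\<lambda>t::real. exp (\<i> * of_real t * of_real r)) integrable_on {a..b}"
  by (intro integrable_continuous_real continuous_intros)

lemma cmod_phase: "cmod (exp (\<i> * of_real t * of_real r)) = 1"
  by (simp add: norm_exp_eq_Re)

lemma phase_integral_0: "0 \<le> T \<Longrightarrow> phase_integral T 0 = of_real (2 * T)"
  by (simp add: phase_integral_def scaleR_conv_of_real)

lemma cmod_phase_integral_le: "0 \<le> T \<Longrightarrow> cmod (phase_integral T r) \<le> 2 * T"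
  using integral_bound[of "-T" T "\<lambda>t. exp (\<i> * of_real t * of_real r)" 1]
  by (simp add: phase_integral_def cmod_phase continuous_intros)

lemma cmod_phase_integral_le_inverse:
  assumes "0 \<le> T" "r \<noteq> 0"
  shows "cmod (phase_integral T r) \<le> 2 / \<bar>r\<bar>"
proof -
  let ?F = "\<lambda>t::real. exp (\<i> * of_real t * of_real r) / (\<i> * of_real r)"
  have "((\<lambda>t. exp (\<i> * of_real t * of_real r)) has_integral (?F T - ?F (-T))) {-T..T}"
  proof (rule fundamental_theorem_of_calculus)
    fix t :: real
    have "((\<lambda>z. exp (\<i> * z * of_real r) / (\<i> * of_real r)) has_field_derivative exp (\<i> * of_real t * of_real r)) (at (of_real t))"
      using assms by (auto intro!: derivative_eq_intros)
    then show "(?F has_vector_derivative exp (\<i> * of_real t * of_real r)) (at t within {-T..T})"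
      by (rule has_vector_derivative_real_field)
  qed (use assms in simp)
  then have "phase_integral T r = ?F T - ?F (-T)"
    unfolding phase_integral_def by (rule integral_unique)
  also have "cmod \<dots> \<le> cmod (?F T) + cmod (?F (-T))"
    by (rule norm_triangle_ineq4)
  also have "\<dots> = 2 / \<bar>r\<bar>"
    by (simp only: norm_divide cmod_phase norm_mult norm_ii norm_of_real)
  finally show ?thesis .
qed

definition phase_sum :: "(real \<times> real set) set \<Rightarrow> real \<Rightarrow> complex" where
  "phase_sum D r = (\<Sum>(s, k)\<in>D. measure lborel k *\<^sub>R exp (\<i> * of_real s * of_real r))"

lemma sum_content_tagged_division:
  fixes T :: real
  assumes "D tagged_division_of {-T..T}" "0 \<le> T"
  shows "(\<Sum>(s, k)\<in>D. measure lborel k) = 2 * T"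
  using additive_content_tagged_division[of D "-T" T] assms by simp

lemma cmod_phase_sum_le:
  assumes D: "D tagged_division_of {-T..T}" and T: "0 \<le> T"
  shows "cmod (phase_sum D r) \<le> 2 * T"
proof -
  have "cmod (phase_sum D r) \<le> (\<Sum>(s, k)\<in>D. measure lborel k)"
    unfolding phase_sum_def by (intro sum_norm_le) (auto simp: cmod_phase)
  then show ?thesis
    using sum_content_tagged_division[OF assms] by simp
qed

text \<open>
  The phase has Lipschitz constant \<open>\<bar>r\<bar>\<close>, so on a piece of length less than \<open>\<delta>\<close> it differs from its value
  at the tag by at most \<open>\<bar>r\<bar> \<delta>\<close>.
\<close>

lemma phase_sum_approx:
  assumes D: "D tagged_division_of {-T..T}" and fine: "\<forall>(s, k)\<in>D. measure lborel k < \<delta>" and T: "0 \<le> T"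
  shows "cmod (phase_sum D r - phase_integral T r) \<le> \<bar>r\<bar> * \<delta> * (2 * T)"
proof -
  let ?g = "\<lambda>t::real. exp (\<i> * of_real t * of_real r)"
  have D': "D tagged_division_of cbox (-T) T"
    using D by simp
  have "phase_integral T r = (\<Sum>(s, k)\<in>D. integral k ?g)"
    unfolding phase_integral_def 
    using integral_combine_tagged_division_topdown[OF _ D', of ?g] phase_integrable[of r "-T" T] by simp
  then have "phase_sum D r - phase_integral T r = (\<Sum>(s, k)\<in>D. measure lborel k *\<^sub>R ?g s - integral k ?g)"
    by (simp add: phase_sum_def sum_subtractf case_prod_unfold)
  also have "cmod \<dots> \<le> (\<Sum>(s, k)\<in>D. \<bar>r\<bar> * \<delta> * measure lborel k)"
  proof (intro sum_norm_le)
    fix p assume p: "p \<in> D"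
    obtain s k where [simp]: "p = (s, k)"
      by (cases p)
    obtain a b where k: "k = {a..b}"
      using tagged_division_ofD(4)[OF D', of s k] p by auto
    have s: "s \<in> {a..b}"
      using tagged_division_ofD(2)[OF D', of s k] p k by auto
    have small: "b - a < \<delta>"
      using fine p k s by auto
    have "((\<lambda>t. ?g s - ?g t) has_integral (measure lborel k *\<^sub>R ?g s - integral k ?g)) (cbox a b)"
      unfolding k using has_integral_diff[OF has_integral_const_real[of "?g s" a b] integrable_integral[OF phase_integrable[of r a b]]]
      by simp
    moreover have "cmod (?g s - ?g t) \<le> \<bar>r\<bar> * \<delta>" if "t \<in> cbox a b" for t
    proof -
      have "cmod (?g s - ?g t) \<le> \<bar>s * r - t * r\<bar>"
        using cmod_exp_ii_diff[of "s * r" "t * r"] by (simp add: mult.assoc)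
      also have "\<dots> = \<bar>r\<bar> * \<bar>s - t\<bar>"
        by (simp add: abs_mult[symmetric] algebra_simps)
      also have "\<dots> \<le> \<bar>r\<bar> * \<delta>"
        using that s small by (intro mult_left_mono) auto
      finally show ?thesis .
    qed
    ultimately have "norm (measure lborel k *\<^sub>R ?g s - integral k ?g) \<le> \<bar>r\<bar> * \<delta> * measure lborel (cbox a b)"
      using small s by (intro has_integral_bound[where f = "\<lambda>t. ?g s - ?g t"]) auto
    then show "norm (case p of (s, k) \<Rightarrow> measure lborel k *\<^sub>R ?g s - integral k ?g)
        \<le> (case p of (s, k) \<Rightarrow> \<bar>r\<bar> * \<delta> * measure lborel k)"
      by (simp add: k)
  qed
  also have "\<dots> = \<bar>r\<bar> * \<delta> * (\<Sum>(s, k)\<in>D. measure lborel k)"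
    by (simp add: sum_distrib_left case_prod_unfold)
  finally show ?thesis
    using sum_content_tagged_division[OF D T] by simp
qed

lemma ex_fine_tagged_division:
  fixes T \<delta> :: real
  assumes "0 < \<delta>"
  obtains D where "D tagged_division_of {-T..T}" "\<forall>(s, k)\<in>D. measure lborel k < \<delta>"
proof -
  have "gauge (\<lambda>x::real. ball x (\<delta> / 4))"
    using assms by (intro gauge_ball) simp
  then obtain D where D: "D tagged_division_of cbox (-T) T" "(\<lambda>x. ball x (\<delta> / 4)) fine D"
    by (rule fine_division_exists)
  have "measure lborel k < \<delta>" if sk: "(s, k) \<in> D" for s k
  proof -
    obtain a b where k: "k = {a..b}"
      using tagged_division_ofD(4)[OF D(1) sk] by auto
    have "k \<subseteq> ball s (\<delta> / 4)"
      using D(2) sk by (auto simp: fine_def)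
    then have "b - a < \<delta>" if "a \<le> b"
    proof -
      have "a \<in> ball s (\<delta> / 4)" "b \<in> ball s (\<delta> / 4)"
        using \<open>k \<subseteq> ball s (\<delta> / 4)\<close> that k by auto
      then show ?thesis
        using assms unfolding mem_ball dist_real_def by linarith
    qed
    then show ?thesis
      using k assms by (cases "a \<le> b") auto
  qed
  then show thesis
    using D(1) by (intro that[of D]) auto
qed

context l2_basis
begin

context
  fixes U :: "real \<Rightarrow> ('a \<Rightarrow> complex) \<Rightarrow> 'a \<Rightarrow> complex" and l :: "int \<Rightarrow> real"
  assumes U: "is_multiplier (U t) (\<lambda>n. exp (\<i> * of_real t * of_real (l n)))"
begin

lemma riemann_sum_L2:
  assumes f: "f \<in> L2 M"
  shows "(\<lambda>x. \<Sum>(s, k)\<in>D. measure lborel k *\<^sub>R U s f x) \<in> L2 M"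
    and "hat (\<lambda>x. \<Sum>(s, k)\<in>D. measure lborel k *\<^sub>R U s f x) n = phase_sum D (l n) * hat f n"
proof -
  let ?F = "\<lambda>p x. of_real (measure lborel (snd p)) * U (fst p) f x"
  have F: "?F p \<in> L2 M" for p
    using multiplierD(1)[OF U f] by (rule L2_scale)
  have eq: "(\<lambda>x. \<Sum>(s, k)\<in>D. measure lborel k *\<^sub>R U s f x) = (\<lambda>x. \<Sum>p\<in>D. ?F p x)"
    by (simp add: case_prod_unfold scaleR_conv_of_real)
  show "(\<lambda>x. \<Sum>(s, k)\<in>D. measure lborel k *\<^sub>R U s f x) \<in> L2 M"
    unfolding eq by (intro L2_sum F)
  have "hat (\<lambda>x. \<Sum>p\<in>D. ?F p x) n = (\<Sum>p\<in>D. hat (?F p) n)"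
    by (rule hat_sum[OF F])
  also have "\<dots> = phase_sum D (l n) * hat f n"
    using f by (simp add: hat_scale multiplierD[OF U f] phase_sum_def case_prod_unfold
        scaleR_conv_of_real sum_distrib_right mult.assoc)
  finally show "hat (\<lambda>x. \<Sum>(s, k)\<in>D. measure lborel k *\<^sub>R U s f x) n = phase_sum D (l n) * hat f n"
    by (simp only: eq)
qed

text \<open>
  The error of a Riemann sum is a multiplier. On finitely many coefficients it is uniformly small for
  fine divisions; on the others it is at most \<open>4 T\<close>, and these carry little of the norm of \<open>f\<close>.
\<close>

lemma multiplier_has_strong_integral:
  assumes T: "0 \<le> T" and f: "f \<in> L2 M" and v: "v \<in> L2 M"
    and hat_v: "\<And>n. hat v n = phase_integral T (l n) * hat f n"
  shows "has_strong_integral M (\<lambda>t. U t f) v {-T..T}"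
  unfolding has_strong_integral_def
proof (intro conjI allI impI v)
  fix \<epsilon> :: real assume \<epsilon>: "0 < \<epsilon>"
  define B where "B = l2_norm Zs (hat f)"
  define S where "S N = (\<Sum>n\<in>window N. (cmod (hat f n))\<^sup>2)" for N
  have c_int: "integrable Zs (\<lambda>n. (cmod (hat f n))\<^sup>2)"
    by (rule L2_integrable[OF hat_L2[OF f]])
  have "S \<longlonglongrightarrow> B\<^sup>2"
    unfolding S_def[abs_def] B_def l2_norm_power2 by (rule sum_window_tendsto[OF c_int])
  then have "(\<lambda>N. 16 * T\<^sup>2 * (B\<^sup>2 - S N)) \<longlonglongrightarrow> 16 * T\<^sup>2 * (B\<^sup>2 - B\<^sup>2)"
    by (intro tendsto_intros)
  then have "\<forall>\<^sub>F N in sequentially. 16 * T\<^sup>2 * (B\<^sup>2 - S N) < \<epsilon>\<^sup>2 / 2"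
    using \<epsilon> by (intro order_tendstoD(2)) auto
  then obtain N where N: "16 * T\<^sup>2 * (B\<^sup>2 - S N) < \<epsilon>\<^sup>2 / 2"
    by (rule eventually_happens'[OF sequentially_bot, THEN exE])
  define \<Lambda> where "\<Lambda> = (\<Sum>n\<in>window N. \<bar>l n\<bar>)"
  have \<Lambda>: "\<bar>l n\<bar> \<le> \<Lambda>" if "n \<in> window N" for n
    unfolding \<Lambda>_def using that by (intro member_le_sum) auto
  have "0 \<le> \<Lambda>" "0 \<le> B"
    by (auto simp: \<Lambda>_def B_def intro: sum_nonneg)
  \<comment> \<open>The summand \<open>1\<close> keeps the divisor positive when \<open>\<Lambda>\<close>, \<open>T\<close> or \<open>B\<close> vanishes.\<close>
  define C where "C = \<Lambda> * (2 * T) * B + 1"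
  have "C > 0"
    using \<open>0 \<le> \<Lambda>\<close> \<open>0 \<le> B\<close> T by (simp add: C_def add_nonneg_pos)
  define \<delta> where "\<delta> = \<epsilon> / (2 * C)"
  have "\<delta> > 0"
    using \<epsilon> \<open>C > 0\<close> by (simp add: \<delta>_def)
  define \<eta> where "\<eta> = \<Lambda> * \<delta> * (2 * T)"
  have \<eta>: "0 \<le> \<eta>" "\<eta> * B \<le> \<epsilon> / 2"
  proof -
    show "0 \<le> \<eta>"
      using \<open>0 \<le> \<Lambda>\<close> \<open>\<delta> > 0\<close> T by (simp add: \<eta>_def)
    have "\<eta> * B = \<delta> * (C - 1)"
      by (simp add: \<eta>_def C_def)
    also have "\<dots> \<le> \<delta> * C"
      using \<open>\<delta> > 0\<close> by simp
    also have "\<dots> = \<epsilon> / 2"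
      using \<open>C > 0\<close> by (simp add: \<delta>_def)
    finally show "\<eta> * B \<le> \<epsilon> / 2" .
  qed
  have "l2_norm M (\<lambda>x. (\<Sum>(s, k)\<in>D. measure lborel k *\<^sub>R U s f x) - v x) < \<epsilon>"
    if D: "D tagged_division_of {-T..T} \<and> (\<forall>(s, k)\<in>D. measure lborel k < \<delta>)" for D
  proof -
    let ?R = "\<lambda>x. (\<Sum>(s, k)\<in>D. measure lborel k *\<^sub>R U s f x) - v x"
    let ?\<rho> = "\<lambda>n. phase_sum D (l n) - phase_integral T (l n)"
    have R: "?R \<in> L2 M"
      by (intro L2_diff riemann_sum_L2 f v)
    have hat_R: "hat ?R n = ?\<rho> n * hat f n" for n
      using f v by (simp only: hat_diff riemann_sum_L2 hat_v left_diff_distrib)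
    have \<rho>1: "(cmod (?\<rho> n))\<^sup>2 \<le> \<eta>\<^sup>2" if "n \<in> window N" for n
    proof (rule power_mono)
      have "cmod (?\<rho> n) \<le> \<bar>l n\<bar> * \<delta> * (2 * T)"
        using D T by (intro phase_sum_approx) auto
      also have "\<dots> \<le> \<eta>"
        unfolding \<eta>_def using \<Lambda>[OF that] \<open>\<delta> > 0\<close> T by (intro mult_right_mono) auto
      finally show "cmod (?\<rho> n) \<le> \<eta>" .
    qed simp
    have \<rho>2: "(cmod (?\<rho> n))\<^sup>2 \<le> 16 * T\<^sup>2" for n
    proof -
      have "cmod (?\<rho> n) \<le> cmod (phase_sum D (l n)) + cmod (phase_integral T (l n))"
        by (rule norm_triangle_ineq4)
      also have "\<dots> \<le> 4 * T"
        using cmod_phase_sum_le[of D T "l n"] cmod_phase_integral_le[OF T, of "l n"] D T by linarith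
      finally have "(cmod (?\<rho> n))\<^sup>2 \<le> (4 * T)\<^sup>2"
        by (rule power_mono) simp
      then show ?thesis
        by (simp add: power_mult_distrib)
    qed
    have int1: "integrable Zs (\<lambda>n. indicator (window N) n *\<^sub>R (cmod (hat f n))\<^sup>2)"
      by (intro integrable_mult_indicator c_int) simp
    have "(l2_norm M ?R)\<^sup>2 = (LINT n|Zs. (cmod (?\<rho> n * hat f n))\<^sup>2)"
      by (simp only: Parseval_norm[OF R] l2_norm_power2 hat_R)
    also have "\<dots> \<le> (LINT n|Zs. \<eta>\<^sup>2 * (indicator (window N) n *\<^sub>R (cmod (hat f n))\<^sup>2)
        + 16 * T\<^sup>2 * ((cmod (hat f n))\<^sup>2 - indicator (window N) n *\<^sub>R (cmod (hat f n))\<^sup>2))"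
    proof (rule integral_mono)
      show "integrable Zs (\<lambda>n. (cmod (?\<rho> n * hat f n))\<^sup>2)"
        using L2_integrable[OF hat_L2[OF R]] by (simp only: hat_R)
      show "integrable Zs (\<lambda>n. \<eta>\<^sup>2 * (indicator (window N) n *\<^sub>R (cmod (hat f n))\<^sup>2)
        + 16 * T\<^sup>2 * ((cmod (hat f n))\<^sup>2 - indicator (window N) n *\<^sub>R (cmod (hat f n))\<^sup>2))"
        by (intro Bochner_Integration.integrable_add Bochner_Integration.integrable_diff
            integrable_mult_right int1 c_int)
      fix n
      show "(cmod (?\<rho> n * hat f n))\<^sup>2 \<le> \<eta>\<^sup>2 * (indicator (window N) n *\<^sub>R (cmod (hat f n))\<^sup>2)
        + 16 * T\<^sup>2 * ((cmod (hat f n))\<^sup>2 - indicator (window N) n *\<^sub>R (cmod (hat f n))\<^sup>2)"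
        using mult_right_mono[OF \<rho>1[of n], of "(cmod (hat f n))\<^sup>2"] mult_right_mono[OF \<rho>2[of n], of "(cmod (hat f n))\<^sup>2"]
        by (cases "n \<in> window N") (simp_all add: norm_mult power_mult_distrib)
    qed
    also have "\<dots> = \<eta>\<^sup>2 * S N + 16 * T\<^sup>2 * (B\<^sup>2 - S N)"
      using int1 c_int sum_finite_eq_integral[OF finite_window, of N "\<lambda>n. (cmod (hat f n))\<^sup>2"]
      by (simp add: S_def B_def l2_norm_power2)
    also have "\<dots> < (\<epsilon> / 2)\<^sup>2 + \<epsilon>\<^sup>2 / 2"
    proof -
      have "S N \<le> B\<^sup>2"
        unfolding S_def B_def Parseval_norm[OF f, symmetric] by (rule Bessel[OF f finite_window])
      then have "\<eta>\<^sup>2 * S N \<le> (\<eta> * B)\<^sup>2"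
        by (simp add: power_mult_distrib mult_left_mono)
      also have "\<dots> \<le> (\<epsilon> / 2)\<^sup>2"
        using \<eta> \<open>0 \<le> B\<close> by (intro power_mono) auto
      finally show ?thesis
        using N by linarith
    qed
    also have "\<dots> \<le> \<epsilon>\<^sup>2"
      by (simp add: power_divide)
    finally show ?thesis
      by (rule power2_less_imp_less) (use \<epsilon> in simp)
  qed
  then show "\<exists>\<delta>>0. \<forall>D. D tagged_division_of {-T..T} \<and> (\<forall>(s, k)\<in>D. measure lborel k < \<delta>) \<longrightarrow>
      l2_norm M (\<lambda>x. (\<Sum>(s, k)\<in>D. measure lborel k *\<^sub>R U s f x) - v x) < \<epsilon>"
    using \<open>\<delta> > 0\<close> by blast
qed

text \<open>
  Two strong integrals are both close to the Riemann sum of one sufficiently fine division.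
\<close>

lemma strong_integral_hat_unique:
  assumes f: "f \<in> L2 M"
    and v: "has_strong_integral M (\<lambda>t. U t f) v {-T..T}"
    and v': "has_strong_integral M (\<lambda>t. U t f) v' {-T..T}"
  shows "hat v n = hat v' n"
proof -
  have vL: "v \<in> L2 M" "v' \<in> L2 M"
    using v v' by (auto simp: has_strong_integral_def)
  have "cmod (hat v n - hat v' n) \<le> \<epsilon>" if "\<epsilon> > 0" for \<epsilon>
  proof -
    have "\<epsilon> / 2 > 0"
      using that by simp
    obtain \<delta>1 where \<delta>1: "\<delta>1 > 0" "\<And>D. D tagged_division_of {-T..T} \<and> (\<forall>(s, k)\<in>D. measure lborel k < \<delta>1) \<Longrightarrow>
      l2_norm M (\<lambda>x. (\<Sum>(s, k)\<in>D. measure lborel k *\<^sub>R U s f x) - v x) < \<epsilon> / 2"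
      using v \<open>\<epsilon> / 2 > 0\<close> unfolding has_strong_integral_def by meson
    obtain \<delta>2 where \<delta>2: "\<delta>2 > 0" "\<And>D. D tagged_division_of {-T..T} \<and> (\<forall>(s, k)\<in>D. measure lborel k < \<delta>2) \<Longrightarrow>
      l2_norm M (\<lambda>x. (\<Sum>(s, k)\<in>D. measure lborel k *\<^sub>R U s f x) - v' x) < \<epsilon> / 2"
      using v' \<open>\<epsilon> / 2 > 0\<close> unfolding has_strong_integral_def by meson
    obtain D where D: "D tagged_division_of {-T..T}" "\<forall>(s, k)\<in>D. measure lborel k < min \<delta>1 \<delta>2"
      using \<delta>1(1) \<delta>2(1) by (auto intro: ex_fine_tagged_division[of "min \<delta>1 \<delta>2" T])
    let ?R = "\<lambda>x. (\<Sum>(s, k)\<in>D. measure lborel k *\<^sub>R U s f x)"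
    have R: "?R \<in> L2 M"
      by (rule riemann_sum_L2[OF f])
    have "cmod (hat ?R n - hat v n) \<le> l2_norm M (\<lambda>x. ?R x - v x)"
      using norm_hat_le[OF L2_diff[OF R vL(1)], of n] by (simp only: hat_diff[OF R vL(1)])
    also have "\<dots> < \<epsilon> / 2"
      using D by (intro \<delta>1(2)) auto
    finally have 1: "cmod (hat ?R n - hat v n) < \<epsilon> / 2" .
    have "cmod (hat ?R n - hat v' n) \<le> l2_norm M (\<lambda>x. ?R x - v' x)"
      using norm_hat_le[OF L2_diff[OF R vL(2)], of n] by (simp only: hat_diff[OF R vL(2)])
    also have "\<dots> < \<epsilon> / 2"
      using D by (intro \<delta>2(2)) auto
    finally have 2: "cmod (hat ?R n - hat v' n) < \<epsilon> / 2" .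
    have "hat v n - hat v' n = (hat ?R n - hat v' n) - (hat ?R n - hat v n)"
      by simp
    then have "cmod (hat v n - hat v' n) \<le> cmod (hat ?R n - hat v' n) + cmod (hat ?R n - hat v n)"
      by (metis norm_triangle_ineq4)
    then show ?thesis
      using 1 2 by linarith
  qed
  then have "cmod (hat v n - hat v' n) \<le> 0"
    by (rule field_le_epsilon) simp
  then show ?thesis
    by simp
qed

lemma time_average_multiplier:
  assumes T: "0 < T"
  shows "is_multiplier (time_average M U T) (\<lambda>n. phase_integral T (l n) / of_real (2 * T))"
  unfolding is_multiplier_def
proof (rule ballI)
  fix f assume f: "f \<in> L2 M"
  obtain A where A: "is_multiplier A (\<lambda>n. phase_integral T (l n))"
    by (rule ex_multiplier[of "\<lambda>n. phase_integral T (l n)" "2 * T"]) (use T cmod_phase_integral_le in auto)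
  have v: "has_strong_integral M (\<lambda>t. U t f) (A f) {-T..T}"
    using T f multiplierD[OF A f] by (intro multiplier_has_strong_integral) auto
  define v' where "v' = (SOME v. has_strong_integral M (\<lambda>t. U t f) v {-T..T})"
  have v': "has_strong_integral M (\<lambda>t. U t f) v' {-T..T}"
    unfolding v'_def by (rule someI[where P = "\<lambda>v. has_strong_integral M (\<lambda>t. U t f) v {-T..T}", OF v])
  have v'L: "v' \<in> L2 M"
    using v' by (simp add: has_strong_integral_def)
  have eq: "time_average M U T f = (\<lambda>x. (1 / of_real (2 * T)) * v' x)"
    by (simp add: time_average_def v'_def)
  show "time_average M U T f \<in> L2 M \<and>
      (\<forall>n. hat (time_average M U T f) n = phase_integral T (l n) / of_real (2 * T) * hat f n)"
  proof (intro conjI allI)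
    show "time_average M U T f \<in> L2 M"
      unfolding eq by (rule L2_scale[OF v'L])
    fix n
    have "hat v' n = phase_integral T (l n) * hat f n"
      using strong_integral_hat_unique[OF f v v'] multiplierD(2)[OF A f] by simp
    then show "hat (time_average M U T f) n = phase_integral T (l n) / of_real (2 * T) * hat f n"
      unfolding eq hat_scale[OF v'L] by simp
  qed
qed

end

text \<open>
  The convergence is uniform because the averaged phase decays like \<open>1 / (T \<bar>l n\<bar>)\<close> and \<open>\<bar>l n\<bar> \<ge> \<delta>\<close> for all
  coefficients outside the kernel.
\<close>

theorem time_averages_converge_if_gap:
  fixes l :: "int \<Rightarrow> real"
  assumes gap: "\<delta> > 0" "\<And>n. l n = 0 \<or> \<delta> \<le> \<bar>l n\<bar>"
  shows "op_norm_tendsto M (\<lambda>T. time_average M (exp_it M (diag (\<lambda>n. of_real (l n)))) T)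
    (orth_proj M (op_kernel (diag (\<lambda>n. of_real (l n))))) at_top"
proof -
  let ?A = "time_average M (exp_it M (diag (\<lambda>n. of_real (l n))))"
  let ?P = "orth_proj M (op_kernel (diag (\<lambda>n. of_real (l n))))"
  note A = time_average_multiplier[OF exp_it_multiplier[of l]]
  note P = orth_proj_kernel_multiplier[of l]
  have bounded: "?A T \<in> bounded_ops M" if T: "0 < T" for T
  proof (rule multiplier_bounded_ops[OF A[OF T]])
    fix n
    show "cmod (phase_integral T (l n) / of_real (2 * T)) \<le> 1"
      using cmod_phase_integral_le[of T "l n"] T by (simp add: norm_divide)
  qed
  have diff_le: "op_norm M (\<lambda>f x. ?A T f x - ?P f x) \<le> ennreal (1 / (T * \<delta>))" if T: "0 < T" for T
  proof (rule multiplier_op_norm_le)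
    let ?m = "\<lambda>n. phase_integral T (l n) / of_real (2 * T) - (if l n = 0 then 1 else 0)"
    show "is_multiplier (\<lambda>f x. ?A T f x - ?P f x) ?m"
      using multiplierD[OF A[OF T]] multiplierD[OF P]
      by (auto simp: is_multiplier_def L2_diff hat_diff left_diff_distrib)
    fix n
    show "cmod (?m n) \<le> 1 / (T * \<delta>)"
    proof (cases "l n = 0")
      case True
      then show ?thesis
        using T gap(1) by (simp add: phase_integral_0)
    next
      case False
      then have "\<delta> \<le> \<bar>l n\<bar>"
        using gap(2)[of n] by simp
      have "cmod (?m n) = cmod (phase_integral T (l n)) / (2 * T)"
        using False T by (simp add: norm_divide)
      also have "\<dots> \<le> (2 / \<bar>l n\<bar>) / (2 * T)"
        using cmod_phase_integral_le_inverse[of T "l n"] False T by (intro divide_right_mono) auto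
      also have "\<dots> \<le> (2 / \<delta>) / (2 * T)"
        using \<open>\<delta> \<le> \<bar>l n\<bar>\<close> gap(1) T by (intro divide_right_mono divide_left_mono) auto
      also have "\<dots> = 1 / (T * \<delta>)"
        using T gap(1) by simp
      finally show ?thesis .
    qed
  qed
  have "((\<lambda>T. op_norm M (\<lambda>f x. ?A T f x - ?P f x)) \<longlongrightarrow> 0) at_top"
  proof (rule tendsto_sandwich[OF _ _ tendsto_const])
    have "((\<lambda>T. inverse \<delta> * inverse T) \<longlongrightarrow> inverse \<delta> * 0) at_top"
      by (intro tendsto_mult tendsto_const tendsto_inverse_0_at_top filterlim_ident)
    then have "((\<lambda>T. 1 / (T * \<delta>)) \<longlongrightarrow> 0) at_top"
      by (simp add: field_simps)
    then have "((\<lambda>T. ennreal (1 / (T * \<delta>))) \<longlongrightarrow> ennreal 0) at_top"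
      by (rule tendsto_ennrealI)
    then show "((\<lambda>T. ennreal (1 / (T * \<delta>))) \<longlongrightarrow> 0) at_top"
      by simp
    show "\<forall>\<^sub>F T in at_top. op_norm M (\<lambda>f x. ?A T f x - ?P f x) \<le> ennreal (1 / (T * \<delta>))"
      using eventually_gt_at_top[of 0] by eventually_elim (rule diff_le)
  qed simp
  moreover have "\<forall>\<^sub>F T in at_top. ?A T \<in> bounded_ops M"
    using eventually_gt_at_top[of 0] by eventually_elim (rule bounded)
  moreover have "?P \<in> bounded_ops M"
    by (rule multiplier_bounded_ops[OF P, of 1]) auto
  ultimately show ?thesis
    by (simp add: op_norm_tendsto_def)
qed

end

section \<open>Primitives of integrable functions\<close>

lemma sigma_finite_lebesgue: "sigma_finite_measure (lebesgue :: real measure)"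
proof
  obtain A :: "real set set" where A: "countable A" "A \<subseteq> sets lborel" "\<Union>A = space lborel"
    "\<forall>a\<in>A. emeasure lborel a \<noteq> \<infinity>"
    using sigma_finite_measure.sigma_finite_countable[OF sigma_finite_lborel] by metis
  show "\<exists>A. countable A \<and> A \<subseteq> sets (lebesgue :: real measure) \<and> \<Union>A = space lebesgue
      \<and> (\<forall>a\<in>A. emeasure lebesgue a \<noteq> \<infinity>)"
    using A by (intro exI[of _ A]) auto
qed

interpretation lebesgue_pair: pair_sigma_finite "lebesgue :: real measure" "lebesgue :: real measure"
  by (intro pair_sigma_finite.intro sigma_finite_lebesgue)

text \<open>
  The primitive that vanishes at \<open>-\<infinity>\<close>. Primitives of integrable functions are the absolutely
  continuous functions with integrable derivative and limit \<open>0\<close> at \<open>-\<infinity>\<close>.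
\<close>

definition primitive :: "(real \<Rightarrow> 'b :: {banach, second_countable_topology}) \<Rightarrow> real \<Rightarrow> 'b" where
  "primitive p x = (LINT y|lebesgue. indicator {..x} y *\<^sub>R p y)"

lemma AE_lebesgue_neq: "AE y in lebesgue. y \<noteq> (x :: real)"
  by (rule AE_completion[OF AE_lborel_singleton])

lemma primitive_integrable:
  fixes p :: "real \<Rightarrow> 'b :: {banach, second_countable_topology}"
  assumes "integrable lebesgue p"
  shows "integrable lebesgue (\<lambda>y. indicator {..x :: real} y *\<^sub>R p y)"
  using assms by (intro integrable_mult_indicator) auto

lemma primitive_tendsto:
  fixes p :: "real \<Rightarrow> 'b :: {banach, second_countable_topology}"
  assumes p: "integrable lebesgue p" and A: "A \<in> sets lebesgue"
    and lim: "AE y in lebesgue. (\<lambda>n. indicator {..X n} y :: real) \<longlonglongrightarrow> indicator A y"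
  shows "(\<lambda>n. primitive p (X n)) \<longlonglongrightarrow> (LINT y|lebesgue. indicator A y *\<^sub>R p y)"
  unfolding primitive_def
proof (rule integral_dominated_convergence)
  show "integrable lebesgue (\<lambda>y. norm (p y))"
    using p by simp
  show "AE y in lebesgue. (\<lambda>n. indicator {..X n} y *\<^sub>R p y) \<longlonglongrightarrow> indicator A y *\<^sub>R p y"
    using lim by eventually_elim (intro tendsto_intros)
  show "(\<lambda>y. indicator A y *\<^sub>R p y) \<in> borel_measurable lebesgue"
    using p A by (intro borel_measurable_scaleR) auto
  show "(\<lambda>y. indicator {..X n} y *\<^sub>R p y) \<in> borel_measurable lebesgue" for n
    using primitive_integrable[OF p] by auto
qed (auto simp: indicator_def)

lemma continuous_on_primitive:
  assumes p: "integrable lebesgue p"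
  shows "continuous_on UNIV (primitive p)"
  unfolding continuous_on_sequentially
proof (intro allI ballI impI, elim conjE)
  fix X :: "nat \<Rightarrow> real" and x assume X: "X \<longlonglongrightarrow> x"
  have "(\<lambda>n. primitive p (X n)) \<longlonglongrightarrow> (LINT y|lebesgue. indicator {..x} y *\<^sub>R p y)"
  proof (rule primitive_tendsto[OF p])
    show "AE y in lebesgue. (\<lambda>n. indicator {..X n} y :: real) \<longlonglongrightarrow> indicator {..x} y"
      using AE_lebesgue_neq[of x]
    proof eventually_elim
      case (elim y)
      show ?case
      proof (cases "y < x")
        case True
        then have "\<forall>\<^sub>F n in sequentially. y < X n"
          using order_tendstoD(1)[OF X] by blast
        then show ?thesis
          using True by (intro tendsto_eventually) (auto elim: eventually_mono)
      next
        case False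
        then have "\<forall>\<^sub>F n in sequentially. X n < y"
          using order_tendstoD(2)[OF X] elim by force
        then show ?thesis
          using False elim by (intro tendsto_eventually) (auto elim: eventually_mono)
      qed
    qed
  qed simp
  then show "(primitive p \<circ> X) \<longlonglongrightarrow> primitive p x"
    by (simp add: primitive_def[of p x] o_def)
qed

lemma primitive_tendsto_at_top:
  assumes p: "integrable lebesgue p"
  shows "(primitive p \<longlongrightarrow> integral\<^sup>L lebesgue p) at_top"
proof (rule tendsto_at_topI_sequentially)
  fix X :: "nat \<Rightarrow> real" assume X: "filterlim X at_top sequentially"
  have "(\<lambda>n. primitive p (X n)) \<longlonglongrightarrow> (LINT y|lebesgue. indicator UNIV y *\<^sub>R p y)"
  proof (rule primitive_tendsto[OF p])
    show "AE y in lebesgue. (\<lambda>n. indicator {..X n} y :: real) \<longlonglongrightarrow> indicator UNIV y"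
    proof (rule AE_I2)
      fix y
      have "\<forall>\<^sub>F n in sequentially. y \<le> X n"
        using X by (simp add: filterlim_at_top)
      then show "(\<lambda>n. indicator {..X n} y :: real) \<longlonglongrightarrow> indicator UNIV y"
        by (intro tendsto_eventually) (auto elim: eventually_mono)
    qed
  qed simp
  then show "(\<lambda>n. primitive p (X n)) \<longlonglongrightarrow> integral\<^sup>L lebesgue p"
    by simp
qed

lemma primitive_tendsto_at_bot:
  assumes p: "integrable lebesgue p"
  shows "(primitive p \<longlongrightarrow> 0) at_bot"
proof -
  have "((\<lambda>x. primitive p (- x)) \<longlongrightarrow> 0) at_top"
  proof (rule tendsto_at_topI_sequentially)
    fix X :: "nat \<Rightarrow> real" assume X: "filterlim X at_top sequentially"
    have "(\<lambda>n. primitive p (- X n)) \<longlonglongrightarrow> (LINT y|lebesgue. indicator {} y *\<^sub>R p y)"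
    proof (rule primitive_tendsto[OF p])
      show "AE y in lebesgue. (\<lambda>n. indicator {..- X n} y :: real) \<longlonglongrightarrow> indicator {} y"
      proof (rule AE_I2)
        fix y
        have "\<forall>\<^sub>F n in sequentially. - y < X n"
          using X by (simp add: filterlim_at_top_dense)
        then show "(\<lambda>n. indicator {..- X n} y :: real) \<longlonglongrightarrow> indicator {} y"
          by (intro tendsto_eventually) (auto elim: eventually_mono)
      qed
    qed simp
    then show "(\<lambda>n. primitive p (- X n)) \<longlonglongrightarrow> 0"
      by simp
  qed
  then show ?thesis
    by (simp add: filterlim_at_bot_mirror)
qed

lemma primitive_diff:
  assumes p: "integrable lebesgue p" and "a \<le> b"
  shows "primitive p b - primitive p a = (LINT y|lebesgue. indicator {a..b} y *\<^sub>R p y)"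
proof -
  have "primitive p b - primitive p a = (LINT y|lebesgue. indicator {..b} y *\<^sub>R p y - indicator {..a} y *\<^sub>R p y)"
    unfolding primitive_def using primitive_integrable[OF p] by simp
  also have "\<dots> = (LINT y|lebesgue. indicator {a..b} y *\<^sub>R p y)"
  proof (rule integral_cong_AE)
    show "AE y in lebesgue. indicator {..b} y *\<^sub>R p y - indicator {..a} y *\<^sub>R p y = indicator {a..b} y *\<^sub>R p y"
      using AE_lebesgue_neq[of a]
      by eventually_elim (use \<open>a \<le> b\<close> in \<open>auto simp: indicator_def\<close>)
    show "(\<lambda>y. indicator {..b} y *\<^sub>R p y - indicator {..a} y *\<^sub>R p y) \<in> borel_measurable lebesgue"
      using primitive_integrable[OF p] by (intro borel_measurable_diff) auto
    show "(\<lambda>y. indicator {a..b} y *\<^sub>R p y) \<in> borel_measurable lebesgue"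
      by (intro borel_measurable_integrable integrable_mult_indicator p) simp
  qed
  finally show ?thesis .
qed

lemma norm_primitive_le:
  assumes p: "integrable lebesgue p"
  shows "norm (primitive p x) \<le> (LINT y|lebesgue. norm (p y))"
proof -
  have "norm (primitive p x) \<le> (LINT y|lebesgue. norm (indicator {..x} y *\<^sub>R p y))"
    unfolding primitive_def by (rule integral_norm_bound)
  also have "\<dots> \<le> (LINT y|lebesgue. norm (p y))"
    using integrable_norm[OF primitive_integrable[OF p]] p by (intro integral_mono) (auto simp: indicator_def)
  finally show ?thesis .
qed

lemma primitive_measurable [measurable]: 
  "integrable lebesgue p \<Longrightarrow> primitive p \<in> borel_measurable borel"
  by (intro borel_measurable_continuous_onI continuous_on_primitive)

lemma lebesgue_measurable_if_borel: "f \<in> borel_measurable borel \<Longrightarrow> f \<in> borel_measurable lebesgue"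
  by (rule measurable_completion) simp

lemma measurable_lebesgue_borel_ident: "(\<lambda>x. x) \<in> lebesgue \<rightarrow>\<^sub>M borel"
  by (rule lebesgue_measurable_if_borel) simp

lemma integrable_bounded_mult:
  fixes f g :: "'a \<Rightarrow> complex"
  assumes f: "integrable M f" and g: "g \<in> borel_measurable M" and bound: "\<And>x. norm (g x) \<le> C"
  shows "integrable M (\<lambda>x. g x * f x)" "integrable M (\<lambda>x. f x * g x)"
proof -
  show "integrable M (\<lambda>x. g x * f x)"
  proof (rule Bochner_Integration.integrable_bound)
    show "integrable M (\<lambda>x. C * norm (f x))"
      using f by simp
    have "norm (g x * f x) \<le> C * norm (f x)" for x
      unfolding norm_mult by (rule mult_right_mono[OF bound]) simp
    then show "AE x in M. norm (g x * f x) \<le> norm (C * norm (f x))"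
      by (auto intro!: AE_I2 order.trans[OF _ abs_ge_self])
  qed (use f g in auto)
  then show "integrable M (\<lambda>x. f x * g x)"
    by (simp add: mult.commute)
qed

text \<open>
  Both terms are integrals of \<open>p y * q x\<close> over the two halves of the plane that the diagonal separates;
  the diagonal is a null set.
\<close>

lemma primitive_by_parts:
  fixes p q :: "real \<Rightarrow> complex"
  assumes p: "integrable lebesgue p" and q: "integrable lebesgue q"
  shows "(LINT x|lebesgue. primitive p x * q x) + (LINT x|lebesgue. p x * primitive q x)
    = integral\<^sup>L lebesgue p * integral\<^sup>L lebesgue q"
proof -
  have [measurable]: "p \<in> borel_measurable lebesgue" "q \<in> borel_measurable lebesgue"
    using p q by auto
  have [measurable]: "(\<lambda>(x::real, y). indicator {..x} y :: complex) \<in> borel_measurable (lebesgue \<Otimes>\<^sub>M lebesgue)"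
  proof -
    have eq: "(\<lambda>(x::real, y). indicator {..x} y :: complex) = (\<lambda>z. indicator {z. snd z \<le> fst z} (fst z, snd z))"
      by (auto simp: indicator_def fun_eq_iff)
    have m1: "(\<lambda>z. (fst z, snd z)) \<in> (lebesgue \<Otimes>\<^sub>M lebesgue) \<rightarrow>\<^sub>M (borel :: (real \<times> real) measure)"
      unfolding borel_prod[symmetric]
      using measurable_compose[OF measurable_fst[of lebesgue lebesgue] measurable_lebesgue_borel_ident]
        measurable_compose[OF measurable_snd[of lebesgue lebesgue] measurable_lebesgue_borel_ident]
      by (intro measurable_Pair) simp_all
    have m2: "(indicator {z. snd z \<le> fst z} :: _ \<Rightarrow> complex) \<in> borel_measurable (borel :: (real \<times> real) measure)"
      by (intro borel_measurable_indicator borel_closed closed_Collect_le continuous_intros)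
    show ?thesis
      unfolding eq by (rule measurable_compose[OF m1 m2])
  qed
  let ?F = "\<lambda>x y. indicator {..x} y * (p x * q y)"
  have int: "integrable (lebesgue \<Otimes>\<^sub>M lebesgue) (case_prod ?F)"
  proof (rule lebesgue_pair.Fubini_integrable)
    show "case_prod ?F \<in> borel_measurable (lebesgue \<Otimes>\<^sub>M lebesgue)"
      by measurable
    have "integrable lebesgue (\<lambda>y. p x * (indicator {..x} y *\<^sub>R q y))" for x
      using primitive_integrable[OF q] by (rule integrable_mult_right)
    then show "AE x in lebesgue. integrable lebesgue (\<lambda>y. case (x, y) of (x, y) \<Rightarrow> ?F x y)"
      by (auto simp: scaleR_conv_of_real of_real_indicator ac_simps)
    have "(\<lambda>x. LINT y|lebesgue. norm (case (x, y) of (x, y) \<Rightarrow> ?F x y))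
        = (\<lambda>x. norm (p x) * primitive (\<lambda>y. norm (q y)) x)"
    proof
      fix x
      have "(LINT y|lebesgue. norm (case (x, y) of (x, y) \<Rightarrow> ?F x y))
        = (LINT y|lebesgue. norm (p x) * (indicator {..x} y *\<^sub>R norm (q y)))"
        by (intro Bochner_Integration.integral_cong) (auto simp: indicator_def norm_mult)
      then show "(LINT y|lebesgue. norm (case (x, y) of (x, y) \<Rightarrow> ?F x y)) = norm (p x) * primitive (\<lambda>y. norm (q y)) x"
        by (simp add: primitive_def)
    qed
    moreover have "integrable lebesgue (\<lambda>x. norm (p x) * primitive (\<lambda>y. norm (q y)) x)"
    proof (rule Bochner_Integration.integrable_bound)
      show "integrable lebesgue (\<lambda>x. norm (p x) * (LINT y|lebesgue. norm (q y)))"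
        using p by simp
      have "norm (primitive (\<lambda>y. norm (q y)) x) \<le> (LINT y|lebesgue. norm (q y))" for x
        using norm_primitive_le[of "\<lambda>y. norm (q y)" x] q by simp
      then show "AE x in lebesgue. norm (norm (p x) * primitive (\<lambda>y. norm (q y)) x)
          \<le> norm (norm (p x) * (LINT y|lebesgue. norm (q y)))"
        by (auto simp: abs_mult intro!: mult_left_mono)
      show "(\<lambda>x. norm (p x) * primitive (\<lambda>y. norm (q y)) x) \<in> borel_measurable lebesgue"
        using q by (intro borel_measurable_times borel_measurable_norm
            lebesgue_measurable_if_borel[OF primitive_measurable]) auto
    qed
    ultimately show "integrable lebesgue (\<lambda>x. LINT y|lebesgue. norm (case (x, y) of (x, y) \<Rightarrow> ?F x y))"
      by simp
  qed
  have "(LINT x|lebesgue. p x * primitive q x) = (LINT x|lebesgue. (LINT y|lebesgue. ?F x y))"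
  proof (rule Bochner_Integration.integral_cong[OF refl])
    fix x
    have "p x * primitive q x = (LINT y|lebesgue. p x * (indicator {..x} y *\<^sub>R q y))"
      unfolding primitive_def by (rule integral_mult_right_zero[symmetric])
    also have "\<dots> = (LINT y|lebesgue. ?F x y)"
      by (intro Bochner_Integration.integral_cong) (auto simp: indicator_def)
    finally show "p x * primitive q x = (LINT y|lebesgue. ?F x y)" .
  qed
  also have "\<dots> = (LINT y|lebesgue. (LINT x|lebesgue. ?F x y))"
    by (rule lebesgue_pair.Fubini_integral[OF int, symmetric])
  also have "\<dots> = (LINT y|lebesgue. integral\<^sup>L lebesgue p * q y - primitive p y * q y)"
  proof (rule Bochner_Integration.integral_cong[OF refl])
    fix y
    have "(LINT x|lebesgue. ?F x y) = (LINT x|lebesgue. (p x - indicator {..y} x *\<^sub>R p x) * q y)"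
    proof (rule integral_cong_AE)
      show "AE x in lebesgue. ?F x y = (p x - indicator {..y} x *\<^sub>R p x) * q y"
        using AE_lebesgue_neq[of y] by eventually_elim (auto simp: indicator_def)
      have "(\<lambda>x. indicator {y..} x *\<^sub>R (p x * q y)) \<in> borel_measurable lebesgue"
        using p by (intro borel_measurable_integrable integrable_mult_indicator) auto
      also have "(\<lambda>x. indicator {y..} x *\<^sub>R (p x * q y)) = (\<lambda>x. ?F x y)"
        by (auto simp: indicator_def)
      finally show "(\<lambda>x. ?F x y) \<in> borel_measurable lebesgue" .
      show "(\<lambda>x. (p x - indicator {..y} x *\<^sub>R p x) * q y) \<in> borel_measurable lebesgue"
        using p by (intro borel_measurable_integrable integrable_mult_left Bochner_Integration.integrable_diff
            primitive_integrable)
    qed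
    also have "\<dots> = (LINT x|lebesgue. p x - indicator {..y} x *\<^sub>R p x) * q y"
      by simp
    also have "\<dots> = integral\<^sup>L lebesgue p * q y - primitive p y * q y"
      using p primitive_integrable[OF p, of y] by (simp add: primitive_def left_diff_distrib)
    finally show "(LINT x|lebesgue. ?F x y) = integral\<^sup>L lebesgue p * q y - primitive p y * q y" .
  qed
  also have "\<dots> = integral\<^sup>L lebesgue p * integral\<^sup>L lebesgue q - (LINT y|lebesgue. primitive p y * q y)"
    using q integrable_bounded_mult(1)[OF q lebesgue_measurable_if_borel[OF primitive_measurable[OF p]] norm_primitive_le[OF p]]
    by simp
  finally show ?thesis
    by simp
qed

lemma AE_zero_if_set_integrals_zero:
  fixes p :: "'a \<Rightarrow> complex"
  assumes p: "integrable M p" and zero: "\<And>A. A \<in> sets M \<Longrightarrow> set_lebesgue_integral M A p = 0"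
  shows "AE x in M. p x = 0"
proof -
  have real: "AE x in M. q x \<le> 0"
    if q: "integrable M q" and q0: "\<And>A. A \<in> sets M \<Longrightarrow> (LINT x|M. indicator A x *\<^sub>R q x) = 0"
    for q :: "'a \<Rightarrow> real"
  proof -
    define A where "A = {x \<in> space M. 0 < q x}"
    have A: "A \<in> sets M"
      using q unfolding A_def by measurable
    have "AE x in M. indicator A x *\<^sub>R q x = 0"
      using q0[OF A] integrable_mult_indicator[OF A q]
      by (subst (asm) integral_nonneg_eq_0_iff_AE) (auto simp: A_def indicator_def)
    then show ?thesis
      using AE_space by eventually_elim (auto simp: A_def indicator_def not_less split: if_splits)
  qed
  have z: "(LINT x|M. indicator A x *\<^sub>R p x) = 0" if "A \<in> sets M" for A
    using zero[OF that] by (simp add: set_lebesgue_integral_def)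
  have int: "integrable M (\<lambda>x. indicator A x *\<^sub>R p x)" if "A \<in> sets M" for A
    using that p by (rule integrable_mult_indicator)
  have "(LINT x|M. indicator A x *\<^sub>R Re (p x)) = 0" "(LINT x|M. indicator A x *\<^sub>R Im (p x)) = 0"
    if "A \<in> sets M" for A
    using integral_Re[OF int[OF that]] integral_Im[OF int[OF that]] z[OF that] by simp_all
  then have "AE x in M. Re (p x) \<le> 0" "AE x in M. - Re (p x) \<le> 0"
    "AE x in M. Im (p x) \<le> 0" "AE x in M. - Im (p x) \<le> 0"
    using p real[of "\<lambda>x. Re (p x)"] real[of "\<lambda>x. - Re (p x)"]
      real[of "\<lambda>x. Im (p x)"] real[of "\<lambda>x. - Im (p x)"] by simp_all
  then show ?thesis
    by eventually_elim (simp add: complex_eq_iff)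
qed

text \<open>
  The half-lines generate the Borel sets, and every Lebesgue set is a Borel set up to a null set.
\<close>

lemma AE_zero_if_primitive_zero:
  fixes p :: "real \<Rightarrow> complex"
  assumes p: "integrable lebesgue p" and zero: "\<And>x. primitive p x = 0"
  shows "AE x in lebesgue. p x = 0"
proof (rule AE_zero_if_set_integrals_zero[OF p])
  have total: "integral\<^sup>L lebesgue p = 0"
  proof -
    have "((\<lambda>x::real. 0 :: complex) \<longlongrightarrow> integral\<^sup>L lebesgue p) at_top"
      using primitive_tendsto_at_top[OF p] unfolding zero .
    then show ?thesis
      using tendsto_unique[OF trivial_limit_at_top_linorder _ tendsto_const] by blast
  qed
  have int: "integrable lebesgue (\<lambda>x. indicator A x *\<^sub>R p x)" if "A \<in> sets lebesgue" for A
    using that p by (rule integrable_mult_indicator)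
  have sig: "sets borel = sigma_sets UNIV (range (\<lambda>a::real. {..a}))"
    by (subst borel_eq_atMost) simp
  have borel: "set_lebesgue_integral lebesgue A p = 0" if A: "A \<in> sets borel" for A :: "real set"
  proof -
    have "Int_stable (range (\<lambda>a::real. {..a}))" "range (\<lambda>a::real. {..a}) \<subseteq> Pow UNIV"
      "A \<in> sigma_sets UNIV (range (\<lambda>a::real. {..a}))"
      using A by (auto simp: Int_stable_def sig)
    then show ?thesis
    proof (induction rule: sigma_sets_induct_disjoint)
      case (basic A)
      then show ?case
        using zero by (auto simp: set_lebesgue_integral_def primitive_def)
    next
      case empty
      show ?case
        by (simp add: set_lebesgue_integral_def)
    next
      case (compl A)
      then have "A \<in> sets lebesgue"
        by (intro sets_completionI_sets) (simp add: sig)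
      have "set_lebesgue_integral lebesgue (UNIV - A) p = (LINT x|lebesgue. p x - indicator A x *\<^sub>R p x)"
        unfolding set_lebesgue_integral_def by (intro Bochner_Integration.integral_cong) (auto simp: indicator_def)
      also have "\<dots> = 0"
        using int[OF \<open>A \<in> sets lebesgue\<close>] p compl by (simp add: total set_lebesgue_integral_def)
      finally show ?case .
    next
      case (union A)
      have A: "A i \<in> sets lebesgue" for i
        using union(2) by (intro sets_completionI_sets) (auto simp: sig)
      then have "set_integrable lebesgue (\<Union>i. A i) p"
        unfolding set_integrable_def by (intro int) auto
      then have "set_lebesgue_integral lebesgue (\<Union>i. A i) p = (\<Sum>i. set_lebesgue_integral lebesgue (A i) p)"
        using A union by (intro lebesgue_integral_countable_add) (auto simp: disjoint_family_on_def)
      then show ?case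
        using union by simp
    qed
  qed
  fix A assume "A \<in> sets (lebesgue :: real measure)"
  then obtain S N N' where SN: "A = S \<union> N" "N \<subseteq> N'" "N' \<in> null_sets lborel" "S \<in> sets lborel"
    by (rule sets_completionE)
  have "AE x in lborel. x \<notin> N'"
    using SN(3) by (rule AE_not_in)
  then have "AE x in lebesgue. x \<notin> N'"
    by (rule AE_completion)
  then have "AE x in lebesgue. indicator A x *\<^sub>R p x = indicator S x *\<^sub>R p x"
    by eventually_elim (use SN in \<open>auto simp: indicator_def\<close>)
  then have "set_lebesgue_integral lebesgue A p = set_lebesgue_integral lebesgue S p"
    unfolding set_lebesgue_integral_def
    using \<open>A \<in> sets lebesgue\<close> sets_completionI_sets[OF SN(4)]
    by (intro integral_cong_AE borel_measurable_integrable int)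
  then show "set_lebesgue_integral lebesgue A p = 0"
    using borel[of S] SN(4) by simp
qed

section \<open>Test functions and the lemma of du Bois-Reymond\<close>

text \<open>
  The functions \<open>exp (-1/x) / x\<^sup>k\<close>, extended by zero to \<open>x \<le> 0\<close>. The family is closed under
  differentiation up to linear combinations, and \<open>k = 0\<close> gives smooth functions of compact
  support as products \<open>flat_exp 0 (x - a) * flat_exp 0 (b - x)\<close>.
\<close>

definition flat_exp :: "nat \<Rightarrow> real \<Rightarrow> real" where
  "flat_exp k x = (if x \<le> 0 then 0 else exp (- (1 / x)) / x ^ k)"

lemma flat_exp_tendsto_0: "(flat_exp k \<longlongrightarrow> 0) (at 0)"
proof -
  have "((\<lambda>x. inverse x ^ k / exp (inverse x)) \<longlongrightarrow> 0) (at_right (0 :: real))"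
    by (rule filterlim_compose[OF tendsto_power_div_exp_0 filterlim_inverse_at_top_right])
  moreover have "\<forall>\<^sub>F x in at_right (0 :: real). inverse x ^ k / exp (inverse x) = flat_exp k x"
    using eventually_at_right_less[of "0 :: real"]
    by eventually_elim (simp add: flat_exp_def exp_minus field_simps)
  ultimately have right: "(flat_exp k \<longlongrightarrow> 0) (at_right 0)"
    by (rule Lim_transform_eventually)
  have "\<forall>\<^sub>F x in at_left (0 :: real). flat_exp k x = 0"
    by (auto simp: eventually_at_filter flat_exp_def)
  then have "(flat_exp k \<longlongrightarrow> 0) (at_left 0)"
    by (rule tendsto_eventually)
  then show ?thesis
    using right by (simp add: filterlim_split_at)
qed

lemma flat_exp_derivative:
  "(flat_exp k has_real_derivative (flat_exp (k + 2) x - real k * flat_exp (k + 1) x)) (at x)"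
proof -
  consider "x < 0" | "x = 0" | "x > 0" by linarith
  then show ?thesis
  proof cases
    case 1
    have "((\<lambda>_. 0) has_real_derivative 0) (at x)"
      by simp
    then have "(flat_exp k has_real_derivative 0) (at x)"
      by (rule has_field_derivative_transform_within_open[of _ _ _ "{..<0}"]) (use 1 in \<open>auto simp: flat_exp_def\<close>)
    then show ?thesis
      using 1 by (simp add: flat_exp_def)
  next
    case 2
    have "\<forall>\<^sub>F h in at (0 :: real). flat_exp (k + 1) h = (flat_exp k (0 + h) - flat_exp k 0) / h"
      by (auto simp: eventually_at_filter flat_exp_def)
    then have "((\<lambda>h. (flat_exp k (0 + h) - flat_exp k 0) / h) \<longlongrightarrow> 0) (at 0)"
      by (rule Lim_transform_eventually[OF flat_exp_tendsto_0])
    then show ?thesis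
      using 2 by (simp add: DERIV_def flat_exp_def)
  next
    case 3
    have "((\<lambda>x. exp (- (1 / x)) / x ^ k) has_real_derivative
        (exp (- (1 / x)) * (1 / x ^ 2) * x ^ k - exp (- (1 / x)) * (real k * x ^ (k - 1))) / (x ^ k * x ^ k)) (at x)"
      using 3 by (auto intro!: derivative_eq_intros simp: power2_eq_square)
    also have "(exp (- (1 / x)) * (1 / x ^ 2) * x ^ k - exp (- (1 / x)) * (real k * x ^ (k - 1))) / (x ^ k * x ^ k)
        = flat_exp (k + 2) x - real k * flat_exp (k + 1) x"
      using 3 by (cases k) (auto simp: flat_exp_def field_simps power2_eq_square power_add)
    finally have "((\<lambda>x. exp (- (1 / x)) / x ^ k) has_real_derivative flat_exp (k + 2) x - real k * flat_exp (k + 1) x) (at x)" .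
    then show ?thesis
      by (rule has_field_derivative_transform_within_open[of _ _ _ "{0<..}"]) (use 3 in \<open>auto simp: flat_exp_def\<close>)
  qed
qed

text \<open>
  A class of functions that is closed under differentiation and contains the bumps; membership
  therefore implies smoothness.
\<close>

inductive bump_sum :: "(real \<Rightarrow> real) \<Rightarrow> bool" where
  bump_sum_product: "bump_sum (\<lambda>x. c * (flat_exp j (x - a) * flat_exp k (b - x)))"
| bump_sum_add: "bump_sum f \<Longrightarrow> bump_sum g \<Longrightarrow> bump_sum (\<lambda>x. f x + g x)"

lemma bump_sum_derivative:
  "bump_sum f \<Longrightarrow> \<exists>f'. bump_sum f' \<and> (\<forall>x. (f has_real_derivative f' x) (at x))"
proof (induction rule: bump_sum.induct)
  case (bump_sum_product c j a k b)
  let ?f' = "\<lambda>x. (c * (flat_exp (j + 2) (x - a) * flat_exp k (b - x))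
      + (- (c * real j)) * (flat_exp (j + 1) (x - a) * flat_exp k (b - x)))
      + ((- c) * (flat_exp j (x - a) * flat_exp (k + 2) (b - x))
      + (c * real k) * (flat_exp j (x - a) * flat_exp (k + 1) (b - x)))"
  have "bump_sum ?f'"
    by (intro bump_sum.intros)
  moreover have "((\<lambda>x. c * (flat_exp j (x - a) * flat_exp k (b - x))) has_real_derivative ?f' x) (at x)" for x
  proof -
    have 1: "((\<lambda>x. flat_exp j (x - a)) has_real_derivative
        (flat_exp (j + 2) (x - a) - real j * flat_exp (j + 1) (x - a)) * 1) (at x)"
      by (rule DERIV_chain2[OF flat_exp_derivative]) (auto intro!: derivative_eq_intros)
    have 2: "((\<lambda>x. flat_exp k (b - x)) has_real_derivative
        (flat_exp (k + 2) (b - x) - real k * flat_exp (k + 1) (b - x)) * (- 1)) (at x)"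
      by (rule DERIV_chain2[OF flat_exp_derivative]) (auto intro!: derivative_eq_intros)
    show ?thesis
      by (rule DERIV_cong[OF DERIV_cmult[OF DERIV_mult[OF 1 2]]]) (simp add: algebra_simps)
  qed
  ultimately show ?case
    by blast
next
  case (bump_sum_add f g)
  then obtain f' g' where "bump_sum f'" "bump_sum g'"
    "\<And>x. (f has_real_derivative f' x) (at x)" "\<And>x. (g has_real_derivative g' x) (at x)"
    by auto
  then show ?case
    by (intro exI[of _ "\<lambda>x. f' x + g' x"]) (auto intro: bump_sum.intros DERIV_add)
qed

lemma bump_sum_deriv:
  assumes "bump_sum f"
  shows "bump_sum (deriv f)" "f field_differentiable (at x)"
proof -
  obtain f' where f': "bump_sum f'" "\<And>x. (f has_real_derivative f' x) (at x)"
    using bump_sum_derivative[OF assms] by auto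
  have "deriv f = f'"
    using f'(2) by (auto intro: DERIV_imp_deriv)
  then show "bump_sum (deriv f)" "f field_differentiable (at x)"
    using f' by (auto simp: field_differentiable_def)
qed

lemma bump_sum_iterated_deriv: "bump_sum f \<Longrightarrow> bump_sum ((deriv ^^ n) f)"
  by (induction n) (auto intro: bump_sum_deriv)

lemma bump_sum_continuous: "bump_sum f \<Longrightarrow> continuous_on UNIV f"
  by (intro continuous_at_imp_continuous_on ballI field_differentiable_imp_continuous_at bump_sum_deriv)

lemma test_function_if_deriv_bump_sum:
  assumes F: "\<And>x. (F has_real_derivative f x) (at x)" and f: "bump_sum f"
    and supp: "\<And>x. \<bar>x\<bar> > R \<Longrightarrow> F x = 0"
  shows "test_function F"
proof -
  have "deriv F = f"
    using F by (auto intro: DERIV_imp_deriv)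
  have "(deriv ^^ n) F field_differentiable (at x)" for n x
  proof (cases n)
    case 0
    then show ?thesis
      using F by (auto simp: field_differentiable_def)
  next
    case (Suc m)
    then have "(deriv ^^ n) F = (deriv ^^ m) f"
      by (simp only: funpow_Suc_right o_apply \<open>deriv F = f\<close>)
    then show ?thesis
      using bump_sum_deriv(2)[OF bump_sum_iterated_deriv[OF f]] by simp
  qed
  then show ?thesis
    using supp by (auto simp: test_function_def)
qed

lemma integrable_if_compact_support:
  fixes f :: "real \<Rightarrow> 'b :: {banach, second_countable_topology}"
  assumes f: "continuous_on UNIV f" and supp: "\<And>x. x \<notin> {a..b} \<Longrightarrow> f x = 0"
  shows "integrable lebesgue f"
proof -
  have "set_integrable lborel {a..b} f"
    by (rule borel_integrable_atLeastAtMost') (rule continuous_on_subset[OF f], simp)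
  moreover have "(\<lambda>x. indicator {a..b} x *\<^sub>R f x) = f"
    using supp by (auto simp: indicator_def fun_eq_iff)
  ultimately have "integrable lborel f"
    by (simp add: set_integrable_def)
  then show ?thesis
    by (simp add: integrable_completion)
qed

lemma primitive_eq_integral:
  fixes f :: "real \<Rightarrow> real"
  assumes f: "continuous_on UNIV f" and supp: "\<And>x. x < a \<Longrightarrow> f x = 0"
  shows "primitive f x = integral {a..x} f"
proof -
  have "primitive f x = (LINT y|lebesgue. indicator {a..x} y *\<^sub>R f y)"
    unfolding primitive_def using supp
    by (intro Bochner_Integration.integral_cong) (auto simp: indicator_def not_le)
  also have "\<dots> = integral {a..x} f"
    using set_lebesgue_integral_eq_integral(2)[of "{a..x}" f] 
      absolutely_integrable_continuous_real[OF continuous_on_subset[OF f]]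
    by (auto simp: set_lebesgue_integral_def)
  finally show ?thesis .
qed

lemma primitive_derivative:
  fixes f :: "real \<Rightarrow> real"
  assumes f: "continuous_on UNIV f" and supp: "\<And>x. x < a \<Longrightarrow> f x = 0"
  shows "(primitive f has_real_derivative f x) (at x)"
proof -
  define c where "c = min a (x - 1)"
  have c: "c < x" "\<And>y. y < c \<Longrightarrow> f y = 0"
    using supp by (auto simp: c_def)
  have "((\<lambda>x. integral {c..x} f) has_real_derivative f x) (at x within {c..x + 1})"
    using c(1) by (intro integral_has_real_derivative continuous_on_subset[OF f]) auto
  moreover have "at x within {c..x + 1} = at x"
    using c(1) by (intro at_within_interior) simp
  moreover have "(\<lambda>x. integral {c..x} f) = primitive f"
    using primitive_eq_integral[OF f c(2)] by auto
  ultimately show ?thesis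
    by simp
qed

lemma test_function_has_derivative:
  assumes "test_function \<phi>"
  shows "(\<phi> has_real_derivative deriv \<phi> x) (at x)" "continuous_on UNIV (deriv \<phi>)"
proof -
  have d: "(deriv ^^ n) \<phi> field_differentiable (at x)" for n x
    using assms by (auto simp: test_function_def)
  show "(\<phi> has_real_derivative deriv \<phi> x) (at x)"
    using d[of 0] by (simp add: DERIV_deriv_iff_field_differentiable)
  have "deriv \<phi> field_differentiable (at x)" for x
    using d[of 1 x] by simp
  then show "continuous_on UNIV (deriv \<phi>)"
    by (intro continuous_at_imp_continuous_on ballI field_differentiable_imp_continuous_at)
qed

lemma test_function_support:
  assumes \<phi>: "test_function \<phi>"
  obtains R where "0 \<le> R" "\<And>x. R < \<bar>x\<bar> \<Longrightarrow> \<phi> x = 0" "\<And>x. R < \<bar>x\<bar> \<Longrightarrow> deriv \<phi> x = 0"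
proof -
  obtain S where S: "\<And>x. S < \<bar>x\<bar> \<Longrightarrow> \<phi> x = 0"
    using \<phi> by (auto simp: test_function_def)
  define R where "R = \<bar>S\<bar>"
  have R: "\<phi> x = 0" if "R < \<bar>x\<bar>" for x
    using S that by (auto simp: R_def)
  have "deriv \<phi> x = 0" if "R < \<bar>x\<bar>" for x
  proof (rule DERIV_imp_deriv)
    have "((\<lambda>_. 0) has_real_derivative 0) (at x)"
      by simp
    then show "(\<phi> has_real_derivative 0) (at x)"
      by (rule has_field_derivative_transform_within_open[of _ _ _ "{x. R < \<bar>x\<bar>}"])
         (use R that in \<open>auto intro!: open_Collect_less continuous_intros\<close>)
  qed
  then show thesis
    using R by (intro that[of R]) (auto simp: R_def)
qed

lemma test_function_deriv:
  assumes \<phi>: "test_function \<phi>"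
  shows "integrable lebesgue (deriv \<phi>)" "primitive (deriv \<phi>) x = \<phi> x" "integral\<^sup>L lebesgue (deriv \<phi>) = 0"
proof -
  obtain R where R: "\<And>x. R < \<bar>x\<bar> \<Longrightarrow> \<phi> x = 0" and zero: "\<And>x. R < \<bar>x\<bar> \<Longrightarrow> deriv \<phi> x = 0"
    by (rule test_function_support[OF \<phi>]) (rule that)
  show int: "integrable lebesgue (deriv \<phi>)"
    by (rule integrable_if_compact_support[OF test_function_has_derivative(2)[OF \<phi>], of "-R" R])
       (auto intro!: zero)
  show prim: "primitive (deriv \<phi>) x = \<phi> x" for x
  proof -
    define a where "a = min (- \<bar>R\<bar> - 1) (x - 1)"
    have "primitive (deriv \<phi>) x = integral {a..x} (deriv \<phi>)"
      by (intro primitive_eq_integral test_function_has_derivative[OF \<phi>] zero) (auto simp: a_def)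
    also have "\<dots> = \<phi> x - \<phi> a"
    proof (rule integral_unique, rule fundamental_theorem_of_calculus)
      show "a \<le> x"
        by (simp add: a_def)
      show "(\<phi> has_vector_derivative deriv \<phi> t) (at t within {a..x})" for t
        using test_function_has_derivative(1)[OF \<phi>, of t]
        by (simp add: has_real_derivative_iff_has_vector_derivative has_vector_derivative_at_within)
    qed
    also have "\<phi> a = 0"
      by (rule R) (auto simp: a_def)
    finally show ?thesis
      by simp
  qed
  have "((\<lambda>x. \<phi> x) \<longlongrightarrow> integral\<^sup>L lebesgue (deriv \<phi>)) at_top"
    using primitive_tendsto_at_top[OF int] by (simp add: prim[abs_def])
  moreover have "((\<lambda>x. \<phi> x) \<longlongrightarrow> 0) at_top"
    by (rule tendsto_eventually) (use eventually_gt_at_top[of "\<bar>R\<bar>"] in \<open>eventually_elim, auto intro!: R\<close>)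
  ultimately show "integral\<^sup>L lebesgue (deriv \<phi>) = 0"
    using tendsto_unique[OF trivial_limit_at_top_linorder] by blast
qed

lemma primitive_of_real: "primitive (\<lambda>x. complex_of_real (p x)) x = of_real (primitive p x)"
  unfolding primitive_def integral_complex_of_real[symmetric] by (simp add: scaleR_conv_of_real)

text \<open>
  Integration by parts, since \<open>\<phi>\<close> is the primitive of its derivative and that derivative has total
  integral zero.
\<close>

lemma primitive_weak_derivative:
  assumes g: "integrable lebesgue g" and \<phi>: "test_function \<phi>"
  shows "(LINT x|lebesgue. primitive g x * complex_of_real (deriv \<phi> x)) = - (LINT x|lebesgue. g x * complex_of_real (\<phi> x))"
proof -
  have "integrable lebesgue (\<lambda>x. complex_of_real (deriv \<phi> x))"
    using test_function_deriv(1)[OF \<phi>] by simp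
  from primitive_by_parts[OF g this]
  have "(LINT x|lebesgue. primitive g x * complex_of_real (deriv \<phi> x)) + (LINT x|lebesgue. g x * complex_of_real (\<phi> x)) = 0"
    by (simp add: primitive_of_real test_function_deriv[OF \<phi>] integral_complex_of_real)
  then show ?thesis
    by (simp add: eq_neg_iff_add_eq_0)
qed

lemma integrable_mult_test_deriv:
  assumes "continuous_on UNIV u" and \<phi>: "test_function \<phi>"
  shows "integrable lebesgue (\<lambda>x. u x * complex_of_real (deriv \<phi> x))"
proof -
  obtain R where "\<And>x. R < \<bar>x\<bar> \<Longrightarrow> deriv \<phi> x = 0"
    by (rule test_function_support[OF \<phi>]) (rule that)
  then show ?thesis
    by (intro integrable_if_compact_support[of _ "- R" R] continuous_intros assms(1)
        test_function_has_derivative[OF \<phi>]) (auto simp: abs_if)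
qed

definition bump :: "real \<Rightarrow> real \<Rightarrow> real \<Rightarrow> real" where
  "bump \<delta> c x = flat_exp 0 (x - (c - \<delta>)) * flat_exp 0 ((c + \<delta>) - x)"

lemma bump_sign_support:
  assumes "\<delta> > 0"
  shows "0 \<le> bump \<delta> c x" "\<bar>x - c\<bar> < \<delta> \<Longrightarrow> 0 < bump \<delta> c x" "\<bar>x - c\<bar> \<ge> \<delta> \<Longrightarrow> bump \<delta> c x = 0"
  by (auto simp: bump_def flat_exp_def)

lemma bump_sum_bump: "bump_sum (bump \<delta> c)"
  using bump_sum_product[of 1 0 "c - \<delta>" 0 "c + \<delta>"] by (simp add: bump_def[abs_def])

lemma bump_continuous: "continuous_on UNIV (bump \<delta> c)"
  by (rule bump_sum_continuous[OF bump_sum_bump])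

lemma integrable_mult_bump:
  fixes u :: "real \<Rightarrow> complex"
  assumes "continuous_on UNIV u" "\<delta> > 0"
  shows "integrable lebesgue (\<lambda>x. u x * complex_of_real (bump \<delta> c x))"
  by (rule integrable_if_compact_support[of _ "c - \<delta>" "c + \<delta>"])
     (use assms in \<open>auto intro!: continuous_intros bump_continuous bump_sign_support(3)\<close>)

lemma integrable_bump: "\<delta> > 0 \<Longrightarrow> integrable lebesgue (bump \<delta> c)"
  by (rule integrable_if_compact_support[of _ "c - \<delta>" "c + \<delta>", OF bump_continuous])
     (auto intro!: bump_sign_support(3))

lemma integral_bump_shift: "integral\<^sup>L lebesgue (bump \<delta> c) = integral\<^sup>L lebesgue (bump \<delta> 0)"
proof -
  have m: "bump \<delta> c \<in> borel_measurable lborel" for c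
    using borel_measurable_continuous_onI[OF bump_continuous] by simp
  have "integral\<^sup>L lborel (bump \<delta> c) = (LINT x|lborel. bump \<delta> c (c + x))"
    using lborel_integral_real_affine[of 1 "bump \<delta> c" c] by simp
  also have "(\<lambda>x. bump \<delta> c (c + x)) = bump \<delta> 0"
    by (auto simp: bump_def algebra_simps)
  finally show ?thesis
    by (simp only: integral_completion[OF m])
qed

lemma integral_bump_pos:
  assumes "\<delta> > 0"
  shows "0 < integral\<^sup>L lebesgue (bump \<delta> c)"
proof -
  have "integral\<^sup>L lebesgue (bump \<delta> c) \<noteq> 0"
  proof
    assume "integral\<^sup>L lebesgue (bump \<delta> c) = 0"
    then have "AE x in lebesgue. bump \<delta> c x = 0"
      using integrable_bump[OF assms] bump_sign_support(1)[OF assms]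
      by (subst (asm) integral_nonneg_eq_0_iff_AE) auto
    then have "AE x in lebesgue. x \<notin> {c - \<delta><..<c + \<delta>}"
    proof eventually_elim
      case (elim x)
      then show ?case
        using bump_sign_support(2)[OF assms, of x c] by (auto simp: abs_less_iff)
    qed
    then have "{c - \<delta><..<c + \<delta>} \<in> null_sets lebesgue"
      by (subst AE_iff_null_sets) auto
    then have "emeasure lebesgue {c - \<delta><..<c + \<delta>} = 0"
      by auto
    then show False
      using assms by simp
  qed
  moreover have "0 \<le> integral\<^sup>L lebesgue (bump \<delta> c)"
    using bump_sign_support(1)[OF assms] by simp
  ultimately show ?thesis
    by simp
qed

lemma bump_average:
  fixes d :: "real \<Rightarrow> complex"
  assumes d: "continuous_on UNIV d" and \<delta>: "\<delta> > 0" and close: "\<And>x. \<bar>x - c\<bar> < \<delta> \<Longrightarrow> cmod (d x - d c) \<le> \<eta>"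
  shows "cmod ((LINT x|lebesgue. d x * of_real (bump \<delta> c x)) - d c * of_real (integral\<^sup>L lebesgue (bump \<delta> 0)))
    \<le> \<eta> * integral\<^sup>L lebesgue (bump \<delta> 0)"
proof -
  note ints = integrable_mult_bump[OF d \<delta>, of c] integrable_bump[OF \<delta>, of c]
  have "(LINT x|lebesgue. d x * of_real (bump \<delta> c x)) - d c * of_real (integral\<^sup>L lebesgue (bump \<delta> 0))
      = (LINT x|lebesgue. d x * of_real (bump \<delta> c x)) - (LINT x|lebesgue. d c * of_real (bump \<delta> c x))"
    by (simp add: integral_complex_of_real integral_bump_shift[of \<delta> c])
  also have "\<dots> = (LINT x|lebesgue. (d x - d c) * of_real (bump \<delta> c x))"
    using ints by (simp add: left_diff_distrib)
  also have "cmod \<dots> \<le> (LINT x|lebesgue. cmod ((d x - d c) * of_real (bump \<delta> c x)))"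
    by (rule integral_norm_bound)
  also have "\<dots> \<le> (LINT x|lebesgue. \<eta> * bump \<delta> c x)"
  proof (rule integral_mono)
    show "integrable lebesgue (\<lambda>x. cmod ((d x - d c) * of_real (bump \<delta> c x)))"
      using ints by (intro integrable_norm) (simp add: left_diff_distrib)
    show "integrable lebesgue (\<lambda>x. \<eta> * bump \<delta> c x)"
      using ints by simp
    show "cmod ((d x - d c) * of_real (bump \<delta> c x)) \<le> \<eta> * bump \<delta> c x" for x
    proof (cases "\<bar>x - c\<bar> < \<delta>")
      case True
      then show ?thesis
        using close bump_sign_support(1)[OF \<delta>, of c x] by (simp add: norm_mult mult_right_mono)
    next
      case False
      then show ?thesis
        using bump_sign_support(3)[OF \<delta>, of x c] by simp
    qed
  qed
  finally show ?thesis
    by (simp add: integral_bump_shift[of \<delta> c])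
qed

text \<open>
  The primitive of a bump at \<open>a\<close> minus a bump at \<open>b\<close> is a test function. As the bumps
  shrink, the hypothesis for it compares averages of \<open>d\<close> near \<open>a\<close> and near \<open>b\<close>, which tend to \<open>d a\<close>
  and \<open>d b\<close>.
\<close>

lemma du_Bois_Reymond:
  fixes d :: "real \<Rightarrow> complex"
  assumes d: "continuous_on UNIV d"
    and weak: "\<And>\<phi>. test_function \<phi> \<Longrightarrow> (LINT x|lebesgue. d x * complex_of_real (deriv \<phi> x)) = 0"
  shows "d a = d b"
proof -
  have "cmod (d a - d b) \<le> \<eta>" if "\<eta> > 0" for \<eta>
  proof -
    have "\<eta> / 2 > 0"
      using that by simp
    have "\<exists>\<delta>>0. \<forall>x. \<bar>x - c\<bar> < \<delta> \<longrightarrow> cmod (d x - d c) \<le> \<eta> / 2" for c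
    proof -
      have "isCont d c"
        using d by (simp add: continuous_on_eq_continuous_at)
      then obtain \<delta> where "\<delta> > 0" "\<forall>x. dist x c < \<delta> \<longrightarrow> dist (d x) (d c) < \<eta> / 2"
        using \<open>\<eta> / 2 > 0\<close> unfolding continuous_at_eps_delta by meson
      then show ?thesis
        by (intro exI[of _ \<delta>]) (auto simp: dist_norm intro: less_imp_le)
    qed
    then obtain \<delta>a \<delta>b where "\<delta>a > 0" "\<forall>x. \<bar>x - a\<bar> < \<delta>a \<longrightarrow> cmod (d x - d a) \<le> \<eta> / 2"
      "\<delta>b > 0" "\<forall>x. \<bar>x - b\<bar> < \<delta>b \<longrightarrow> cmod (d x - d b) \<le> \<eta> / 2"
      by meson
    then obtain \<delta> where \<delta>: "\<delta> > 0" "\<And>x. \<bar>x - a\<bar> < \<delta> \<Longrightarrow> cmod (d x - d a) \<le> \<eta> / 2"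
      "\<And>x. \<bar>x - b\<bar> < \<delta> \<Longrightarrow> cmod (d x - d b) \<le> \<eta> / 2"
      by (metis min_less_iff_conj)
    define \<kappa> where "\<kappa> = integral\<^sup>L lebesgue (bump \<delta> 0)"
    have "\<kappa> > 0"
      unfolding \<kappa>_def by (rule integral_bump_pos[OF \<delta>(1)])
    define f where "f x = bump \<delta> a x + (- bump \<delta> b x)" for x
    have f_sum: "bump_sum f"
    proof -
      have "bump_sum (\<lambda>x. - bump \<delta> b x)"
        using bump_sum_product[of "-1" 0 "b - \<delta>" 0 "b + \<delta>"] by (simp add: bump_def)
      then show ?thesis
        unfolding f_def[abs_def] by (intro bump_sum_add bump_sum_bump)
    qed
    define R where "R = \<bar>a\<bar> + \<bar>b\<bar> + \<delta>"
    have f_supp: "f x = 0" if "\<bar>x\<bar> > R" for x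
      using that bump_sign_support(3)[OF \<delta>(1), of x a] bump_sign_support(3)[OF \<delta>(1), of x b] by (simp add: f_def R_def)
    have f_int: "integral\<^sup>L lebesgue f = 0"
      unfolding f_def using integrable_bump[OF \<delta>(1)] integral_bump_shift[of \<delta> a] integral_bump_shift[of \<delta> b]
      by simp
    have deriv: "(primitive f has_real_derivative f x) (at x)" for x
      by (rule primitive_derivative[OF bump_sum_continuous[OF f_sum], of "-R"]) (auto intro!: f_supp)
    have "test_function (primitive f)"
    proof (rule test_function_if_deriv_bump_sum[OF deriv f_sum, of R])
      fix x assume x: "\<bar>x\<bar> > R"
      show "primitive f x = 0"
      proof (cases "x > 0")
        case True
        then have "(\<lambda>y. indicator {..x} y *\<^sub>R f y) = f"
          using x by (auto simp: indicator_def fun_eq_iff intro!: f_supp)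
        then show ?thesis
          using f_int by (simp add: primitive_def)
      next
        case False
        then have "(\<lambda>y. indicator {..x} y *\<^sub>R f y) = (\<lambda>_. 0)"
          using x by (auto simp: indicator_def fun_eq_iff intro!: f_supp)
        then show ?thesis
          by (simp add: primitive_def)
      qed
    qed
    moreover have "deriv (primitive f) = f"
      using deriv by (auto intro: DERIV_imp_deriv)
    ultimately have "(LINT x|lebesgue. d x * complex_of_real (f x)) = 0"
      using weak[of "primitive f"] by simp
    then have eq: "(LINT x|lebesgue. d x * of_real (bump \<delta> a x)) = (LINT x|lebesgue. d x * of_real (bump \<delta> b x))"
      using integrable_mult_bump[OF d \<delta>(1)] by (simp add: f_def ring_distribs)
    have "cmod (d a - d b) * \<kappa> = cmod (d a * of_real \<kappa> - d b * of_real \<kappa>)"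
      using \<open>\<kappa> > 0\<close> by (simp add: left_diff_distrib[symmetric] norm_mult)
    also have "\<dots> \<le> \<eta> / 2 * \<kappa> + \<eta> / 2 * \<kappa>"
    proof -
      let ?I = "LINT x|lebesgue. d x * of_real (bump \<delta> a x)"
      have "d a * of_real \<kappa> - d b * of_real \<kappa> = (?I - d b * of_real \<kappa>) - (?I - d a * of_real \<kappa>)"
        by simp
      then have "cmod (d a * of_real \<kappa> - d b * of_real \<kappa>) \<le> cmod (?I - d b * of_real \<kappa>) + cmod (?I - d a * of_real \<kappa>)"
        by (metis norm_triangle_ineq4)
      moreover have "cmod (?I - d a * of_real \<kappa>) \<le> \<eta> / 2 * \<kappa>"
        unfolding \<kappa>_def by (rule bump_average[OF d \<delta>(1,2)])
      moreover have "cmod (?I - d b * of_real \<kappa>) \<le> \<eta> / 2 * \<kappa>"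
        unfolding eq \<kappa>_def by (rule bump_average[OF d \<delta>(1,3)])
      ultimately show ?thesis
        by linarith
    qed
    also have "\<dots> = \<eta> * \<kappa>"
      by simp
    finally show ?thesis
      using \<open>\<kappa> > 0\<close> by simp
  qed
  then have "cmod (d a - d b) \<le> 0"
    by (rule field_le_epsilon) simp
  then show ?thesis
    by simp
qed

lemma weak_derivative_integrable_imp_primitive:
  assumes weak: "has_weak_derivative f g" and g: "integrable lebesgue g"
    and f_meas: "f \<in> borel_measurable lebesgue"
    and u: "continuous_on UNIV u" "AE x in lebesgue. u x = f x"
  obtains c where "\<And>x. u x = c + primitive g x"
proof -
  let ?d = "\<lambda>x. u x - primitive g x"
  have "?d x = ?d 0" for x
  proof (rule du_Bois_Reymond)
    show "continuous_on UNIV ?d"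
      using u(1) continuous_on_primitive[OF g] by (intro continuous_intros)
    fix \<phi> assume \<phi>: "test_function \<phi>"
    have "(LINT x|lebesgue. ?d x * complex_of_real (deriv \<phi> x))
      = (LINT x|lebesgue. u x * complex_of_real (deriv \<phi> x)) - (LINT x|lebesgue. primitive g x * complex_of_real (deriv \<phi> x))"
      using integrable_mult_test_deriv[OF u(1) \<phi>] integrable_mult_test_deriv[OF continuous_on_primitive[OF g] \<phi>]
      by (simp add: left_diff_distrib)
    also have "(LINT x|lebesgue. u x * complex_of_real (deriv \<phi> x)) = (LINT x|lebesgue. f x * complex_of_real (deriv \<phi> x))"
    proof (rule integral_cong_AE)
      show "AE x in lebesgue. u x * complex_of_real (deriv \<phi> x) = f x * complex_of_real (deriv \<phi> x)"
        using u(2) by eventually_elim simp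
      show "(\<lambda>x. u x * complex_of_real (deriv \<phi> x)) \<in> borel_measurable lebesgue"
        using integrable_mult_test_deriv[OF u(1) \<phi>] by auto
      have "(\<lambda>x. complex_of_real (deriv \<phi> x)) \<in> borel_measurable lebesgue"
        using test_function_deriv(1)[OF \<phi>] by auto
      then show "(\<lambda>x. f x * complex_of_real (deriv \<phi> x)) \<in> borel_measurable lebesgue"
        using f_meas by (intro borel_measurable_times)
    qed
    also have "\<dots> = - (LINT x|lebesgue. g x * complex_of_real (\<phi> x))"
      using weak \<phi> by (simp add: has_weak_derivative_def)
    finally show "(LINT x|lebesgue. ?d x * complex_of_real (deriv \<phi> x)) = 0"
      by (simp add: primitive_weak_derivative[OF g \<phi>])
  qed
  then show thesis
    by (intro that[of "?d 0"]) (simp add: algebra_simps)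
qed

lemma primitive_has_weak_derivative:
  assumes g: "integrable lebesgue g" and f: "f \<in> borel_measurable lebesgue" 
    and ae: "AE x in lebesgue. c + primitive g x = f x"
  shows "has_weak_derivative f g"
  unfolding has_weak_derivative_def
proof (intro conjI allI impI)
  let ?u = "\<lambda>x. c + primitive g x"
  have u: "continuous_on UNIV ?u"
    using continuous_on_primitive[OF g] by (intro continuous_intros)
  show "locally_integrable g"
    unfolding locally_integrable_def set_integrable_def using g by (intro allI integrable_mult_indicator) auto
  show "locally_integrable f"
    unfolding locally_integrable_def
  proof (intro allI)
    fix a b :: real
    have "?u absolutely_integrable_on {a..b}"
      by (rule absolutely_integrable_continuous_real[OF continuous_on_subset[OF u]]) simp
    then show "f absolutely_integrable_on {a..b}"
      unfolding set_integrable_def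
    proof (rule integrable_cong_AE_imp)
      show "AE x in lebesgue. indicat_real {a..b} x *\<^sub>R ?u x = indicat_real {a..b} x *\<^sub>R f x"
        using ae by eventually_elim simp
      show "(\<lambda>x. indicat_real {a..b} x *\<^sub>R f x) \<in> borel_measurable lebesgue"
        by (intro borel_measurable_scaleR borel_measurable_indicator f) simp
    qed
  qed
  fix \<phi> assume \<phi>: "test_function \<phi>"
  have m: "(\<lambda>x. complex_of_real (deriv \<phi> x)) \<in> borel_measurable lebesgue"
    using test_function_deriv(1)[OF \<phi>] by auto
  have "(LINT x|lebesgue. f x * complex_of_real (deriv \<phi> x)) = (LINT x|lebesgue. ?u x * complex_of_real (deriv \<phi> x))"
  proof (rule integral_cong_AE)
    show "AE x in lebesgue. f x * complex_of_real (deriv \<phi> x) = ?u x * complex_of_real (deriv \<phi> x)"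
      using ae by eventually_elim simp
    show "(\<lambda>x. ?u x * complex_of_real (deriv \<phi> x)) \<in> borel_measurable lebesgue"
      using integrable_mult_test_deriv[OF u \<phi>] by auto
  qed (use f m in auto)
  also have "\<dots> = c * (LINT x|lebesgue. complex_of_real (deriv \<phi> x)) + (LINT x|lebesgue. primitive g x * complex_of_real (deriv \<phi> x))"
    using integrable_mult_test_deriv[OF continuous_on_primitive[OF g] \<phi>] test_function_deriv(1)[OF \<phi>]
    by (simp add: distrib_right)
  also have "\<dots> = - (LINT x|lebesgue. g x * complex_of_real (\<phi> x))"
    by (simp add: integral_complex_of_real test_function_deriv(3)[OF \<phi>] primitive_weak_derivative[OF g \<phi>])
  finally show "(LINT x|lebesgue. f x * complex_of_real (deriv \<phi> x)) = - (LINT x|lebesgue. g x * complex_of_real (\<phi> x))" .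
qed

section \<open>The exponential basis of a weighted space\<close>

text \<open>
  Polynomials in \<open>z\<close> and its conjugate; on the unit circle these are the trigonometric polynomials.
\<close>

inductive trig_poly :: "(complex \<Rightarrow> complex) \<Rightarrow> bool" where
  monomial: "trig_poly (\<lambda>z. c * z ^ m * cnj z ^ k)"
| add: "trig_poly f \<Longrightarrow> trig_poly g \<Longrightarrow> trig_poly (\<lambda>z. f z + g z)"

lemma trig_poly_mult:
  assumes "trig_poly f" "trig_poly g"
  shows "trig_poly (\<lambda>z. f z * g z)"
  using assms(1)
proof (induction rule: trig_poly.induct)
  case (monomial c m k)
  show ?case
    using assms(2)
  proof (induction rule: trig_poly.induct)
    case (monomial c' m' k')
    show ?case
      using trig_poly.monomial[of "c * c'" "m + m'" "k + k'"] by (simp add: power_add mult_ac)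
  next
    case (add g h)
    then show ?case
      using trig_poly.add by (simp add: distrib_left)
  qed
next
  case (add f h)
  then show ?case
    using trig_poly.add by (simp add: distrib_right)
qed

text \<open>
  Real linear functionals on the complex plane are combinations of \<open>z\<close> and its conjugate.
\<close>

lemma trig_poly_real_polynomial:
  "real_polynomial_function p \<Longrightarrow> trig_poly (\<lambda>z. complex_of_real (p z))"
proof (induction rule: real_polynomial_function.induct)
  case (linear p)
  define A B where "A = (of_real (p 1) - \<i> * of_real (p \<i>)) / 2"
    and "B = (of_real (p 1) + \<i> * of_real (p \<i>)) / 2"
  have eq: "complex_of_real (p z) = A * z ^ 1 * cnj z ^ 0 + B * z ^ 0 * cnj z ^ 1" for z
  proof -
    have "z = Re z *\<^sub>R 1 + Im z *\<^sub>R \<i>"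
      by (simp add: complex_eq_iff)
    then have "p z = p (Re z *\<^sub>R 1 + Im z *\<^sub>R \<i>)"
      by simp
    also have "\<dots> = Re z * p 1 + Im z * p \<i>"
      using linear by (simp add: linear_simps)
    finally show ?thesis
      by (simp add: A_def B_def complex_eq_iff field_simps)
  qed
  show ?case
    unfolding eq by (intro trig_poly.intros)
next
  case (const c)
  show ?case
    using trig_poly.monomial[of "of_real c" 0 0] by simp
next
  case (add p q)
  then show ?case
    using trig_poly.add by simp
next
  case (mult p q)
  then show ?case
    using trig_poly_mult by simp
qed

locale weight =
  fixes w :: "real \<Rightarrow> real"
  assumes w_pos: "AE x in lebesgue. 0 < w x"
    and w_int: "integrable lebesgue w"
begin

abbreviation M :: "real measure" where "M \<equiv> weighted_measure w"

definition W :: "real \<Rightarrow> real" where "W = primitive w"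

definition L :: real where "L = integral\<^sup>L lebesgue w"

lemma w_meas: "w \<in> borel_measurable lebesgue"
  using w_int by auto

lemma w_nonneg: "AE x in lebesgue. 0 \<le> w x"
  using w_pos by eventually_elim simp

lemma sets_M: "sets M = sets lebesgue"
  by (simp add: weighted_measure_def)

lemma space_M: "space M = UNIV"
  by (simp add: weighted_measure_def)

lemma measurable_M: "borel_measurable M = borel_measurable lebesgue"
  by (rule measurable_cong_sets[OF sets_M refl])

lemma integral_M:
  fixes f :: "real \<Rightarrow> 'b :: {banach, second_countable_topology}"
  assumes "f \<in> borel_measurable lebesgue"
  shows "integral\<^sup>L M f = (LINT x|lebesgue. w x *\<^sub>R f x)"
  unfolding weighted_measure_def using w_meas w_nonneg assms by (intro integral_density) auto

lemma integrable_M: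
  fixes f :: "real \<Rightarrow> 'b :: {banach, second_countable_topology}"
  assumes "f \<in> borel_measurable lebesgue"
  shows "integrable M f \<longleftrightarrow> integrable lebesgue (\<lambda>x. w x *\<^sub>R f x)"
  unfolding weighted_measure_def using w_meas w_nonneg assms by (intro integrable_density) auto

lemma AE_M: "(AE x in M. P x) \<longleftrightarrow> (AE x in lebesgue. P x)"
proof -
  have "(AE x in M. P x) \<longleftrightarrow> (AE x in lebesgue. 0 < ennreal (w x) \<longrightarrow> P x)"
    unfolding weighted_measure_def using w_meas by (intro AE_density) auto
  also have "\<dots> \<longleftrightarrow> (AE x in lebesgue. P x)"
  proof
    assume "AE x in lebesgue. 0 < ennreal (w x) \<longrightarrow> P x"
    then show "AE x in lebesgue. P x"
      using w_pos by eventually_elim simp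
  next
    assume "AE x in lebesgue. P x"
    then show "AE x in lebesgue. 0 < ennreal (w x) \<longrightarrow> P x"
      by eventually_elim simp
  qed
  finally show ?thesis .
qed

lemma emeasure_M:
  assumes "A \<in> sets lebesgue"
  shows "emeasure M A = ennreal (LINT x|lebesgue. indicator A x *\<^sub>R w x)"
proof -
  have "emeasure M A = (\<integral>\<^sup>+x. ennreal (w x) * indicator A x \<partial>lebesgue)"
    unfolding weighted_measure_def using w_meas assms by (intro emeasure_density) auto
  also have "\<dots> = (\<integral>\<^sup>+x. ennreal (indicator A x *\<^sub>R w x) \<partial>lebesgue)"
    by (intro nn_integral_cong) (auto simp: indicator_def)
  also have "\<dots> = ennreal (LINT x|lebesgue. indicator A x *\<^sub>R w x)"
    using w_nonneg by (intro nn_integral_eq_integral integrable_mult_indicator assms w_int)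
      (auto elim!: eventually_mono simp: indicator_def)
  finally show ?thesis .
qed

lemma finite_M: "finite_measure M"
  by (rule finite_measureI) (simp add: emeasure_M space_M)

lemma W_diff: "a \<le> b \<Longrightarrow> W b - W a = (LINT x|lebesgue. indicator {a..b} x *\<^sub>R w x)"
  unfolding W_def by (rule primitive_diff[OF w_int])

lemma continuous_W: "continuous_on UNIV W"
  unfolding W_def by (rule continuous_on_primitive[OF w_int])

lemma W_measurable [measurable]: "W \<in> borel_measurable borel"
  by (rule borel_measurable_continuous_onI[OF continuous_W])

lemma W_strict_mono: "strict_mono W"
proof (rule strict_monoI)
  fix a b :: real assume "a < b"
  have int: "integrable lebesgue (\<lambda>x. indicator {a..b} x *\<^sub>R w x)"
    by (intro integrable_mult_indicator w_int) simp
  have nn: "AE x in lebesgue. 0 \<le> indicator {a..b} x *\<^sub>R w x"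
    using w_nonneg by eventually_elim (auto simp: indicator_def)
  have "(LINT x|lebesgue. indicator {a..b} x *\<^sub>R w x) \<noteq> 0"
  proof
    assume "(LINT x|lebesgue. indicator {a..b} x *\<^sub>R w x) = 0"
    then have "AE x in lebesgue. indicator {a..b} x *\<^sub>R w x = 0"
      using int nn by (subst (asm) integral_nonneg_eq_0_iff_AE) auto
    then have "AE x in lebesgue. x \<notin> {a..b}"
      using w_pos by eventually_elim (auto simp: indicator_def split: if_splits)
    then have "{a..b} \<in> null_sets lebesgue"
      by (subst AE_iff_null_sets) auto
    then have "emeasure lebesgue {a..b} = 0"
      by auto
    then show False
      using \<open>a < b\<close> by simp
  qed
  moreover have "0 \<le> (LINT x|lebesgue. indicator {a..b} x *\<^sub>R w x)"
    using nn by (rule integral_nonneg_AE)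
  ultimately show "W a < W b"
    using W_diff[of a b] \<open>a < b\<close> by simp
qed

lemma W_less: "W a < W b \<longleftrightarrow> a < b"
  using W_strict_mono by (simp add: strict_mono_less)

lemma W_le: "W a \<le> W b \<longleftrightarrow> a \<le> b"
  using W_strict_mono by (simp add: strict_mono_less_eq)

lemma W_at_top: "(W \<longlongrightarrow> L) at_top"
  unfolding W_def L_def by (rule primitive_tendsto_at_top[OF w_int])

lemma W_at_bot: "(W \<longlongrightarrow> 0) at_bot"
  unfolding W_def by (rule primitive_tendsto_at_bot[OF w_int])

lemma W_pos: "0 < W x"
proof -
  have "0 \<le> W (x - 1)"
    by (rule tendsto_upperbound[OF W_at_bot])
       (use eventually_le_at_bot[of "x - 1"] in \<open>auto elim!: eventually_mono simp: W_le\<close>)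
  also have "\<dots> < W x"
    by (simp add: W_less)
  finally show ?thesis .
qed

lemma W_less_L: "W x < L"
proof -
  have "W x < W (x + 1)"
    by (simp add: W_less)
  also have "\<dots> \<le> L"
    by (rule tendsto_lowerbound[OF W_at_top])
       (use eventually_ge_at_top[of "x + 1"] in \<open>auto elim!: eventually_mono simp: W_le\<close>)
  finally show ?thesis .
qed

lemma L_pos: "0 < L"
  using W_pos[of 0] W_less_L[of 0] by linarith

lemma W_surj:
  assumes "0 < s" "s < L"
  obtains x where "W x = s"
proof -
  obtain a where a: "W a < s"
    using order_tendstoD(2)[OF W_at_bot assms(1)] eventually_happens'[OF trivial_limit_at_bot_linorder] by blast
  obtain b where b: "s < W b"
    using order_tendstoD(1)[OF W_at_top assms(2)] eventually_happens'[OF trivial_limit_at_top_linorder] by blast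
  have "a \<le> b"
    using a b W_less[of a b] by linarith
  then show thesis
    using IVT'[of W a s b] a b continuous_on_subset[OF continuous_W] that by force
qed

text \<open>
  This is the substitution \<open>s = W x\<close>: the measure \<open>w dx\<close> is transported to Lebesgue measure on
  \<open>[0, L]\<close>, since both give the same mass to every half-line.
\<close>

lemma distr_W: "distr M borel W = density lborel (indicator {0..L})"
proof (rule measure_eqI_lessThan)
  have W_M: "W \<in> M \<rightarrow>\<^sub>M borel"
    unfolding measurable_M by (rule lebesgue_measurable_if_borel[OF W_measurable])
  have emeasure_L: "emeasure (distr M borel W) {s<..} = emeasure M {x. s < W x}" for s
    using W_M by (simp add: emeasure_distr space_M vimage_def)
  show "emeasure (distr M borel W) {s<..} < \<infinity>" for s
    using finite_measure.emeasure_finite[OF finite_M] by (simp add: emeasure_L less_top)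
  show "emeasure (distr M borel W) {s<..} = emeasure (density lborel (indicator {0..L})) {s<..}" for s
  proof -
    have R: "emeasure (density lborel (indicator {0..L})) {s<..} = emeasure lborel ({0..L} \<inter> {s<..})"
      by (simp add: emeasure_density nn_integral_indicator indicator_inter_arith[symmetric])
    consider "s \<le> 0" | "0 < s" "s < L" | "L \<le> s" by linarith
    then have "emeasure M {x. s < W x} = emeasure lborel ({0..L} \<inter> {s<..})"
    proof cases
      case 1
      then have "{x. s < W x} = UNIV"
        using W_pos by (auto intro: le_less_trans)
      then have "emeasure M {x. s < W x} = ennreal L"
        by (simp add: emeasure_M L_def)
      also have "\<dots> = emeasure lborel ({0..L} \<inter> {s<..})"
      proof (cases "s = 0")
        case True
        then have "{0..L} \<inter> {s<..} = {0<..L}" by auto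
        then show ?thesis using L_pos by simp
      next
        case False
        then have "{0..L} \<inter> {s<..} = {0..L}" using 1 by auto
        then show ?thesis using L_pos by simp
      qed
      finally show ?thesis .
    next
      case 2
      then obtain a where a: "W a = s"
        by (rule W_surj)
      then have "{x. s < W x} = {a<..}"
        by (auto simp: W_less)
      then have "emeasure M {x. s < W x} = ennreal (LINT x|lebesgue. indicator {a<..} x *\<^sub>R w x)"
        by (simp add: emeasure_M)
      also have "(LINT x|lebesgue. indicator {a<..} x *\<^sub>R w x) = (LINT x|lebesgue. w x - indicator {..a} x *\<^sub>R w x)"
        by (intro Bochner_Integration.integral_cong) (auto simp: indicator_def)
      also have "\<dots> = L - s"
        using w_int primitive_integrable[OF w_int, of a] a by (simp add: L_def W_def primitive_def)
      also have "{0..L} \<inter> {s<..} = {s<..L}"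
        using 2 by auto
      then have "ennreal (L - s) = emeasure lborel ({0..L} \<inter> {s<..})"
        using 2 by simp
      finally show ?thesis .
    next
      case 3
      then have "{x. s < W x} = {}" "{0..L} \<inter> {s<..} = {}"
        using W_less_L by (auto simp: not_less intro: less_imp_le order.trans)
      then show ?thesis
        by simp
    qed
    then show ?thesis
      by (simp add: emeasure_L R)
  qed
qed simp_all

lemma integral_W:
  fixes \<phi> :: "real \<Rightarrow> complex"
  assumes "\<phi> \<in> borel_measurable borel"
  shows "(LINT x|M. \<phi> (W x)) = (LINT s|lborel. indicator {0..L} s *\<^sub>R \<phi> s)"
proof -
  have W_M: "W \<in> M \<rightarrow>\<^sub>M borel"
    unfolding measurable_M by (rule lebesgue_measurable_if_borel[OF W_measurable])
  have "(LINT x|M. \<phi> (W x)) = integral\<^sup>L (density lborel (indicator {0..L})) \<phi>"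
    using integral_distr[OF W_M assms] by (simp add: distr_W)
  also have "\<dots> = integral\<^sup>L (density lborel (\<lambda>s. ennreal (indicator {0..L} s))) \<phi>"
    by (simp add: ennreal_indicator)
  also have "\<dots> = (LINT s|lborel. indicator {0..L} s *\<^sub>R \<phi> s)"
    using assms by (intro integral_density) auto
  finally show ?thesis .
qed

definition wave :: "real \<Rightarrow> real \<Rightarrow> complex" where
  "wave r x = exp (\<i> * of_real (r * W x))"

lemma wave_measurable: "wave r \<in> borel_measurable borel"
  unfolding wave_def[abs_def]
  by (intro borel_measurable_continuous_onI continuous_intros continuous_W)

lemma wave_measurable_lebesgue: "wave r \<in> borel_measurable lebesgue"
  by (rule lebesgue_measurable_if_borel[OF wave_measurable])

lemma cmod_wave [simp]: "cmod (wave r x) = 1"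
  by (simp add: wave_def)

lemma wave_mult: "wave r x * wave s x = wave (r + s) x"
  by (simp add: wave_def exp_add[symmetric] algebra_simps)

lemma cnj_wave: "cnj (wave r x) = wave (- r) x"
  by (simp add: wave_def exp_cnj)

lemma wave_0: "wave 0 x = 1"
  by (simp add: wave_def)

lemma wave_at_top: "(wave r \<longlongrightarrow> exp (\<i> * of_real (r * L))) at_top"
  unfolding wave_def[abs_def] by (intro tendsto_intros W_at_top)

lemma integral_phase:
  assumes "0 \<le> a"
  shows "(LINT s|lborel. indicator {0..a} s *\<^sub>R (\<i> * of_real r * exp (\<i> * of_real (r * s)))) = exp (\<i> * of_real (r * a)) - 1"
proof -
  have "(LINT s|lborel. indicator {0..a} s *\<^sub>R (\<i> * of_real r * exp (\<i> * of_real (r * s))))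
      = exp (\<i> * of_real (r * a)) - exp (\<i> * of_real (r * 0))"
  proof (rule integral_FTC_atLeastAtMost[OF assms])
    fix s :: real
    have "((\<lambda>z. exp (\<i> * (of_real r * z))) has_field_derivative \<i> * of_real r * exp (\<i> * (of_real r * of_real s))) (at (of_real s))"
      by (auto intro!: derivative_eq_intros)
    then have "((\<lambda>s. exp (\<i> * (of_real r * of_real s))) has_vector_derivative \<i> * of_real r * exp (\<i> * (of_real r * of_real s))) (at s within {0..a})"
      by (rule has_vector_derivative_real_field)
    then show "((\<lambda>s. exp (\<i> * of_real (r * s))) has_vector_derivative \<i> * of_real r * exp (\<i> * of_real (r * s))) (at s within {0..a})"
      by simp
  qed (intro continuous_intros)
  then show ?thesis
    by simp
qed

text \<open>
  The chain rule for \<open>exp (\<i> r W)\<close>, where \<open>W\<close> need not be differentiable. After the substitution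
  it is the fundamental theorem of calculus for \<open>exp (\<i> r s)\<close>.
\<close>

lemma wave_primitive:
  "integrable lebesgue (\<lambda>y. of_real (w y) * (\<i> * of_real r * wave r y))"
  "primitive (\<lambda>y. of_real (w y) * (\<i> * of_real r * wave r y)) x = wave r x - 1"
proof -
  show int: "integrable lebesgue (\<lambda>y. of_real (w y) * (\<i> * of_real r * wave r y))"
    using w_int wave_measurable_lebesgue
    by (intro integrable_bounded_mult(2)[where C = "\<bar>r\<bar>"]) (auto simp: norm_mult)
  have meas: "(\<lambda>y. indicator {..W x} (W y) *\<^sub>R (\<i> * of_real r * wave r y)) \<in> borel_measurable lebesgue"
    using wave_measurable by (intro lebesgue_measurable_if_borel) measurable
  have "primitive (\<lambda>y. of_real (w y) * (\<i> * of_real r * wave r y)) x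
      = (LINT y|lebesgue. w y *\<^sub>R (indicator {..W x} (W y) *\<^sub>R (\<i> * of_real r * wave r y)))"
    unfolding primitive_def
    by (intro Bochner_Integration.integral_cong) (auto simp: indicator_def W_le scaleR_conv_of_real)
  also have "\<dots> = (LINT y|M. indicator {..W x} (W y) *\<^sub>R (\<i> * of_real r * wave r y))"
    by (rule integral_M[OF meas, symmetric])
  also have "\<dots> = (LINT s|lborel. indicator {0..L} s *\<^sub>R (indicator {..W x} s *\<^sub>R (\<i> * of_real r * exp (\<i> * of_real (r * s)))))"
    unfolding wave_def by (intro integral_W) measurable
  also have "\<dots> = (LINT s|lborel. indicator {0..W x} s *\<^sub>R (\<i> * of_real r * exp (\<i> * of_real (r * s))))"
    using W_less_L[of x] by (intro Bochner_Integration.integral_cong) (auto simp: indicator_def)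
  also have "\<dots> = wave r x - 1"
    unfolding wave_def by (intro integral_phase less_imp_le W_pos)
  finally show "primitive (\<lambda>y. of_real (w y) * (\<i> * of_real r * wave r y)) x = wave r x - 1" .
qed

lemma integral_wave:
  "(LINT x|M. wave (2 * pi * of_int k / L) x) = (if k = 0 then of_real L else 0)"
proof (cases "k = 0")
  case True
  have "(LINT x|M. wave 0 x) = of_real (measure M (space M))"
    by (simp add: wave_0 scaleR_conv_of_real)
  also have "measure M (space M) = L"
    using L_pos by (simp add: measure_def emeasure_M space_M L_def)
  finally show ?thesis
    using True by simp
next
  case False
  define r where "r = 2 * pi * of_int k / L"
  have "r \<noteq> 0"
    using False L_pos by (simp add: r_def)
  have "(LINT x|M. \<i> * of_real r * wave r x) = (LINT s|lborel. indicator {0..L} s *\<^sub>R (\<i> * of_real r * exp (\<i> * of_real (r * s))))"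
    unfolding wave_def by (intro integral_W) measurable
  also have "\<dots> = exp (\<i> * of_real (r * L)) - 1"
    using L_pos by (intro integral_phase) simp
  also have "\<i> * of_real (r * L) = of_int (2 * k) * (of_real pi * \<i>)"
    using L_pos by (simp add: r_def)
  also have "exp \<dots> = 1"
    by (simp add: exp_eq_1)
  finally have "\<i> * of_real r * (LINT x|M. wave r x) = 0"
    by simp
  then show ?thesis
    using \<open>r \<noteq> 0\<close> False by (simp add: r_def)
qed

text \<open>
  The values \<open>r\<close> for which \<open>exp (\<i> r W)\<close> gains the factor \<open>exp (\<i> \<theta>)\<close> from \<open>-\<infinity>\<close> to \<open>\<infinity>\<close>.
\<close>

definition freq :: "real \<Rightarrow> int \<Rightarrow> real" where
  "freq \<theta> n = (\<theta> + 2 * pi * of_int n) / L"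

definition basis :: "real \<Rightarrow> int \<Rightarrow> real \<Rightarrow> complex" where
  "basis \<theta> n x = of_real (1 / sqrt L) * wave (freq \<theta> n) x"

lemma basis_L2: "basis \<theta> n \<in> L2 M"
proof -
  interpret finite_measure M by (rule finite_M)
  have "basis \<theta> n \<in> borel_measurable M"
    unfolding basis_def[abs_def] measurable_M using wave_measurable_lebesgue by simp
  moreover have "integrable M (\<lambda>x. (cmod (basis \<theta> n x))\<^sup>2)"
    by (simp add: basis_def norm_divide)
  ultimately show ?thesis
    by (simp add: L2_def)
qed

lemma basis_orthonormal: "l2_inner M (basis \<theta> n) (basis \<theta> m) = (if n = m then 1 else 0)"
proof -
  have eq: "basis \<theta> n x * cnj (basis \<theta> m x) = of_real (1 / L) * wave (2 * pi * of_int (n - m) / L) x" for x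
  proof -
    have "freq \<theta> n + - freq \<theta> m = 2 * pi * of_int (n - m) / L"
      by (simp add: freq_def add_divide_distrib diff_divide_distrib right_diff_distrib)
    moreover have "complex_of_real (1 / sqrt L) * of_real (1 / sqrt L) = of_real (1 / L)"
      using L_pos by (simp flip: of_real_mult)
    moreover have "basis \<theta> n x * cnj (basis \<theta> m x) = (complex_of_real (1 / sqrt L) * of_real (1 / sqrt L))
        * (wave (freq \<theta> n) x * wave (- freq \<theta> m) x)"
      by (simp only: basis_def complex_cnj_mult complex_cnj_complex_of_real cnj_wave mult_ac)
    ultimately show ?thesis
      by (simp only: wave_mult)
  qed
  show ?thesis
    unfolding l2_inner_def eq using integral_wave[of "n - m"] L_pos by simp
qed

text \<open>
  Let \<open>z = exp (2 \<pi> \<i> W / L)\<close>, which maps the line injectively to the circle. If \<open>f\<close> is orthogonal to the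
  basis, then \<open>F = w f exp (- \<i> \<theta> W / L)\<close> integrates to zero against all trigonometric polynomials in
  \<open>z\<close>, hence against all continuous functions of \<open>z\<close> by the Stone-Weierstrass theorem, hence against
  indicators of closed arcs by dominated convergence. Closed arcs that avoid the point \<open>1\<close>
  correspond to the compact intervals of the line, so the primitive of \<open>F\<close> is constant.
\<close>

lemma basis_complete:
  assumes f: "f \<in> L2 M" and orth: "\<And>n. l2_inner M f (basis \<theta> n) = 0"
  shows "AE x in M. f x = 0"
proof -
  interpret finite_measure M by (rule finite_M)
  define z where "z = wave (2 * pi / L)"
  define F where "F x = w x *\<^sub>R (f x * wave (- (\<theta> / L)) x)" for x
  have f_meas: "f \<in> borel_measurable lebesgue"
    using L2_measurable[OF f] by (simp add: measurable_M)
  have wave_L2: "wave r \<in> L2 M" for r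
    using wave_measurable_lebesgue by (simp add: L2_def measurable_M)
  have fw_int: "integrable M (\<lambda>x. f x * wave r x)" for r
    using integrable_L2_mult[OF f wave_L2[of "- r"]] by (simp add: cnj_wave)
  have fw_meas: "(\<lambda>x. f x * wave r x) \<in> borel_measurable lebesgue" for r
    using f_meas wave_measurable_lebesgue by simp
  have F_int: "integrable lebesgue F"
    unfolding F_def[abs_def] using fw_int fw_meas by (simp add: integrable_M[symmetric])
  have z_power: "z x ^ m * cnj (z x) ^ k = wave (2 * pi * of_int (int m - int k) / L) x" for m k x
  proof -
    have pow: "wave r x ^ j = wave (of_nat j * r) x" for r j
      by (simp add: wave_def exp_of_nat_mult[symmetric] algebra_simps)
    show ?thesis
      unfolding z_def cnj_wave pow wave_mult by (simp add: diff_divide_distrib algebra_simps)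
  qed
  have z_meas: "z \<in> borel_measurable lebesgue"
    unfolding z_def by (rule wave_measurable_lebesgue)
  have z_sphere: "z x \<in> sphere 0 1" for x
    by (simp add: z_def)
  have monomial: "integrable lebesgue (\<lambda>x. F x * (c * z x ^ m * cnj (z x) ^ k)) \<and>
      (LINT x|lebesgue. F x * (c * z x ^ m * cnj (z x) ^ k)) = 0" for c m k
  proof -
    define r where "r = - (\<theta> / L) + 2 * pi * of_int (int m - int k) / L"
    have eq: "F x * (c * z x ^ m * cnj (z x) ^ k) = c * (w x *\<^sub>R (f x * wave r x))" for x
    proof -
      have "F x * (c * z x ^ m * cnj (z x) ^ k) = c * (w x *\<^sub>R (f x * (wave (- (\<theta> / L)) x * (z x ^ m * cnj (z x) ^ k))))"
        by (simp add: F_def scaleR_conv_of_real mult_ac)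
      then show ?thesis
        unfolding z_power wave_mult r_def by simp
    qed
    have "(LINT x|M. f x * wave r x) = of_real (sqrt L) * l2_inner M f (basis \<theta> (int k - int m))"
    proof -
      have "- freq \<theta> (int k - int m) = r"
        by (simp add: freq_def r_def add_divide_distrib diff_divide_distrib right_diff_distrib)
      then have "of_real (sqrt L) * (f x * cnj (basis \<theta> (int k - int m) x)) = f x * wave r x" for x
        using L_pos by (simp add: basis_def cnj_wave)
      then show ?thesis
        unfolding l2_inner_def integral_mult_right_zero[symmetric] by (simp only:)
    qed
    then have "(LINT x|lebesgue. w x *\<^sub>R (f x * wave r x)) = 0"
      using orth integral_M[OF fw_meas, of r] by simp
    moreover have "integrable lebesgue (\<lambda>x. w x *\<^sub>R (f x * wave r x))"
      using fw_int[of r] by (simp add: integrable_M[OF fw_meas])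
    ultimately show ?thesis
      unfolding eq integral_mult_right_zero by (intro conjI integrable_mult_right) simp_all
  qed
  have trig: "trig_poly q \<Longrightarrow> integrable lebesgue (\<lambda>x. F x * q (z x)) \<and> (LINT x|lebesgue. F x * q (z x)) = 0" for q
  proof (induction rule: trig_poly.induct)
    case (monomial c m k)
    then show ?case
      by (rule \<open>\<And>c m k. integrable lebesgue (\<lambda>x. F x * (c * z x ^ m * cnj (z x) ^ k)) \<and> _\<close>)
  next
    case (add f g)
    then show ?case
      by (simp add: distrib_left)
  qed
  have cont: "(LINT x|lebesgue. F x * of_real (g (z x))) = 0" "integrable lebesgue (\<lambda>x. F x * of_real (g (z x)))"
    if g: "continuous_on UNIV g" for g :: "complex \<Rightarrow> real"
  proof -
    have "compact (g ` sphere 0 1)"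
      by (intro compact_continuous_image continuous_on_subset[OF g]) auto
    then obtain C where "\<forall>u\<in>sphere 0 1. \<bar>g u\<bar> \<le> C"
      by (auto dest!: compact_imp_bounded simp: bounded_iff)
    then have C: "\<bar>g (z x)\<bar> \<le> C" for x
      using z_sphere by blast
    have gz_meas: "(\<lambda>x. complex_of_real (g (z x))) \<in> borel_measurable lebesgue"
      using measurable_compose[OF z_meas borel_measurable_continuous_onI[OF g]] by simp
    show int: "integrable lebesgue (\<lambda>x. F x * of_real (g (z x)))"
      by (rule integrable_bounded_mult(2)[OF F_int gz_meas, of C]) (simp add: C)
    have "cmod (LINT x|lebesgue. F x * of_real (g (z x))) \<le> \<epsilon> * (LINT x|lebesgue. cmod (F x))"
      if \<epsilon>: "\<epsilon> > 0" for \<epsilon>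
    proof -
      obtain p where p: "real_polynomial_function p" "\<And>x. x \<in> sphere 0 1 \<Longrightarrow> \<bar>g x - p x\<bar> < \<epsilon>"
        by (rule Stone_Weierstrass_real_polynomial_function[OF compact_sphere[of 0 1]
              continuous_on_subset[OF g subset_UNIV] \<epsilon>]) (rule that)
      note t = trig[OF trig_poly_real_polynomial[OF p(1)]]
      have "(LINT x|lebesgue. F x * of_real (g (z x))) = (LINT x|lebesgue. F x * of_real (g (z x)) - F x * of_real (p (z x)))"
        using t int by simp
      also have "cmod \<dots> \<le> (LINT x|lebesgue. cmod (F x * of_real (g (z x)) - F x * of_real (p (z x))))"
        by (rule integral_norm_bound)
      also have "\<dots> \<le> (LINT x|lebesgue. \<epsilon> * cmod (F x))"
      proof (rule integral_mono)
        fix x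
        have "cmod (F x * of_real (g (z x)) - F x * of_real (p (z x))) = \<bar>g (z x) - p (z x)\<bar> * cmod (F x)"
          by (simp add: right_diff_distrib[symmetric] norm_mult mult.commute flip: of_real_diff)
        also have "\<dots> \<le> \<epsilon> * cmod (F x)"
          using p(2)[OF z_sphere, of x] by (intro mult_right_mono) auto
        finally show "cmod (F x * of_real (g (z x)) - F x * of_real (p (z x))) \<le> \<epsilon> * cmod (F x)" .
      qed (use t int F_int in auto)
      finally show ?thesis
        by simp
    qed
    note bound = this
    have "cmod (LINT x|lebesgue. F x * of_real (g (z x))) \<le> 0"
    proof (rule field_le_epsilon)
      fix \<epsilon> :: real assume "\<epsilon> > 0"
      define I where "I = (LINT x|lebesgue. cmod (F x))"
      have "I \<ge> 0"
        by (simp add: I_def)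
      then have "\<epsilon> / (I + 1) * I \<le> \<epsilon>"
        using \<open>\<epsilon> > 0\<close> by (simp add: divide_simps)
      then show "cmod (LINT x|lebesgue. F x * of_real (g (z x))) \<le> 0 + \<epsilon>"
        using bound[of "\<epsilon> / (I + 1)"] \<open>\<epsilon> > 0\<close> \<open>I \<ge> 0\<close> unfolding I_def[symmetric] by force
    qed
    then show "(LINT x|lebesgue. F x * of_real (g (z x))) = 0"
      by simp
  qed
  have arc: "(LINT y|lebesgue. indicator {a..b} y *\<^sub>R F y) = 0" if "a \<le> b" for a b
  proof -
    define C where "C = (\<lambda>s. exp (\<i> * of_real (2 * pi / L * s))) ` {W a..W b}"
    have C: "closed C" "C \<noteq> {}"
    proof -
      have "compact C"
        unfolding C_def by (intro compact_continuous_image continuous_intros) auto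
      then show "closed C"
        by (rule compact_imp_closed)
      show "C \<noteq> {}"
        using that by (simp add: C_def W_le)
    qed
    have z_C: "z y \<in> C \<longleftrightarrow> y \<in> {a..b}" for y
    proof
      assume "y \<in> {a..b}"
      then show "z y \<in> C"
        by (auto simp: C_def z_def wave_def W_le)
    next
      assume "z y \<in> C"
      then obtain s where s: "s \<in> {W a..W b}" "exp (\<i> * of_real (2 * pi / L * W y)) = exp (\<i> * of_real (2 * pi / L * s))"
        unfolding C_def z_def wave_def by blast
      then obtain n where "\<i> * of_real (2 * pi / L * W y) = \<i> * of_real (2 * pi / L * s) + of_real (of_int (2 * n) * pi) * \<i>"
        unfolding exp_eq by auto
      then have "\<i> * of_real (2 * pi / L * W y) = \<i> * of_real (2 * pi / L * s + of_int (2 * n) * pi)"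
        by (simp only: of_real_add distrib_left mult.commute)
      then have "2 * pi / L * W y = 2 * pi / L * s + of_int (2 * n) * pi"
        by (simp only: mult_cancel_left of_real_eq_iff) simp
      then have "2 * pi * (W y - s) = 2 * pi * (of_int n * L)"
        using L_pos by (simp add: field_simps)
      then have n: "W y - s = of_int n * L"
        by simp
      have "W y > 0" "W y < L" "s > 0" "s < L"
        using s(1) W_pos[of a] W_pos[of y] W_less_L[of b] W_less_L[of y] by auto
      then have "\<bar>of_int n * L\<bar> < 1 * L"
        using n by linarith
      then have "\<bar>real_of_int n\<bar> < 1"
        using L_pos by (simp add: abs_mult)
      then have "n = 0"
        by linarith
      then have "W y = s"
        using n by simp
      then show "y \<in> {a..b}"
        using s(1) W_le[of a y] W_le[of y b] by simp
    qed
    \<comment> \<open>Continuous functions that decrease to the indicator of the arc \<open>C\<close>.\<close>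
    define g where "g j u = max 0 (1 - of_nat j * infdist u C)" for j :: nat and u
    have g: "continuous_on UNIV (g j)" for j
      unfolding g_def[abs_def] by (intro continuous_intros)
    have "(\<lambda>j. LINT y|lebesgue. F y * of_real (g j (z y))) \<longlonglongrightarrow> (LINT y|lebesgue. indicator {a..b} y *\<^sub>R F y)"
    proof (rule integral_dominated_convergence)
      show "integrable lebesgue (\<lambda>y. cmod (F y))"
        using F_int by simp
      show "(\<lambda>y. indicator {a..b} y *\<^sub>R F y) \<in> borel_measurable lebesgue"
        by (intro borel_measurable_integrable integrable_mult_indicator F_int) simp
      show "(\<lambda>y. F y * of_real (g j (z y))) \<in> borel_measurable lebesgue" for j
        by (intro borel_measurable_integrable cont(2) g)
      show "AE y in lebesgue. cmod (F y * of_real (g j (z y))) \<le> cmod (F y)" for j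
      proof (rule AE_I2)
        fix y
        have "0 \<le> of_nat j * infdist (z y) C"
          by (simp add: infdist_nonneg)
        then have "\<bar>g j (z y)\<bar> \<le> 1"
          unfolding g_def by linarith
        then show "cmod (F y * of_real (g j (z y))) \<le> cmod (F y)"
          by (simp add: norm_mult mult_left_le)
      qed
      show "AE y in lebesgue. (\<lambda>j. F y * of_real (g j (z y))) \<longlonglongrightarrow> indicator {a..b} y *\<^sub>R F y"
      proof (rule AE_I2)
        fix y
        show "(\<lambda>j. F y * of_real (g j (z y))) \<longlonglongrightarrow> indicator {a..b} y *\<^sub>R F y"
        proof (cases "y \<in> {a..b}")
          case True
          then have "infdist (z y) C = 0"
            using z_C by simp
          then show ?thesis
            using True by (simp add: g_def)
        next
          case False
          then have "z y \<notin> C"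
            using z_C by simp
          then have pos: "infdist (z y) C > 0"
            using C by (metis in_closed_iff_infdist_zero infdist_nonneg less_eq_real_def)
          have "\<forall>\<^sub>F j in sequentially. inverse (infdist (z y) C) \<le> real j"
            using filterlim_real_sequentially by (simp add: filterlim_at_top)
          then have "\<forall>\<^sub>F j in sequentially. F y * of_real (g j (z y)) = 0"
          proof eventually_elim
            case (elim j)
            then have "1 \<le> of_nat j * infdist (z y) C"
              using pos by (simp add: field_simps)
            then show ?case
              by (simp add: g_def)
          qed
          then show ?thesis
            using False by (intro tendsto_eventually) auto
        qed
      qed
    qed
    then show ?thesis
      using cont(1)[OF g] by (simp add: LIMSEQ_const_iff)
  qed
  have const: "primitive F a = primitive F b" for a b
    using primitive_diff[OF F_int, of a b] primitive_diff[OF F_int, of b a] arc[of a b] arc[of b a]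
    by (cases "a \<le> b") auto
  have "primitive F x = 0" for x
  proof -
    have "primitive F = (\<lambda>_. primitive F x)"
      using const by blast
    then have "((\<lambda>_. primitive F x) \<longlongrightarrow> 0) (at_bot :: real filter)"
      using primitive_tendsto_at_bot[OF F_int] by simp
    then show ?thesis
      by (simp add: tendsto_const_iff)
  qed
  then have "AE x in lebesgue. F x = 0"
    by (rule AE_zero_if_primitive_zero[OF F_int])
  then have "AE x in lebesgue. f x = 0"
    using w_pos by eventually_elim (auto simp: F_def wave_def)
  then show ?thesis
    by (simp add: AE_M)
qed

lemma l2_basis: "l2_basis M (basis \<theta>)"
proof (intro l2_basis.intro l2_basis_axioms.intro finite_M basis_L2 basis_orthonormal)
  fix f assume "f \<in> L2 M" "\<And>n. l2_inner M f (basis \<theta> n) = 0"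
  then show "AE x in M. f x = 0"
    by (rule basis_complete)
qed

end

section \<open>Diagonalization of the differential operator\<close>

lemma locally_integrable_measurable:
  assumes "locally_integrable g"
  shows "g \<in> borel_measurable lebesgue"
proof (rule borel_measurable_LIMSEQ_metric)
  fix n :: nat
  have "integrable lebesgue (\<lambda>x. indicator {- real n..real n} x *\<^sub>R g x)"
    using assms by (simp add: locally_integrable_def set_integrable_def)
  then show "(\<lambda>x. indicator {- real n..real n} x *\<^sub>R g x) \<in> borel_measurable lebesgue"
    by (rule borel_measurable_integrable)
next
  fix x :: real
  have "\<forall>\<^sub>F n in sequentially. \<bar>x\<bar> \<le> real n"
    using filterlim_real_sequentially by (simp add: filterlim_at_top)
  then have "\<forall>\<^sub>F n in sequentially. indicator {- real n..real n} x *\<^sub>R g x = g x"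
    by eventually_elim (simp add: abs_le_iff indicator_def)
  then show "(\<lambda>n. indicator {- real n..real n} x *\<^sub>R g x) \<longlonglongrightarrow> g x"
    by (rule tendsto_eventually)
qed

context weight
begin

lemma bounded_continuous_L2:
  assumes u: "continuous_on UNIV u" and bound: "\<And>x. cmod (u x) \<le> C"
  shows "u \<in> L2 M"
proof -
  interpret finite_measure M by (rule finite_M)
  have m: "u \<in> borel_measurable M"
    unfolding measurable_M by (rule lebesgue_measurable_if_borel[OF borel_measurable_continuous_onI[OF u]])
  have "(cmod (u x))\<^sup>2 \<le> C\<^sup>2" for x
    by (rule power_mono[OF bound]) simp
  then have "integrable M (\<lambda>x. (cmod (u x))\<^sup>2)"
    using m by (intro integrable_const_bound[where B = "C\<^sup>2"]) auto
  then show ?thesis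
    using m by (simp add: L2_def)
qed

text \<open>
  The equation \<open>H\<^sub>w u = h\<close> means that \<open>u\<close> has this derivative.
\<close>

definition slope :: "(real \<Rightarrow> complex) \<Rightarrow> real \<Rightarrow> complex" where
  "slope h x = \<i> * of_real (w x) * h x"

lemma slope_integrable:
  assumes h: "h \<in> L2 M"
  shows "integrable lebesgue (slope h)"
proof -
  interpret finite_measure M by (rule finite_M)
  have h_meas: "h \<in> borel_measurable lebesgue"
    using L2_measurable[OF h] by (simp add: measurable_M)
  have "(\<lambda>_. 1) \<in> L2 M"
    by (simp add: L2_def)
  from integrable_L2_mult[OF h this] have "integrable lebesgue (\<lambda>x. w x *\<^sub>R h x)"
    using integrable_M[OF h_meas] by simp
  then have "integrable lebesgue (\<lambda>x. \<i> * (w x *\<^sub>R h x))"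
    by (rule integrable_mult_right)
  then show ?thesis
    by (simp add: slope_def[abs_def] scaleR_conv_of_real mult.assoc)
qed

lemma primitive_slope_L2:
  assumes h: "h \<in> L2 M"
  shows "(\<lambda>x. c + primitive (slope h) x) \<in> L2 M"
proof (rule bounded_continuous_L2)
  show "continuous_on UNIV (\<lambda>x. c + primitive (slope h) x)"
    by (intro continuous_intros continuous_on_primitive slope_integrable h)
  show "cmod (c + primitive (slope h) x) \<le> cmod c + (LINT y|lebesgue. norm (slope h y))" for x
    using norm_primitive_le[OF slope_integrable[OF h], of x]
    by (intro order.trans[OF norm_triangle_ineq]) simp
qed

lemma exp_Arg:
  assumes "cmod \<alpha> = 1"
  shows "exp (\<i> * of_real (Arg \<alpha>)) = \<alpha>"
  using Arg_eq[of \<alpha>] assms by (metis mult_1 norm_zero of_real_1 zero_neq_one)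

lemma exp_freq:
  assumes "cmod \<alpha> = 1"
  shows "exp (\<i> * of_real (freq (Arg \<alpha>) n * L)) = \<alpha>"
proof -
  have "\<i> * of_real (freq (Arg \<alpha>) n * L) = \<i> * of_real (Arg \<alpha>) + of_int (2 * n) * (of_real pi * \<i>)"
  proof -
    have "freq (Arg \<alpha>) n * L = Arg \<alpha> + 2 * pi * of_int n"
      using L_pos by (simp add: freq_def)
    then show ?thesis
      by (simp add: algebra_simps)
  qed
  also have "exp \<dots> = \<alpha> * exp (of_int (2 * n) * (of_real pi * \<i>))"
    by (simp only: exp_add exp_Arg[OF assms])
  also have "exp (of_int (2 * n) * (of_real pi * \<i>)) = 1"
    by (simp add: exp_eq_1)
  finally show ?thesis
    by simp
qed

text \<open>
  Integration by parts against \<open>e\<^sub>n\<close>. The boundary term vanishes exactly if \<open>u = c + primitive (slope h)\<close>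
  satisfies the boundary condition; it is the same for all \<open>n\<close> because all \<open>e\<^sub>n\<close> have the same
  limits at \<open>-\<infinity>\<close> and \<open>\<infinity>\<close>.
\<close>

lemma green_formula:
  assumes \<alpha>: "cmod \<alpha> = 1" and h: "h \<in> L2 M"
  defines "I \<equiv> integral\<^sup>L lebesgue (slope h)"
  shows "l2_inner M h (basis (Arg \<alpha>) n)
    = of_real (freq (Arg \<alpha>) n) * l2_inner M (\<lambda>x. c + primitive (slope h) x) (basis (Arg \<alpha>) n)
      - \<i> / of_real (sqrt L) * (cnj \<alpha> * (c + I) - c)"
proof -
  define r where "r = freq (Arg \<alpha>) n"
  define u where "u x = c + primitive (slope h) x" for x
  define p where "p y = of_real (w y) * (\<i> * of_real (- r) * wave (- r) y)" for y
  note q = slope_integrable[OF h]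
  have p: "integrable lebesgue p" "primitive p x = wave (- r) x - 1" for x
    unfolding p_def[abs_def] by (rule wave_primitive)+
  have int_p: "integral\<^sup>L lebesgue p = cnj \<alpha> - 1"
  proof (rule tendsto_unique[OF trivial_limit_at_top_linorder])
    show "(primitive p \<longlongrightarrow> integral\<^sup>L lebesgue p) at_top"
      by (rule primitive_tendsto_at_top[OF p(1)])
    have "exp (\<i> * of_real (- r * L)) = cnj (exp (\<i> * of_real (r * L)))"
      by (simp add: exp_cnj)
    also have "\<dots> = cnj \<alpha>"
      by (simp only: r_def exp_freq[OF \<alpha>])
    finally show "(primitive p \<longlongrightarrow> cnj \<alpha> - 1) at_top"
      unfolding p(2)[abs_def] using tendsto_diff[OF wave_at_top[of "- r"] tendsto_const[of 1]] by simp
  qed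
  have u_meas: "u \<in> borel_measurable lebesgue"
    using L2_measurable[OF primitive_slope_L2[OF h, of c]] by (simp add: measurable_M u_def[abs_def])
  have h_meas: "h \<in> borel_measurable lebesgue"
    using L2_measurable[OF h] by (simp add: measurable_M)
  have prim_bound: "integrable lebesgue (\<lambda>x. primitive (slope h) x * p x)"
    by (rule integrable_bounded_mult(1)[OF p(1) _ norm_primitive_le[OF q]])
       (rule lebesgue_measurable_if_borel[OF primitive_measurable[OF q]])
  have qv_int: "integrable lebesgue (\<lambda>x. slope h x * wave (- r) x)"
    by (rule integrable_bounded_mult(2)[OF q wave_measurable_lebesgue, of _ 1]) simp
  have "(LINT x|lebesgue. primitive (slope h) x * p x) + (LINT x|lebesgue. slope h x * primitive p x)
      = I * (cnj \<alpha> - 1)"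
    using primitive_by_parts[OF q p(1)] by (simp add: I_def int_p)
  also have "(LINT x|lebesgue. slope h x * primitive p x) = (LINT x|lebesgue. slope h x * wave (- r) x) - I"
    using qv_int q by (simp add: p(2) right_diff_distrib I_def)
  also have "(LINT x|lebesgue. primitive (slope h) x * p x) = (LINT x|lebesgue. u x * p x) - c * (cnj \<alpha> - 1)"
    using prim_bound p(1) by (simp add: u_def distrib_right int_p)
  finally have sum: "(LINT x|lebesgue. u x * p x) + (LINT x|lebesgue. slope h x * wave (- r) x)
      = cnj \<alpha> * (c + I) - c"
    by (simp add: algebra_simps)
  have cnj_basis: "cnj (basis (Arg \<alpha>) n x) = of_real (1 / sqrt L) * wave (- r) x" for x
    by (simp add: basis_def cnj_wave r_def)
  have inner: "l2_inner M f (basis (Arg \<alpha>) n) = of_real (1 / sqrt L) * (LINT x|lebesgue. of_real (w x) * (f x * wave (- r) x))"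
    if f: "f \<in> borel_measurable lebesgue" for f
  proof -
    have "l2_inner M f (basis (Arg \<alpha>) n) = (LINT x|M. of_real (1 / sqrt L) * (f x * wave (- r) x))"
      unfolding l2_inner_def cnj_basis by (simp only: mult.left_commute)
    also have "\<dots> = of_real (1 / sqrt L) * (LINT x|M. f x * wave (- r) x)"
      by (rule integral_mult_right_zero)
    also have "(LINT x|M. f x * wave (- r) x) = (LINT x|lebesgue. w x *\<^sub>R (f x * wave (- r) x))"
      using f wave_measurable_lebesgue by (intro integral_M) simp
    finally show ?thesis
      by (simp only: scaleR_conv_of_real)
  qed
  have "(LINT x|lebesgue. u x * p x) = (LINT x|lebesgue. - (\<i> * of_real r) * (of_real (w x) * (u x * wave (- r) x)))"
    by (intro Bochner_Integration.integral_cong) (simp_all add: p_def)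
  then have 1: "(LINT x|lebesgue. u x * p x) = - (\<i> * of_real r) * (LINT x|lebesgue. of_real (w x) * (u x * wave (- r) x))"
    by (simp only: integral_mult_right_zero)
  have "(LINT x|lebesgue. slope h x * wave (- r) x) = (LINT x|lebesgue. \<i> * (of_real (w x) * (h x * wave (- r) x)))"
    by (intro Bochner_Integration.integral_cong) (simp_all add: slope_def)
  then have 2: "(LINT x|lebesgue. slope h x * wave (- r) x) = \<i> * (LINT x|lebesgue. of_real (w x) * (h x * wave (- r) x))"
    by (simp only: integral_mult_right_zero)
  have eq: "(LINT x|lebesgue. of_real (w x) * (h x * wave (- r) x))
      = of_real r * (LINT x|lebesgue. of_real (w x) * (u x * wave (- r) x)) - \<i> * (cnj \<alpha> * (c + I) - c)"
    unfolding sum[symmetric] 1 2 by (simp add: algebra_simps)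
  have "l2_inner M h (basis (Arg \<alpha>) n)
      = of_real r * l2_inner M u (basis (Arg \<alpha>) n) - \<i> / of_real (sqrt L) * (cnj \<alpha> * (c + I) - c)"
    unfolding inner[OF h_meas] inner[OF u_meas] eq right_diff_distrib by (simp add: mult_ac)
  then show ?thesis
    by (simp only: r_def u_def[abs_def])
qed

text \<open>
  The continuous representative of \<open>f\<close> is \<open>c + primitive (slope h)\<close>, and its limits at \<open>-\<infinity>\<close> and \<open>\<infinity>\<close> are
  \<open>c\<close> and \<open>c + I\<close>.
\<close>

lemma H_graph_imp_eigen:
  assumes \<alpha>: "cmod \<alpha> = 1" and H: "(f, h) \<in> H_graph w \<alpha>"
  shows "l2_inner M h (basis (Arg \<alpha>) n) = of_real (freq (Arg \<alpha>) n) * l2_inner M f (basis (Arg \<alpha>) n)"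
proof -
  obtain g u lp lm where f: "f \<in> L2 M" and h: "h \<in> L2 M" and g: "has_weak_derivative f g"
    and hg: "AE x in lebesgue. h x = - (\<i> / complex_of_real (w x)) * g x"
    and u: "continuous_on UNIV u" "AE x in lebesgue. u x = f x"
    and lim: "(u \<longlongrightarrow> lp) at_top" "(u \<longlongrightarrow> lm) at_bot" "lp = \<alpha> * lm"
    using H by (auto simp: H_graph_def boundary_condition_def)
  note q = slope_integrable[OF h]
  have "g \<in> borel_measurable lebesgue"
    using g by (auto simp: has_weak_derivative_def intro: locally_integrable_measurable)
  moreover have vg: "AE x in lebesgue. slope h x = g x"
    using hg w_pos by eventually_elim (simp add: slope_def)
  ultimately have g_int: "integrable lebesgue g"
    using integrable_cong_AE_imp[OF q] by blast
  have f_meas: "f \<in> borel_measurable lebesgue"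
    using L2_measurable[OF f] by (simp add: measurable_M)
  obtain c where "\<And>x. u x = c + primitive g x"
    by (rule weak_derivative_integrable_imp_primitive[OF g g_int f_meas u]) (rule that)
  moreover have "primitive g = primitive (slope h)"
  proof
    fix x
    have "AE y in lebesgue. indicator {..x} y *\<^sub>R g y = indicator {..x} y *\<^sub>R slope h y"
      using vg by eventually_elim simp
    then show "primitive g x = primitive (slope h) x"
      unfolding primitive_def
      by (intro integral_cong_AE borel_measurable_integrable primitive_integrable g_int q)
  qed
  ultimately have u_eq: "u = (\<lambda>x. c + primitive (slope h) x)"
    by auto
  have "lp = c + integral\<^sup>L lebesgue (slope h)"
    using tendsto_unique[OF trivial_limit_at_top_linorder lim(1)]
      tendsto_add[OF tendsto_const primitive_tendsto_at_top[OF q], of c] by (simp add: u_eq)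
  moreover have "lm = c"
    using tendsto_unique[OF trivial_limit_at_bot_linorder lim(2)]
      tendsto_add[OF tendsto_const primitive_tendsto_at_bot[OF q], of c] by (simp add: u_eq)
  ultimately have "c + integral\<^sup>L lebesgue (slope h) = \<alpha> * c"
    using lim(3) by simp
  moreover have "cnj \<alpha> * \<alpha> = 1"
    using \<alpha> complex_norm_square[of \<alpha>] by (simp add: mult.commute)
  ultimately have "cnj \<alpha> * (c + integral\<^sup>L lebesgue (slope h)) - c = 0"
    by (simp add: mult.assoc[symmetric])
  then have "l2_inner M h (basis (Arg \<alpha>) n) = of_real (freq (Arg \<alpha>) n) * l2_inner M u (basis (Arg \<alpha>) n)"
    using green_formula[OF \<alpha> h, of n c] by (simp add: u_eq)
  also have "l2_inner M u (basis (Arg \<alpha>) n) = l2_inner M f (basis (Arg \<alpha>) n)"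
    using u(2) primitive_slope_L2[OF h, of c]
    by (intro l2_inner_cong_AE f basis_L2) (simp_all add: u_eq AE_M)
  finally show ?thesis .
qed

lemma H_graphI:
  assumes f: "f \<in> L2 M" and h: "h \<in> L2 M"
    and fu: "AE x in M. c + primitive (slope h) x = f x"
    and bc: "c + integral\<^sup>L lebesgue (slope h) = \<alpha> * c"
  shows "(f, h) \<in> H_graph w \<alpha>"
proof -
  let ?u = "\<lambda>x. c + primitive (slope h) x"
  note q = slope_integrable[OF h]
  have f_meas: "f \<in> borel_measurable lebesgue"
    using L2_measurable[OF f] by (simp add: measurable_M)
  have weak: "has_weak_derivative f (slope h)"
    using fu by (intro primitive_has_weak_derivative[OF q f_meas, of c]) (simp add: AE_M)
  have hq: "AE x in lebesgue. h x = - (\<i> / complex_of_real (w x)) * slope h x"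
    using w_pos by eventually_elim (simp add: slope_def)
  have "boundary_condition \<alpha> f"
    unfolding boundary_condition_def
  proof (intro exI conjI)
    show "continuous_on UNIV ?u"
      by (intro continuous_intros continuous_on_primitive q)
    show "AE x in lebesgue. ?u x = f x"
      using fu by (simp add: AE_M)
    show "(?u \<longlongrightarrow> c + integral\<^sup>L lebesgue (slope h)) at_top"
      by (intro tendsto_intros primitive_tendsto_at_top q)
    show "(?u \<longlongrightarrow> c) at_bot"
      using tendsto_add[OF tendsto_const primitive_tendsto_at_bot[OF q], of c] by simp
  qed (rule bc)
  then show ?thesis
    using f h weak hq by (auto simp: H_graph_def)
qed

text \<open>
  For every \<open>c\<close> the function \<open>u c = c + primitive (slope h)\<close> solves the differential equation; one has to choose \<open>c\<close> so
  that it satisfies the boundary condition and has the coefficients of \<open>f\<close>. If \<open>\<alpha> \<noteq> 1\<close>, the boundary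
  condition determines \<open>c\<close>, and the coefficients agree because no eigenvalue is zero. If
  \<open>\<alpha> = 1\<close>, then Green's formula at the eigenvalue zero shows \<open>I = 0\<close>, so every \<open>c\<close> satisfies the boundary
  condition, and \<open>c\<close> is chosen to match the coefficient of the constant function.
\<close>

lemma eigen_imp_H_graph:
  assumes \<alpha>: "cmod \<alpha> = 1" and f: "f \<in> L2 M" and h: "h \<in> L2 M"
    and eigen: "\<And>n. l2_inner M h (basis (Arg \<alpha>) n) = of_real (freq (Arg \<alpha>) n) * l2_inner M f (basis (Arg \<alpha>) n)"
  shows "(f, h) \<in> H_graph w \<alpha>"
proof -
  interpret l2_basis M "basis (Arg \<alpha>)"
    by (rule l2_basis)
  define I where "I = integral\<^sup>L lebesgue (slope h)"
  define u where "u c x = c + primitive (slope h) x" for c x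
  have u: "u c \<in> L2 M" for c
    unfolding u_def[abs_def] by (rule primitive_slope_L2[OF h])
  have green: "of_real (freq (Arg \<alpha>) n) * (hat f n - hat (u c) n) = - (\<i> / of_real (sqrt L)) * (cnj \<alpha> * (c + I) - c)" for n c
    using green_formula[OF \<alpha> h, of n c] eigen[of n]
    by (simp add: hat_def u_def[abs_def] I_def right_diff_distrib algebra_simps)
  have \<alpha>1: "cnj \<alpha> * \<alpha> = 1"
    using \<alpha> complex_norm_square[of \<alpha>] by (simp add: mult.commute)
  have "\<exists>c. c + I = \<alpha> * c \<and> (\<forall>n. hat (u c) n = hat f n)"
  proof (cases "\<alpha> = 1")
    case False
    define c where "c = I / (\<alpha> - 1)"
    have bc: "c + I = \<alpha> * c"
      using False by (simp add: c_def field_simps)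
    have "hat (u c) n = hat f n" for n
    proof -
      have "freq (Arg \<alpha>) n \<noteq> 0"
        using exp_freq[OF \<alpha>, of n] False by auto
      moreover have "of_real (freq (Arg \<alpha>) n) * (hat f n - hat (u c) n) = 0"
        unfolding green bc using \<alpha>1 by (simp add: mult.assoc[symmetric])
      ultimately show ?thesis
        by simp
    qed
    then show ?thesis
      using bc by blast
  next
    case True
    have freq: "freq (Arg \<alpha>) n = 2 * pi * of_int n / L" for n
      using True by (simp add: freq_def)
    have "complex_of_real (freq (Arg \<alpha>) 0) = 0"
      by (simp only: freq) simp
    then have "\<i> / of_real (sqrt L) * (cnj \<alpha> * I) = 0"
      using green[of 0 0] by simp
    then have "I = 0"
      using L_pos True by simp
    define c where "c = (hat f 0 - hat (u 0) 0) / of_real (sqrt L)"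
    have u_c: "u c = (\<lambda>x. u 0 x + (c * of_real (sqrt L)) * basis (Arg \<alpha>) 0 x)"
      using L_pos by (auto simp: u_def basis_def freq wave_0)
    have hat_u: "hat (u c) n = hat (u 0) n + c * of_real (sqrt L) * (if n = 0 then 1 else 0)" for n
      unfolding u_c by (simp add: hat_lincomb u basis_L2 hat_basis)
    have "hat (u c) n = hat f n" for n
    proof (cases "n = 0")
      case True
      then show ?thesis
        using L_pos by (simp add: hat_u) (simp add: c_def)
    next
      case False
      have "of_real (freq (Arg \<alpha>) n) * (hat f n - hat (u c) n) = 0"
        unfolding green by (simp add: True \<open>I = 0\<close>)
      then show ?thesis
        using False L_pos by (simp add: freq)
    qed
    then show ?thesis
      using True \<open>I = 0\<close> by auto
  qed
  then obtain c where bc: "c + I = \<alpha> * c" and hat: "\<And>n. hat (u c) n = hat f n"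
    by blast
  have "AE x in M. u c x = f x"
    by (rule eq_AE_if_hat_eq[OF u f hat])
  then show ?thesis
    using bc by (intro H_graphI[OF f h, of c]) (simp_all add: u_def I_def)
qed

lemma H_graph_eq_diag:
  assumes \<alpha>: "cmod \<alpha> = 1"
  shows "H_graph w \<alpha> = l2_basis.diag M (basis (Arg \<alpha>)) (\<lambda>n. of_real (freq (Arg \<alpha>) n))"
proof -
  interpret l2_basis M "basis (Arg \<alpha>)"
    by (rule l2_basis)
  have "(f, h) \<in> H_graph w \<alpha> \<longleftrightarrow> (f, h) \<in> diag (\<lambda>n. of_real (freq (Arg \<alpha>) n))" for f h
  proof
    assume H: "(f, h) \<in> H_graph w \<alpha>"
    then have "f \<in> L2 M" "h \<in> L2 M"
      by (simp_all add: H_graph_def)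
    then show "(f, h) \<in> diag (\<lambda>n. of_real (freq (Arg \<alpha>) n))"
      using H_graph_imp_eigen[OF \<alpha> H] by (simp add: diag_def hat_def)
  next
    assume "(f, h) \<in> diag (\<lambda>n. of_real (freq (Arg \<alpha>) n))"
    then show "(f, h) \<in> H_graph w \<alpha>"
      by (intro eigen_imp_H_graph[OF \<alpha>]) (simp_all add: diag_def hat_def)
  qed
  then show ?thesis
    by (intro set_eqI) (simp only: split_paired_all)
qed

text \<open>
  The operator on the given domain is already self-adjoint, so it is its own self-adjoint
  extension, and self-adjoint extensions are unique.
\<close>

lemma H_op_eq_diag:
  assumes \<alpha>: "cmod \<alpha> = 1"
  shows "H_op w \<alpha> = l2_basis.diag M (basis (Arg \<alpha>)) (\<lambda>n. of_real (freq (Arg \<alpha>) n))"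
proof -
  interpret l2_basis M "basis (Arg \<alpha>)"
    by (rule l2_basis)
  have sa: "selfadjoint M (H_graph w \<alpha>)"
    unfolding H_graph_eq_diag[OF \<alpha>] by (rule selfadjoint_diag)
  have "H_op w \<alpha> = H_graph w \<alpha>"
    unfolding H_op_def using sa selfadjoint_extension_unique[OF sa] by (intro the_equality) auto
  then show ?thesis
    by (simp only: H_graph_eq_diag[OF \<alpha>])
qed

text \<open>
  For \<open>n \<noteq> 0\<close> the numerator \<open>\<theta> + 2 \<pi> n\<close> has modulus at least \<open>\<pi>\<close>, since \<open>\<bar>\<theta>\<bar> \<le> \<pi>\<close>.
\<close>

lemma freq_gap:
  assumes "-pi < \<theta>" "\<theta> \<le> pi"
  obtains \<delta> where "\<delta> > 0" "\<And>n. freq \<theta> n = 0 \<or> \<delta> \<le> \<bar>freq \<theta> n\<bar>"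
proof -
  define \<gamma> where "\<gamma> = (if \<theta> = 0 then pi else \<bar>\<theta>\<bar>)"
  have \<gamma>: "0 < \<gamma>"
    by (simp add: \<gamma>_def)
  have "\<theta> + 2 * pi * of_int n = 0 \<or> \<gamma> \<le> \<bar>\<theta> + 2 * pi * of_int n\<bar>" for n
  proof (cases "n = 0")
    case True
    then show ?thesis
      by (simp add: \<gamma>_def)
  next
    case False
    then have "1 \<le> \<bar>real_of_int n\<bar>"
      by linarith
    then have "2 * pi * 1 \<le> 2 * pi * \<bar>real_of_int n\<bar>"
      by (intro mult_left_mono) auto
    also have "\<dots> = \<bar>2 * pi * of_int n\<bar>"
      by (simp add: abs_mult)
    finally have "pi \<le> \<bar>\<theta> + 2 * pi * of_int n\<bar>"
      using assms by linarith
    moreover have "\<gamma> \<le> pi"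
      using assms by (auto simp: \<gamma>_def)
    ultimately show ?thesis
      by linarith
  qed
  note gap = this
  have "freq \<theta> n = 0 \<or> \<gamma> / L \<le> \<bar>freq \<theta> n\<bar>" for n
  proof -
    have "\<bar>freq \<theta> n\<bar> = \<bar>\<theta> + 2 * pi * of_int n\<bar> / L"
      using L_pos by (simp add: freq_def)
    then show ?thesis
      using gap[of n] L_pos by (auto simp: freq_def intro!: divide_right_mono)
  qed
  then show thesis
    using \<gamma> L_pos by (intro that[of "\<gamma> / L"]) auto
qed

end

theorem theorem1p5:
  fixes w :: "real \<Rightarrow> real" and \<alpha> :: complex
  assumes "AE x in lebesgue. 0 < w x"
    and "integrable lebesgue w"
    and "\<exists>C. AE x in lebesgue. \<bar>w x\<bar> \<le> C"
    and "cmod \<alpha> = 1"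
  shows "op_norm_tendsto (weighted_measure w)
           (\<lambda>T. time_average (weighted_measure w) (exp_it (weighted_measure w) (H_op w \<alpha>)) T)
           (orth_proj (weighted_measure w) (op_kernel (H_op w \<alpha>)))
           at_top"
proof -
  interpret weight w
    using assms(1,2) by (rule weight.intro)
  interpret l2_basis "weighted_measure w" "basis (Arg \<alpha>)"
    by (rule l2_basis)
  obtain \<delta> where "\<delta> > 0" "\<And>n. freq (Arg \<alpha>) n = 0 \<or> \<delta> \<le> \<bar>freq (Arg \<alpha>) n\<bar>"
    by (rule freq_gap[OF mpi_less_Arg Arg_le_pi]) (rule that)
  then show ?thesis
    unfolding H_op_eq_diag[OF assms(4)] by (rule time_averages_converge_if_gap)
qed

end
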